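(* Let $p$ be a prime number and let $G=G_1\times G_2$ be a product of two finite $p$-groups $G_1$ and $G_2$. There is an algorithm whose output is a formula $\Phi_G$ for $G$ and whose inputs are formulas for all groups in $\mathcal F_{G_1}\cup\mathcal F_{G_2}$.
   Context: Rings are associative with unit, not necessarily commutative; groups act on rings by ring automorphisms. For a finite group $U$ acting on a ring $R$, $N_U(x)=\sum_{g\in U}g(x)$. A group is elementary abelian if it is isomorphic to $C_q^r$ for some prime $q$ and $r\ge1$ ($C_n$ is the cyclic group of order $n$). For a finite group $G$, $\mathcal E_G$ is the set of elementary abelian subgroups of $G$. A formula for a finite group $G$ is a polynomial $\Phi_G$ in noncommuting variables $g(x_E)$ ($g\in G$, $E\in\mathcal E_G$), with coefficients in $\mathbf Z$, such that: whenever $G$ acts on a ring $R$ and $(x_E)_{E\in\mathcal E_G}$ is a family of elements of $R$ with $N_E(x_E)=1$ for all $E\in\mathcal E_G$, the element $x_G\in R$ obtained by replacing in $\Phi_G$ each variable $g(x_E)$ by the value of the action of $g$ on $x_E\in R$ satisfies $N_G(x_G)=1$. A $p$-group $G$ is extraspecial (resp. almost extraspecial) if it fits into a central extension $1\to C_p\to G\to C_p^r\to1$ with $r\ge1$ and the center of $G$ is isomorphic to $C_p$ (resp. to $C_{p^2}$). For a $p$-group $G$, $\mathcal F_G$ is the set of isomorphism classes of groups that are subquotients of $G$ (homomorphic images of subgroups of $G$) and are extraspecial or almost extraspecial. *)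

theory Defs
  imports "HOL-Algebra.Algebra" "HOL-Library.Nat_Bijection" "HOL-Library.Countable_Set"
begin

section \<open>Groups\<close>

definition center :: "('a, 'm) monoid_scheme \<Rightarrow> 'a set" where
  "center G = {z \<in> carrier G. \<forall>x\<in>carrier G. z \<otimes>\<^bsub>G\<^esub> x = x \<otimes>\<^bsub>G\<^esub> z}"

abbreviation cyclic_power :: "nat \<Rightarrow> nat \<Rightarrow> (nat \<Rightarrow> int) monoid" where
  "cyclic_power q r \<equiv> product_group {..<r} (\<lambda>_. integer_mod_group q)"

definition elementary_abelian :: "('a, 'm) monoid_scheme \<Rightarrow> bool" where
  "elementary_abelian E \<longleftrightarrow> group E \<and> (\<exists>q r. Factorial_Ring.prime q \<and> 1 \<le> r \<and> E \<cong> cyclic_power q r)"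

definition elem_ab_subgroups :: "('a, 'm) monoid_scheme \<Rightarrow> 'a set set" where
  "elem_ab_subgroups G = {E. subgroup E G \<and> elementary_abelian (G\<lparr>carrier := E\<rparr>)}"

text \<open>The trivial group is a \<open>p\<close>-group for every \<open>p\<close>.\<close>

definition fin_p_group :: "nat \<Rightarrow> ('a, 'm) monoid_scheme \<Rightarrow> bool" where
  "fin_p_group p G \<longleftrightarrow> group G \<and> finite (carrier G) \<and> (\<exists>n. order G = p ^ n)"

text \<open>\<open>G\<close> fits into a central extension \<open>1 \<rightarrow> C\<^sub>p \<rightarrow> G \<rightarrow> C\<^sub>p\<^sup>r \<rightarrow> 1\<close> with \<open>r \<ge> 1\<close>.\<close>

definition central_ext :: "nat \<Rightarrow> ('a, 'm) monoid_scheme \<Rightarrow> bool" where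
  "central_ext p G \<longleftrightarrow>
     (\<exists>r i \<pi>. 1 \<le> r \<and> i \<in> mon (integer_mod_group p) G \<and> \<pi> \<in> epi G (cyclic_power p r) \<and>
        i ` carrier (integer_mod_group p) = kernel G (cyclic_power p r) \<pi> \<and>
        i ` carrier (integer_mod_group p) \<subseteq> center G)"

definition extraspecial :: "nat \<Rightarrow> ('a, 'm) monoid_scheme \<Rightarrow> bool" where
  "extraspecial p G \<longleftrightarrow> fin_p_group p G \<and> central_ext p G \<and>
     G\<lparr>carrier := center G\<rparr> \<cong> integer_mod_group p"

definition almost_extraspecial :: "nat \<Rightarrow> ('a, 'm) monoid_scheme \<Rightarrow> bool" where
  "almost_extraspecial p G \<longleftrightarrow> fin_p_group p G \<and> central_ext p G \<and>
     G\<lparr>carrier := center G\<rparr> \<cong> integer_mod_group (p ^ 2)"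

definition subquotient :: "('a, 'm) monoid_scheme \<Rightarrow> ('b, 'n) monoid_scheme \<Rightarrow> bool" where
  "subquotient K G \<longleftrightarrow> group K \<and> (\<exists>H h. subgroup H G \<and> h \<in> epi (G\<lparr>carrier := H\<rparr>) K)"

text \<open>
  The set of isomorphism classes \<open>\<F>\<^sub>G\<close> is given by the class of all its members with
  underlying set contained in the natural numbers; every finite group is isomorphic to such a
  group. The quotient by isomorphism is taken care of in \<open>formula_family\<close> below.
\<close>

definition FF :: "nat \<Rightarrow> ('a, 'm) monoid_scheme \<Rightarrow> nat monoid set" where
  "FF p G = {K. subquotient K G \<and> (extraspecial p K \<or> almost_extraspecial p K)}"


section \<open>Norms and formulas\<close>

definition ring_action :: "('g, 'm) monoid_scheme \<Rightarrow> 'r ring \<Rightarrow> ('g \<Rightarrow> 'r \<Rightarrow> 'r) \<Rightarrow> bool" where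
  "ring_action G R \<phi> \<longleftrightarrow>
     ring R \<and> group_action G (carrier R) \<phi> \<and> (\<forall>g\<in>carrier G. \<phi> g \<in> ring_iso R R)"

definition Nrm :: "'r ring \<Rightarrow> ('g \<Rightarrow> 'r \<Rightarrow> 'r) \<Rightarrow> 'g set \<Rightarrow> 'r \<Rightarrow> 'r" where
  "Nrm R \<phi> U x = (\<Oplus>\<^bsub>R\<^esub>g\<in>U. \<phi> g x)"

text \<open>
  The pair \<open>(g, E)\<close> stands for the variable \<open>g(x\<^sub>E)\<close>. The list
  \<open>[(c\<^sub>1, w\<^sub>1), \<dots>, (c\<^sub>k, w\<^sub>k)]\<close> denotes the noncommutative polynomial
  \<open>c\<^sub>1 w\<^sub>1 + \<dots> + c\<^sub>k w\<^sub>k\<close> with integer coefficients \<open>c\<^sub>i\<close> and words \<open>w\<^sub>i\<close> in the variables;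
  words may be repeated.
\<close>

type_synonym 'g poly_expr = "(int \<times> ('g \<times> 'g set) list) list"

definition eval_word :: "'r ring \<Rightarrow> ('g \<Rightarrow> 'r \<Rightarrow> 'r) \<Rightarrow> ('g set \<Rightarrow> 'r) \<Rightarrow> ('g \<times> 'g set) list \<Rightarrow> 'r" where
  "eval_word R \<phi> x w = foldr (\<lambda>(g, E) y. \<phi> g (x E) \<otimes>\<^bsub>R\<^esub> y) w \<one>\<^bsub>R\<^esub>"

definition eval_expr :: "'r ring \<Rightarrow> ('g \<Rightarrow> 'r \<Rightarrow> 'r) \<Rightarrow> ('g set \<Rightarrow> 'r) \<Rightarrow> 'g poly_expr \<Rightarrow> 'r" where
  "eval_expr R \<phi> x \<Phi> =
     foldr (\<lambda>(c, w) y. ([c] \<cdot>\<^bsub>R\<^esub> eval_word R \<phi> x w) \<oplus>\<^bsub>R\<^esub> y) \<Phi> \<zero>\<^bsub>R\<^esub>"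

definition expr_over :: "('g, 'm) monoid_scheme \<Rightarrow> 'g poly_expr \<Rightarrow> bool" where
  "expr_over G \<Phi> \<longleftrightarrow> (\<forall>(c, w)\<in>set \<Phi>. set w \<subseteq> carrier G \<times> elem_ab_subgroups G)"

definition valid_in :: "'r ring \<Rightarrow> ('g, 'm) monoid_scheme \<Rightarrow> 'g poly_expr \<Rightarrow> bool" where
  "valid_in R G \<Phi> \<longleftrightarrow>
     (\<forall>\<phi> x. ring_action G R \<phi> \<and>
        (\<forall>E\<in>elem_ab_subgroups G. x E \<in> carrier R \<and> Nrm R \<phi> E (x E) = \<one>\<^bsub>R\<^esub>) \<longrightarrow>
        Nrm R \<phi> (carrier G) (eval_expr R \<phi> x \<Phi>) = \<one>\<^bsub>R\<^esub>)"

text \<open>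
  A definition cannot quantify over types. Quantifying over all rings whose carrier is any set of
  natural numbers is the same as quantifying over all rings: this is proved in
  \<open>is_formula_all_rings\<close> below for rings over an arbitrary type.
\<close>

definition is_formula :: "('g, 'm) monoid_scheme \<Rightarrow> 'g poly_expr \<Rightarrow> bool" where
  "is_formula G \<Phi> \<longleftrightarrow> expr_over G \<Phi> \<and> (\<forall>R :: nat ring. valid_in R G \<Phi>)"


subsection \<open>A formula is valid in rings over any type\<close>

lemma hom_eval_expr:
  assumes "ring_hom_ring R S h" "ring_action G R \<phi>"
    and x: "\<And>E. E \<in> elem_ab_subgroups G \<Longrightarrow> x E \<in> carrier R"
    and eq: "\<And>g y. g \<in> carrier G \<Longrightarrow> y \<in> carrier R \<Longrightarrow> h (\<phi> g y) = \<psi> g (h y)"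
    and \<Phi>: "expr_over G \<Phi>"
  shows "eval_expr R \<phi> x \<Phi> \<in> carrier R"
    and "h (eval_expr R \<phi> x \<Phi>) = eval_expr S \<psi> (h \<circ> x) \<Phi>"
proof -
  interpret ring_hom_ring R S h by fact
  interpret act: group_action G "carrier R" \<phi> using assms(2) by (simp add: ring_action_def)
  have w: "eval_word R \<phi> x w \<in> carrier R \<and> h (eval_word R \<phi> x w) = eval_word S \<psi> (h \<circ> x) w"
    if "set w \<subseteq> carrier G \<times> elem_ab_subgroups G" for w
    using that
  proof (induction w)
    case Nil then show ?case by (simp add: eval_word_def)
  next
    case (Cons v w)
    obtain g E where v: "v = (g, E)" "g \<in> carrier G" "E \<in> elem_ab_subgroups G"
      using Cons.prems by (cases v) auto
    have "\<phi> g (x E) \<in> carrier R" using v x act.element_image by blast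
    then show ?case using Cons v x eq by (simp add: eval_word_def)
  qed
  interpret A: group_hom "add_monoid R" "add_monoid S" h
    using a_group_hom .
  have pw: "[c] \<cdot>\<^bsub>R\<^esub> y \<in> carrier R" "h ([c] \<cdot>\<^bsub>R\<^esub> y) = [c] \<cdot>\<^bsub>S\<^esub> h y"
    if "y \<in> carrier R" for c :: int and y
    using that A.hom_int_pow[of y c] R.add.int_pow_closed[of y c] by (simp_all add: add_pow_def)
  have "eval_expr R \<phi> x \<Phi> \<in> carrier R \<and> h (eval_expr R \<phi> x \<Phi>) = eval_expr S \<psi> (h \<circ> x) \<Phi>"
    using \<Phi>
  proof (induction \<Phi>)
    case Nil then show ?case by (simp add: eval_expr_def)
  next
    case (Cons t \<Phi>)
    then show ?case using w pw by (cases t) (auto simp: eval_expr_def expr_over_def o_def)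
  qed
  then show "eval_expr R \<phi> x \<Phi> \<in> carrier R"
    and "h (eval_expr R \<phi> x \<Phi>) = eval_expr S \<psi> (h \<circ> x) \<Phi>" by auto
qed

lemma hom_Nrm:
  assumes "ring_hom_ring R S h" "ring_action G R \<phi>" "U \<subseteq> carrier G" "y \<in> carrier R"
    and eq: "\<And>g y. g \<in> carrier G \<Longrightarrow> y \<in> carrier R \<Longrightarrow> h (\<phi> g y) = \<psi> g (h y)"
  shows "Nrm R \<phi> U y \<in> carrier R" "h (Nrm R \<phi> U y) = Nrm S \<psi> U (h y)"
proof -
  interpret ring_hom_ring R S h by fact
  interpret act: group_action G "carrier R" \<phi> using assms(2) by (simp add: ring_action_def)
  have cl: "(\<lambda>g. \<phi> g y) \<in> U \<rightarrow> carrier R"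
    using assms(3,4) act.element_image by blast
  then show "Nrm R \<phi> U y \<in> carrier R" by (simp add: Nrm_def)
  have "h (Nrm R \<phi> U y) = (\<Oplus>\<^bsub>S\<^esub>g\<in>U. h (\<phi> g y))"
    using hom_finsum[OF cl] by (simp add: Nrm_def comp_def)
  also have "\<dots> = Nrm S \<psi> U (h y)"
  proof -
    have "\<psi> g (h y) = h (\<phi> g y) \<and> h (\<phi> g y) \<in> carrier S" if "g \<in> U" for g
      using that assms(3,4) eq act.element_image hom_closed by (metis subsetD)
    then show ?thesis unfolding Nrm_def by (intro S.finsum_cong') auto
  qed
  finally show "h (Nrm R \<phi> U y) = Nrm S \<psi> U (h y)" .
qed

lemma countable_generate_ring:
  assumes "countable H"
  shows "countable (generate_ring R H)"
proof -
  define F where "F T = T \<union> (\<lambda>h. \<ominus>\<^bsub>R\<^esub> h) ` T \<union> (\<lambda>(a, b). a \<oplus>\<^bsub>R\<^esub> b) ` (T \<times> T)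
    \<union> (\<lambda>(a, b). a \<otimes>\<^bsub>R\<^esub> b) ` (T \<times> T)" for T
  define T where "T n = (F ^^ n) (insert \<one>\<^bsub>R\<^esub> H)" for n
  have T_Suc: "T (Suc n) = F (T n)" for n by (simp add: T_def)
  have "countable (T n)" for n
    by (induction n) (use assms in \<open>auto simp: T_Suc F_def, simp add: T_def\<close>)
  then have cnt: "countable (\<Union>n. T n)" by blast
  have mono: "T m \<subseteq> T n" if "m \<le> n" for m n
    using that by (rule lift_Suc_mono_le[rotated]) (auto simp: T_Suc F_def)
  have "generate_ring R H \<subseteq> (\<Union>n. T n)"
  proof
    fix a assume "a \<in> generate_ring R H"
    then show "a \<in> (\<Union>n. T n)"
    proof induction
      case one then show ?case by (auto simp: T_def intro!: exI[of _ 0])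
    next
      case (incl h) then show ?case by (auto simp: T_def intro!: exI[of _ 0])
    next
      case (a_inv h)
      then obtain n where "h \<in> T n" by blast
      then have "\<ominus>\<^bsub>R\<^esub> h \<in> T (Suc n)" by (simp add: T_Suc F_def)
      then show ?case by blast
    next
      case (eng_add a b)
      then obtain m n where "a \<in> T m" "b \<in> T n" by blast
      then have "a \<in> T (max m n)" "b \<in> T (max m n)"
        using mono[of m "max m n"] mono[of n "max m n"] by auto
      then have "a \<oplus>\<^bsub>R\<^esub> b \<in> T (Suc (max m n))" unfolding T_Suc F_def by blast
      then show ?case by blast
    next
      case (eng_mult a b)
      then obtain m n where "a \<in> T m" "b \<in> T n" by blast
      then have "a \<in> T (max m n)" "b \<in> T (max m n)"
        using mono[of m "max m n"] mono[of n "max m n"] by auto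
      then have "a \<otimes>\<^bsub>R\<^esub> b \<in> T (Suc (max m n))" unfolding T_Suc F_def by blast
      then show ?case by blast
    qed
  qed
  then show ?thesis using cnt countable_subset by blast
qed

text \<open>Pulling an action back along an injective homomorphism with invariant image.\<close>

lemma pull_back_action:
  fixes R' :: "'s ring" and R :: "'r ring"
  assumes act: "ring_action G R \<phi>" and G: "group G" and hom: "ring_hom_ring R' R h"
    and inj: "inj_on h (carrier R')"
    and inv: "\<And>g. g \<in> carrier G \<Longrightarrow> \<phi> g ` h ` carrier R' \<subseteq> h ` carrier R'"
  obtains \<psi> where "ring_action G R' \<psi>"
    "\<forall>g\<in>carrier G. \<forall>y\<in>carrier R'. h (\<psi> g y) = \<phi> g (h y)"
proof -
  interpret ring_hom_ring R' R h by fact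
  interpret act: group_action G "carrier R" \<phi> using act by (simp add: ring_action_def)
  define \<psi> where "\<psi> g = (\<lambda>y\<in>carrier R'. inv_into (carrier R') h (\<phi> g (h y)))" for g
  have \<psi>: "\<psi> g y \<in> carrier R'" "h (\<psi> g y) = \<phi> g (h y)"
    if "g \<in> carrier G" "y \<in> carrier R'" for g y
  proof -
    have "\<phi> g (h y) \<in> h ` carrier R'" using inv that by blast
    then show "\<psi> g y \<in> carrier R'" "h (\<psi> g y) = \<phi> g (h y)"
      using that by (auto simp: \<psi>_def inv_into_into f_inv_into_f)
  qed
  have one: "\<psi> \<one>\<^bsub>G\<^esub> y = y" if "y \<in> carrier R'" for y
    using that \<psi>[of "\<one>\<^bsub>G\<^esub>" y] G inj act.id_eq_one
    by (metis group.is_monoid hom_closed inj_onD monoid.one_closed restrict_apply')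
  have mult: "\<psi> (a \<otimes>\<^bsub>G\<^esub> b) y = \<psi> a (\<psi> b y)"
    if "a \<in> carrier G" "b \<in> carrier G" "y \<in> carrier R'" for a b y
  proof -
    have ab: "a \<otimes>\<^bsub>G\<^esub> b \<in> carrier G" using G that by (simp add: group.is_monoid monoid.m_closed)
    have "h (\<psi> (a \<otimes>\<^bsub>G\<^esub> b) y) = h (\<psi> a (\<psi> b y))"
      using that \<psi> ab act.composition_rule[of "h y" a b] by simp
    then show ?thesis using \<psi> ab that inj by (meson inj_onD)
  qed
  have bij: "bij_betw (\<psi> g) (carrier R') (carrier R')" if g: "g \<in> carrier G" for g
  proof (rule bij_betw_byWitness[where f' = "\<psi> (inv\<^bsub>G\<^esub> g)"])
    have ig: "inv\<^bsub>G\<^esub> g \<in> carrier G" using G g by simp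
    show "\<forall>a\<in>carrier R'. \<psi> (inv\<^bsub>G\<^esub> g) (\<psi> g a) = a" "\<forall>a\<in>carrier R'. \<psi> g (\<psi> (inv\<^bsub>G\<^esub> g) a) = a"
      using mult[of "inv\<^bsub>G\<^esub> g" g] mult[of g "inv\<^bsub>G\<^esub> g"] one g ig G
      by (auto simp: group.l_inv group.r_inv)
    show "\<psi> g ` carrier R' \<subseteq> carrier R'" "\<psi> (inv\<^bsub>G\<^esub> g) ` carrier R' \<subseteq> carrier R'"
      using \<psi> g ig by auto
  qed
  have Bij: "\<psi> g \<in> Bij (carrier R')" if "g \<in> carrier G" for g
    using bij[OF that] by (simp add: Bij_def \<psi>_def)
  have "group_action G (carrier R') \<psi>"
  proof (rule group_action.intro)
    show "group_hom G (BijGroup (carrier R')) \<psi>"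
    proof (intro group_hom.intro group_hom_axioms.intro G group_BijGroup homI)
      fix a b assume ab: "a \<in> carrier G" "b \<in> carrier G"
      have "\<psi> (a \<otimes>\<^bsub>G\<^esub> b) = compose (carrier R') (\<psi> a) (\<psi> b)"
        using mult[OF ab] by (intro ext) (auto simp: compose_def \<psi>_def)
      then show "\<psi> (a \<otimes>\<^bsub>G\<^esub> b) = \<psi> a \<otimes>\<^bsub>BijGroup (carrier R')\<^esub> \<psi> b"
        using Bij ab by (simp add: BijGroup_def)
    qed (use Bij in \<open>auto simp: BijGroup_def\<close>)
  qed
  moreover have "\<psi> g \<in> ring_iso R' R'" if g: "g \<in> carrier G" for g
  proof (rule ring_iso_memI)
    have \<phi>g: "\<phi> g \<in> ring_hom R R"
      using act g by (auto simp: ring_action_def ring_iso_def)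
    fix a b assume ab: "a \<in> carrier R'" "b \<in> carrier R'"
    have "h (\<psi> g (a \<otimes>\<^bsub>R'\<^esub> b)) = h (\<psi> g a \<otimes>\<^bsub>R'\<^esub> \<psi> g b)"
      using ab g \<psi> ring_hom_mult[OF \<phi>g] by simp
    then show "\<psi> g (a \<otimes>\<^bsub>R'\<^esub> b) = \<psi> g a \<otimes>\<^bsub>R'\<^esub> \<psi> g b"
      using inj ab g \<psi> by (meson R.m_closed inj_onD)
    have "h (\<psi> g (a \<oplus>\<^bsub>R'\<^esub> b)) = h (\<psi> g a \<oplus>\<^bsub>R'\<^esub> \<psi> g b)"
      using ab g \<psi> ring_hom_add[OF \<phi>g] by simp
    then show "\<psi> g (a \<oplus>\<^bsub>R'\<^esub> b) = \<psi> g a \<oplus>\<^bsub>R'\<^esub> \<psi> g b"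
      using inj ab g \<psi> by (meson R.a_closed inj_onD)
    show "\<psi> g a \<in> carrier R'" using \<psi> g ab by simp
  next
    have \<phi>g: "\<phi> g \<in> ring_hom R R"
      using act g by (auto simp: ring_action_def ring_iso_def)
    have "h (\<psi> g \<one>\<^bsub>R'\<^esub>) = h \<one>\<^bsub>R'\<^esub>"
      using g \<psi> ring_hom_one[OF \<phi>g] by simp
    then show "\<psi> g \<one>\<^bsub>R'\<^esub> = \<one>\<^bsub>R'\<^esub>"
      using inj g \<psi> by (meson R.one_closed inj_onD)
    show "bij_betw (\<psi> g) (carrier R') (carrier R')" using bij g .
  qed
  ultimately have "ring_action G R' \<psi>" using R.ring_axioms by (simp add: ring_action_def)
  then show ?thesis using that \<psi> by blast
qed

theorem is_formula_all_rings:
  fixes R :: "'r ring"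
  assumes \<Phi>: "is_formula G \<Phi>" and G: "group G" "finite (carrier G)"
  shows "valid_in R G \<Phi>"
  unfolding valid_in_def
proof (intro allI impI, elim conjE)
  fix \<phi> and x :: "'a set \<Rightarrow> 'r"
  assume act: "ring_action G R \<phi>"
    and x: "\<forall>E\<in>elem_ab_subgroups G. x E \<in> carrier R \<and> Nrm R \<phi> E (x E) = \<one>\<^bsub>R\<^esub>"
  interpret R: ring R using act by (simp add: ring_action_def)
  interpret act: group_action G "carrier R" \<phi> using act by (simp add: ring_action_def)
  have sub: "E \<subseteq> carrier G" if "E \<in> elem_ab_subgroups G" for E
    using that by (auto simp: elem_ab_subgroups_def dest: subgroup.subset)
  define H where "H = (\<lambda>(g, E). \<phi> g (x E)) ` (carrier G \<times> elem_ab_subgroups G)"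
  define S where "S = generate_ring R H"
  have "elem_ab_subgroups G \<subseteq> Pow (carrier G)" using sub by blast
  then have fin: "finite (elem_ab_subgroups G)" using G(2) finite_subset by blast
  then have cS: "countable S"
    unfolding S_def H_def using G(2) fin
    by (intro countable_generate_ring countable_finite finite_imageI finite_cartesian_product)
  have HR: "H \<subseteq> carrier R" unfolding H_def using x act.element_image by auto
  have SR: "S \<subseteq> carrier R" using R.generate_ring_incl[OF HR] by (simp add: S_def)
  have ringS: "ring (R\<lparr>carrier := S\<rparr>)" using R.generate_ring_is_ring[OF HR] by (simp add: S_def)
  have invS: "\<phi> g s \<in> S" if g: "g \<in> carrier G" and s: "s \<in> S" for g s
  proof -
    have "\<phi> g \<in> ring_hom R R"
      using act g by (auto simp: ring_action_def ring_iso_def)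
    then interpret \<phi>g: ring_hom_ring R R "\<phi> g"
      by (intro ring_hom_ringI2 R.ring_axioms)
    show ?thesis using s unfolding S_def
    proof induction
      case one then show ?case by (simp add: generate_ring.one)
    next
      case (incl h)
      then obtain a E where a: "h = \<phi> a (x E)" "a \<in> carrier G" "E \<in> elem_ab_subgroups G"
        by (auto simp: H_def)
      then have "\<phi> g h = \<phi> (g \<otimes>\<^bsub>G\<^esub> a) (x E)" using act.composition_rule x g by simp
      moreover have "g \<otimes>\<^bsub>G\<^esub> a \<in> carrier G" using G(1) g a by (simp add: group.is_monoid monoid.m_closed)
      ultimately show ?case using a by (auto simp: H_def intro!: generate_ring.incl)
    next
      case (a_inv h)
      then have "h \<in> carrier R" using R.generate_ring_in_carrier[OF HR] by blast
      then show ?case using a_inv generate_ring.a_inv by fastforce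
    next
      case (eng_add a b)
      then have "a \<in> carrier R" "b \<in> carrier R" using R.generate_ring_in_carrier[OF HR] by blast+
      then show ?case using eng_add generate_ring.eng_add by fastforce
    next
      case (eng_mult a b)
      then have "a \<in> carrier R" "b \<in> carrier R" using R.generate_ring_in_carrier[OF HR] by blast+
      then show ?case using eng_mult generate_ring.eng_mult by fastforce
    qed
  qed
  define R' :: "nat ring" where "R' = image_ring (to_nat_on S) (R\<lparr>carrier := S\<rparr>)"
  define h where "h = inv_into S (to_nat_on S)"
  interpret RS: ring "R\<lparr>carrier := S\<rparr>" by (rule ringS)
  have injS: "inj_on (to_nat_on S) (carrier (R\<lparr>carrier := S\<rparr>))"
    using cS by (simp add: inj_on_to_nat_on)
  have "to_nat_on S \<in> ring_iso (R\<lparr>carrier := S\<rparr>) R'"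
    unfolding R'_def using inj_imp_image_ring_iso[OF injS] .
  then have hiso: "h \<in> ring_iso R' (R\<lparr>carrier := S\<rparr>)"
    using ring_iso_set_sym[OF ringS] unfolding h_def by fastforce
  have ringR': "ring R'" unfolding R'_def using RS.inj_imp_image_ring_is_ring[OF injS] .
  have him: "h ` carrier R' = S" and hinj: "inj_on h (carrier R')"
    using hiso by (auto simp: ring_iso_def bij_betw_def)
  have "h \<in> ring_hom R' R" using hiso SR by (auto simp: ring_iso_def ring_hom_def)
  then interpret h: ring_hom_ring R' R h by (intro ring_hom_ringI2 ringR' R.ring_axioms)
  have invh: "\<phi> g ` h ` carrier R' \<subseteq> h ` carrier R'" if "g \<in> carrier G" for g
    using invS[OF that] him by blast
  obtain \<psi> where \<psi>: "ring_action G R' \<psi>"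
    and "\<forall>g\<in>carrier G. \<forall>y\<in>carrier R'. h (\<psi> g y) = \<phi> g (h y)"
    by (rule pull_back_action[OF act G(1) h.ring_hom_ring_axioms hinj invh])
  then have eq: "h (\<psi> g y) = \<phi> g (h y)" if "g \<in> carrier G" "y \<in> carrier R'" for g y
    using that by blast
  define x' where "x' E = inv_into (carrier R') h (x E)" for E
  have xS: "x E \<in> S" if "E \<in> elem_ab_subgroups G" for E
  proof -
    have "x E = \<phi> \<one>\<^bsub>G\<^esub> (x E)" using act.id_eq_one x that by (metis restrict_apply')
    moreover have "\<one>\<^bsub>G\<^esub> \<in> carrier G" using G(1) by (simp add: group.is_monoid monoid.one_closed)
    ultimately have "x E \<in> H" unfolding H_def using that by force
    then show ?thesis by (simp add: S_def generate_ring.incl)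
  qed
  have x': "x' E \<in> carrier R'" "h (x' E) = x E" if "E \<in> elem_ab_subgroups G" for E
    using xS[OF that] him by (auto simp: x'_def inv_into_into f_inv_into_f)
  have "Nrm R' \<psi> E (x' E) = \<one>\<^bsub>R'\<^esub>" if E: "E \<in> elem_ab_subgroups G" for E
  proof -
    have "h (Nrm R' \<psi> E (x' E)) = h \<one>\<^bsub>R'\<^esub>" and "Nrm R' \<psi> E (x' E) \<in> carrier R'"
      using hom_Nrm[OF h.ring_hom_ring_axioms \<psi> sub[OF E] x'(1)[OF E], of \<phi>] eq x'(2)[OF E] x E by auto
    then show ?thesis using hinj by (meson h.R.one_closed inj_onD)
  qed
  then have all: "\<forall>E\<in>elem_ab_subgroups G. x' E \<in> carrier R' \<and> Nrm R' \<psi> E (x' E) = \<one>\<^bsub>R'\<^esub>"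
    using x'(1) by simp
  have "valid_in R' G \<Phi>" using \<Phi> by (simp add: is_formula_def)
  then have "ring_action G R' \<psi> \<and> (\<forall>E\<in>elem_ab_subgroups G. x' E \<in> carrier R' \<and>
      Nrm R' \<psi> E (x' E) = \<one>\<^bsub>R'\<^esub>) \<longrightarrow> Nrm R' \<psi> (carrier G) (eval_expr R' \<psi> x' \<Phi>) = \<one>\<^bsub>R'\<^esub>"
    unfolding valid_in_def by (elim allE)
  then have val: "Nrm R' \<psi> (carrier G) (eval_expr R' \<psi> x' \<Phi>) = \<one>\<^bsub>R'\<^esub>"
    using \<psi> all by simp
  have ex: "expr_over G \<Phi>" using \<Phi> by (simp add: is_formula_def)
  note ev = hom_eval_expr[where \<psi> = \<phi> and x = x', OF h.ring_hom_ring_axioms \<psi> x'(1) eq ex]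
  have "eval_expr R \<phi> (h \<circ> x') \<Phi> = eval_expr R \<phi> x \<Phi>"
  proof -
    have w: "eval_word R \<phi> (h \<circ> x') w = eval_word R \<phi> x w"
      if "set w \<subseteq> carrier G \<times> elem_ab_subgroups G" for w
      using that by (induction w) (auto simp: eval_word_def x')
    show ?thesis using ex
      by (induction \<Phi>) (auto simp: eval_expr_def expr_over_def w)
  qed
  then have "h (eval_expr R' \<psi> x' \<Phi>) = eval_expr R \<phi> x \<Phi>" using ev(2) by simp
  then show "Nrm R \<phi> (carrier G) (eval_expr R \<phi> x \<Phi>) = \<one>\<^bsub>R\<^esub>"
    using hom_Nrm(2)[where \<psi> = \<phi>, OF h.ring_hom_ring_axioms \<psi> subset_refl ev(1) eq] val by simp
qed

section \<open>Algorithms\<close>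

text \<open>Programs for the partial recursive (\<open>\<mu>\<close>-recursive) functions and their evaluation.\<close>

datatype recf =
    Zero_f
  | Succ_f
  | Proj_f nat
  | Comp_f recf "recf list"
  | Prim_f recf recf
  | Mu_f recf

inductive computes :: "recf \<Rightarrow> nat list \<Rightarrow> nat \<Rightarrow> bool" where
  zero: "computes Zero_f xs 0"
| succ: "computes Succ_f [x] (Suc x)"
| proj: "i < length xs \<Longrightarrow> computes (Proj_f i) xs (xs ! i)"
| comp: "list_all2 (\<lambda>g y. computes g xs y) gs ys \<Longrightarrow> computes f ys z \<Longrightarrow>
         computes (Comp_f f gs) xs z"
| prim_0: "computes f xs z \<Longrightarrow> computes (Prim_f f g) (0 # xs) z"
| prim_Suc: "computes (Prim_f f g) (n # xs) y \<Longrightarrow> computes g (n # y # xs) z \<Longrightarrow>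
             computes (Prim_f f g) (Suc n # xs) z"
| mu: "computes f (n # xs) 0 \<Longrightarrow> (\<forall>i<n. \<exists>v. computes f (i # xs) (Suc v)) \<Longrightarrow>
       computes (Mu_f f) xs n"

inductive_cases computes_ZeroE: "computes Zero_f xs z"
inductive_cases computes_SuccE: "computes Succ_f xs z"
inductive_cases computes_ProjE: "computes (Proj_f i) xs z"
inductive_cases computes_CompE: "computes (Comp_f f gs) xs z"
inductive_cases computes_Prim_0E: "computes (Prim_f f g) (0 # xs) z"
inductive_cases computes_Prim_SucE: "computes (Prim_f f g) (Suc n # xs) z"
inductive_cases computes_MuE: "computes (Mu_f f) xs z"

lemma computes_deterministic: "computes f xs y \<Longrightarrow> computes f xs z \<Longrightarrow> y = z"
proof (induction arbitrary: z rule: computes.induct)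
  case (zero xs) then show ?case by (rule computes_ZeroE) simp
next
  case (succ x) then show ?case by (rule computes_SuccE) simp
next
  case (proj i xs) from proj.prems show ?case by (rule computes_ProjE) simp
next
  case (comp xs gs ys f z')
  from comp.prems obtain ys' where ys': "list_all2 (\<lambda>g y. computes g xs y) gs ys'" "computes f ys' z"
    by (rule computes_CompE)
  have "ys = ys'"
    using comp.IH(1) ys'(1) by (auto simp: list_all2_conv_all_nth intro!: nth_equalityI)
  then show ?case using comp.IH(2) ys'(2) by blast
next
  case (prim_0 f xs z' g)
  from prim_0.prems have "computes f xs z" by (rule computes_Prim_0E)
  then show ?case by (rule prim_0.IH)
next
  case (prim_Suc f g n xs y z')
  from prim_Suc.prems obtain y' where "computes (Prim_f f g) (n # xs) y'" "computes g (n # y' # xs) z"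
    by (rule computes_Prim_SucE)
  then show ?case using prim_Suc.IH by blast
next
  case (mu f n xs)
  from mu.prems have "computes f (z # xs) 0 \<and> (\<forall>i<z. \<exists>v. computes f (i # xs) (Suc v))"
    by (rule computes_MuE) blast
  then have z: "computes f (z # xs) 0" "\<forall>i<z. \<exists>v. computes f (i # xs) (Suc v)" by auto
  show ?case
  proof (rule linorder_cases[of n z])
    assume "n < z" then show ?thesis using z(2) mu.IH(1) by fastforce
  next
    assume "z < n" then show ?thesis using z(1) mu.IH(2) by fastforce
  qed simp
qed


section \<open>Coding of the input and output data\<close>

text \<open>
  A finite group is presented to an algorithm by its multiplication table with respect to an
  enumeration of its elements.
\<close>

definition enumerates :: "'a list \<Rightarrow> ('a, 'm) monoid_scheme \<Rightarrow> bool" where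
  "enumerates xs G \<longleftrightarrow> distinct xs \<and> set xs = carrier G"

definition pos :: "'a list \<Rightarrow> 'a \<Rightarrow> nat" where
  "pos xs x = length (takeWhile (\<lambda>y. y \<noteq> x) xs)"

definition code_group :: "'a list \<Rightarrow> ('a, 'm) monoid_scheme \<Rightarrow> nat" where
  "code_group xs G =
     list_encode (map (\<lambda>x. list_encode (map (\<lambda>y. pos xs (x \<otimes>\<^bsub>G\<^esub> y)) xs)) xs)"

definition code_expr :: "'a list \<Rightarrow> 'a poly_expr \<Rightarrow> nat" where
  "code_expr xs \<Phi> =
     list_encode (map (\<lambda>(c, w). prod_encode (int_encode c,
       list_encode (map (\<lambda>(g, E). prod_encode (pos xs g, set_encode (pos xs ` E))) w))) \<Phi>)"

text \<open>
  Formulas for all groups in \<open>\<F>\<^bsub>G\<^sub>1\<^esub> \<union> \<F>\<^bsub>G\<^sub>2\<^esub>\<close>: a list containing for every isomorphism class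
  in this set exactly one representing group, together with an enumeration of its elements and a
  formula.
\<close>

type_synonym family = "(nat monoid \<times> nat list \<times> nat poly_expr) list"

definition formula_family ::
    "nat \<Rightarrow> ('a, 'm) monoid_scheme \<Rightarrow> ('b, 'n) monoid_scheme \<Rightarrow> family \<Rightarrow> bool" where
  "formula_family p G\<^sub>1 G\<^sub>2 fam \<longleftrightarrow>
     (\<forall>(K, zs, \<Psi>)\<in>set fam. K \<in> FF p G\<^sub>1 \<union> FF p G\<^sub>2 \<and> enumerates zs K \<and> is_formula K \<Psi>) \<and>
     (\<forall>H\<in>FF p G\<^sub>1 \<union> FF p G\<^sub>2. \<exists>!j. j < length fam \<and> fst (fam ! j) \<cong> H)"

definition code_family :: "family \<Rightarrow> nat" where
  "code_family fam =
     list_encode (map (\<lambda>(K, zs, \<Psi>). prod_encode (code_group zs K, code_expr zs \<Psi>)) fam)"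

end

theory Submission
  imports Defs "HOL-Library.Poly_Mapping"
begin

text \<open>
  An element \<open>\<Phi>\<close> of the free ring on the variables \<open>g(x\<^sub>E)\<close> is a formula iff \<open>N\<^sub>G(\<Phi>) - 1\<close> lies in the ideal
  generated by the elements \<open>g(N\<^sub>E(x\<^sub>E) - 1)\<close>: the quotient by this ideal is the universal ring with an
  action of \<open>G\<close> and elements \<open>x\<^sub>E\<close> of norm \<open>1\<close>. Membership in the ideal has a finite certificate which is
  checked by a primitive recursive function, so an unbounded search finds a formula whenever
  there is one. The given formulas for \<open>\<F>\<^bsub>G\<^sub>1\<^esub> \<union> \<F>\<^bsub>G\<^sub>2\<^esub>\<close> only serve to prove that the search terminates, that is,
  that an element of norm \<open>1\<close> exists in the universal ring.

  For this, let \<open>N\<close> be normal in \<open>G\<close>, let \<open>N\<^sub>N(x) = 1\<close>, and let \<open>y \<in> R\<^sup>N\<close> have norm \<open>1\<close> under \<open>G/N\<close>;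
  then \<open>N\<^sub>G(x y) = 1\<close>. Moreover \<open>N\<^sub>N\<close> maps elements of norm \<open>1\<close> under the preimage of \<open>E \<le> G/N\<close> to elements of
  \<open>R\<^sup>N\<close> of norm \<open>1\<close> under \<open>E\<close>. So \<open>G\<close> reduces to \<open>N\<close>, \<open>G/N\<close> and the preimages of elementary abelian subgroups,
  which are proper subgroups unless \<open>G/N\<close> is elementary abelian. The \<open>p\<close>-groups that are not elementary
  abelian and all of whose proper nontrivial quotients are elementary abelian are extraspecial or almost extraspecial.
  For \<open>G\<^sub>1 \<times> G\<^sub>2\<close> the same reduction along the two projections ends in subgroups \<open>E\<^sub>1 \<times> E\<^sub>2\<close>, which are
  elementary abelian because both factors are \<open>p\<close>-groups for the same \<open>p\<close>.
\<close>

section \<open>Recursive functions\<close>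

text \<open>The quotient ring is needed in one direction only. That a certificate yields a formula
  is checked in an arbitrary ring with an action: the signed words are evaluated there and cancel.
  The converse, which makes the search stop, takes place in one particular ring whose elements have
  type \<open>free set\<close>, whereas \<open>is_formula\<close> speaks of rings over
  \<open>nat\<close>. Therefore the existence statement \<open>detects\<close> carries the type of
  the ring elements as a parameter, and \<open>is_formula_all_rings\<close> brings the given
  formulas to that type.

  A program sees only multiplication tables. So certificates are built from numbers: the group is
  replaced by a copy \<open>H\<close> on \<open>{..<N}\<close> whose product is the function
  \<open>table_mult s t\<close>, a subgroup by the binary code of its set of elements, and the
  enumeration \<open>List.product xs ys\<close> carries the result back. Coefficients other than 1
  and -1 are obtained by repeating words, which reduces the test for zero in the free ring to
  counting.\<close>

class nat_coded =
  fixes enc :: "'a \<Rightarrow> nat" and dec :: "nat \<Rightarrow> 'a"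
  assumes dec_enc [simp]: "dec (enc x) = x" and enc_dec [simp]: "enc (dec n) = n"

lemma enc_eq_iff [simp]: "enc x = enc y \<longleftrightarrow> x = y" for x y :: "'a :: nat_coded"
  by (metis dec_enc)

instantiation nat :: nat_coded
begin
definition enc_nat :: "nat \<Rightarrow> nat" where [simp]: "enc_nat n = n"
definition dec_nat :: "nat \<Rightarrow> nat" where [simp]: "dec_nat n = n"
instance by standard simp_all
end

instantiation prod :: (nat_coded, nat_coded) nat_coded
begin
definition enc_prod :: "'a \<times> 'b \<Rightarrow> nat" where "enc_prod x = prod_encode (enc (fst x), enc (snd x))"
definition dec_prod :: "nat \<Rightarrow> 'a \<times> 'b" where "dec_prod n = map_prod dec dec (prod_decode n)"
instance by standard (simp_all add: enc_prod_def dec_prod_def)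
end

instantiation list :: (nat_coded) nat_coded
begin
definition enc_list :: "'a list \<Rightarrow> nat" where "enc_list xs = list_encode (map enc xs)"
definition dec_list :: "nat \<Rightarrow> 'a list" where "dec_list n = map dec (list_decode n)"
instance by standard (simp_all add: enc_list_def dec_list_def o_def)
end

text \<open>
  The list \<open>e\<close> holds the values of the variables in scope, the innermost one first, so that
  under a binder the bound variable is \<open>hd e\<close> and the outer environment is \<open>tl e\<close>.
\<close>

definition cmp :: "nat \<Rightarrow> (nat list \<Rightarrow> 'a :: nat_coded) \<Rightarrow> bool" where
  "cmp k F \<longleftrightarrow> (\<exists>r. \<forall>e. length e = k \<longrightarrow> computes r e (enc (F e)))"

definition dcd :: "nat \<Rightarrow> (nat list \<Rightarrow> bool) \<Rightarrow> bool" where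
  "dcd k P \<longleftrightarrow> cmp k (\<lambda>e. of_bool (P e) :: nat)"

lemma cmp_cong: "cmp k F \<Longrightarrow> (\<And>e. length e = k \<Longrightarrow> enc (F e) = enc (G e)) \<Longrightarrow> cmp k G"
  unfolding cmp_def by metis

lemma cmp_enc: "cmp k (\<lambda>e. enc (F e)) \<longleftrightarrow> cmp k F"
  by (simp add: cmp_def)

text \<open>Decoding costs nothing: the coding is onto, so \<open>f e\<close> is already the code of
  \<open>dec (f e)\<close>.\<close>

lemma cmp_dec: "cmp k f \<Longrightarrow> cmp k (\<lambda>e. dec (f e))"
  by (simp add: cmp_def)

lemma cmp_comp:
  fixes Gs :: "(nat list \<Rightarrow> nat) list"
  assumes F: "cmp (length Gs) F" and Gs: "\<And>G. G \<in> set Gs \<Longrightarrow> cmp k G"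
  shows "cmp k (\<lambda>e. F (map (\<lambda>G. G e) Gs))"
proof -
  obtain f where f: "\<And>e. length e = length Gs \<Longrightarrow> computes f e (enc (F e))"
    using F by (auto simp: cmp_def)
  have "\<exists>gs. \<forall>e. length e = k \<longrightarrow> list_all2 (\<lambda>g y. computes g e y) gs (map (\<lambda>G. G e) Gs)"
    using Gs
  proof (induction Gs)
    case (Cons G Gs)
    then obtain gs where "\<forall>e. length e = k \<longrightarrow> list_all2 (\<lambda>g y. computes g e y) gs (map (\<lambda>G. G e) Gs)"
      by auto
    moreover obtain g where "\<forall>e. length e = k \<longrightarrow> computes g e (G e)"
      using Cons.prems[of G] by (auto simp: cmp_def)
    ultimately show ?case by (intro exI[of _ "g # gs"]) auto
  qed simp
  then obtain gs where gs: "\<And>e. length e = k \<Longrightarrow> list_all2 (\<lambda>g y. computes g e y) gs (map (\<lambda>G. G e) Gs)"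
    by blast
  show ?thesis unfolding cmp_def
    by (rule exI[of _ "Comp_f f gs"]) (use f gs in \<open>auto intro!: computes.comp\<close>)
qed

lemma cmp_proj: "i < k \<Longrightarrow> cmp k (\<lambda>e. dec (e ! i))"
  unfolding cmp_def using computes.proj by (intro exI[of _ "Proj_f i"]) auto

lemma length_SucD: "length e = Suc n \<Longrightarrow> \<exists>x e'. e = x # e' \<and> length e' = n"
  by (cases e) auto

lemma cmp_weaken:
  assumes "cmp k F"
  shows "cmp (m + k) (\<lambda>e. F (drop m e))"
proof -
  have "cmp (m + k) (\<lambda>e. F (map (\<lambda>G. G e) (map (\<lambda>i e. e ! (m + i)) [0..<k])))"
    by (rule cmp_comp) (use assms cmp_proj[where 'a = nat, of "m + _" "m + k"] in auto)
  then show ?thesis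
    by (rule cmp_cong) (auto simp: o_def intro!: arg_cong[where f = F] nth_equalityI)
qed

lemma cmp_subst:
  assumes "cmp (Suc k) F" "cmp k (g :: nat list \<Rightarrow> nat)"
  shows "cmp k (\<lambda>e. F (g e # e))"
proof -
  have "cmp k (\<lambda>e. F (map (\<lambda>G. G e) (g # map (\<lambda>i e. e ! i) [0..<k])))"
    by (rule cmp_comp) (use assms cmp_proj[where 'a = nat, of _ k] in auto)
  then show ?thesis
    by (rule cmp_cong) (simp add: o_def, metis map_nth)
qed

text \<open>In the body of a fold the accumulator sits between the list element and the outer
  environment; here it is dropped.\<close>

lemma cmp_skip:
  assumes "cmp (Suc k) F"
  shows "cmp (Suc (Suc k)) (\<lambda>e. F (hd e # tl (tl e)))"
proof -
  have "cmp (Suc (Suc k)) (\<lambda>e. F (map (\<lambda>G. G e) ((\<lambda>e. e ! 0) # map (\<lambda>i e. e ! (Suc (Suc i))) [0..<k])))"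
    by (rule cmp_comp) (use assms cmp_proj[where 'a = nat, of _ "Suc (Suc k)"] in auto)
  then show ?thesis
    by (rule cmp_cong) (auto simp: o_def dest!: length_SucD intro!: arg_cong[where f = F] nth_equalityI)
qed

lemma cmp_var: "cmp (Suc (i + k)) (\<lambda>e. dec (hd ((tl ^^ i) e)))"
proof -
  have "(tl ^^ i) e = drop i e" for e :: "nat list" by (induction i) (auto simp: drop_Suc tl_drop)
  then show ?thesis by (intro cmp_cong[OF cmp_proj[of i]]) (auto simp: hd_drop_conv_nth)
qed

text \<open>Successors and tails are kept explicit so that these rules match syntactically when a
  term is taken apart by introduction rules; the last one reaches the ninth variable.\<close>

lemmas cmp_vars = cmp_var[of "0", simplified] cmp_var[of "Suc 0", simplified]
    cmp_var[of "Suc (Suc 0)", simplified] cmp_var[of "Suc (Suc (Suc 0))", simplified]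
    cmp_var[of "Suc (Suc (Suc (Suc 0)))", simplified]
    cmp_var[of "Suc (Suc (Suc (Suc (Suc 0))))", simplified]
    cmp_var[of "Suc (Suc (Suc (Suc (Suc (Suc 0)))))", simplified]
    cmp_var[of "Suc (Suc (Suc (Suc (Suc (Suc (Suc 0))))))", simplified]
    cmp_var[of "Suc (Suc (Suc (Suc (Suc (Suc (Suc (Suc 0)))))))", simplified]

lemmas cmp_vars_nat = cmp_vars[where 'a = nat, simplified]

text \<open>Abstracting the argument lets the computability of \<open>F\<close> be proved once, in
  an environment that holds nothing else, and then be used under any number of binders.\<close>

lemma cmp_app1:
  assumes "cmp (Suc 0) (\<lambda>e. F (dec (hd e)))" "cmp k f"
  shows "cmp k (\<lambda>e. F (f e))"
proof -
  have "cmp k (\<lambda>e. (\<lambda>e. F (dec (hd e))) (map (\<lambda>G. G e) [\<lambda>e. enc (f e)]))"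
    by (rule cmp_comp) (use assms in \<open>auto simp: cmp_enc\<close>)
  then show ?thesis by simp
qed

lemma cmp_app2:
  assumes "cmp (Suc (Suc 0)) (\<lambda>e. F (dec (hd e)) (dec (hd (tl e))))" "cmp k f" "cmp k g"
  shows "cmp k (\<lambda>e. F (f e) (g e))"
proof -
  have "cmp k (\<lambda>e. (\<lambda>e. F (dec (hd e)) (dec (hd (tl e)))) (map (\<lambda>G. G e) [\<lambda>e. enc (f e), \<lambda>e. enc (g e)]))"
    by (rule cmp_comp) (use assms in \<open>auto simp: cmp_enc\<close>)
  then show ?thesis by simp
qed

lemma cmp_app3:
  assumes "cmp (Suc (Suc (Suc 0))) (\<lambda>e. F (dec (hd e)) (dec (hd (tl e))) (dec (hd (tl (tl e)))))" "cmp k f" "cmp k g" "cmp k h"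
  shows "cmp k (\<lambda>e. F (f e) (g e) (h e))"
proof -
  have "cmp k (\<lambda>e. (\<lambda>e. F (dec (hd e)) (dec (hd (tl e))) (dec (hd (tl (tl e))))) (map (\<lambda>G. G e) [\<lambda>e. enc (f e), \<lambda>e. enc (g e), \<lambda>e. enc (h e)]))"
    by (rule cmp_comp) (use assms in \<open>auto simp: cmp_enc\<close>)
  then show ?thesis by simp
qed

lemma cmp_app4:
  assumes "cmp (Suc (Suc (Suc (Suc 0)))) (\<lambda>e. F (dec (hd e)) (dec (hd (tl e))) (dec (hd (tl (tl e)))) (dec (hd (tl (tl (tl e))))))" "cmp k f" "cmp k g" "cmp k h" "cmp k i"
  shows "cmp k (\<lambda>e. F (f e) (g e) (h e) (i e))"
proof -
  have "cmp k (\<lambda>e. (\<lambda>e. F (dec (hd e)) (dec (hd (tl e))) (dec (hd (tl (tl e)))) (dec (hd (tl (tl (tl e)))))) (map (\<lambda>G. G e) [\<lambda>e. enc (f e), \<lambda>e. enc (g e), \<lambda>e. enc (h e), \<lambda>e. enc (i e)]))"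
    by (rule cmp_comp) (use assms in \<open>auto simp: cmp_enc\<close>)
  then show ?thesis by simp
qed

lemma cmp_Suc: "cmp k f \<Longrightarrow> cmp k (\<lambda>e. Suc (f e))"
  by (rule cmp_app1[where F = Suc])
    (auto simp: cmp_def intro!: exI[of _ Succ_f] computes.succ dest!: length_SucD)

lemma cmp_const: "cmp k (\<lambda>e. c)"
proof -
  have "cmp k (\<lambda>e. n)" for n :: nat
  proof (induction n)
    case 0 then show ?case
      by (auto simp: cmp_def intro!: exI[of _ Zero_f] computes.zero)
  qed (rule cmp_Suc)
  from this[of "enc c"] show ?thesis by (simp add: cmp_enc)
qed

text \<open>\<open>Prim_f\<close> passes the counter, the previous value and then the parameters,
  which is the order of the variables in the environment of \<open>G\<close>.\<close>

lemma cmp_rec_nat: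
  assumes A: "cmp k A" and G: "cmp (Suc (Suc k)) (\<lambda>e. G (hd e) (dec (hd (tl e))) (tl (tl e)))"
    and N: "cmp k N"
  shows "cmp k (\<lambda>e. rec_nat (A e) (\<lambda>n y. G n y e) (N e))"
proof -
  obtain a where a: "\<And>e. length e = k \<Longrightarrow> computes a e (enc (A e))" using A by (auto simp: cmp_def)
  obtain g where g: "\<And>e. length e = Suc (Suc k) \<Longrightarrow>
      computes g e (enc (G (hd e) (dec (hd (tl e))) (tl (tl e))))" using G by (auto simp: cmp_def)
  have "computes (Prim_f a g) (n # e) (enc (rec_nat (A e) (\<lambda>n y. G n y e) n))" if "length e = k" for n e
  proof (induction n)
    case 0 then show ?case using a[OF that] by (simp add: computes.prim_0)
  next
    case (Suc n)
    then show ?case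
      using g[of "n # enc (rec_nat (A e) (\<lambda>n y. G n y e) n) # e"] that
      by (auto intro: computes.prim_Suc)
  qed
  then have "cmp (Suc k) (\<lambda>e. rec_nat (A (tl e)) (\<lambda>n y. G n y (tl e)) (hd e))"
    unfolding cmp_def by (intro exI[of _ "Prim_f a g"]) (auto dest!: length_SucD)
  from cmp_subst[OF this N] show ?thesis by simp
qed

section \<open>Arithmetic and decidable predicates\<close>

lemma cmp_add: "cmp k f \<Longrightarrow> cmp k g \<Longrightarrow> cmp k (\<lambda>e. f e + g e :: nat)"
proof (rule cmp_app2[where F = "(+)"])
  have "cmp (Suc (Suc 0)) (\<lambda>e. rec_nat (hd e) (\<lambda>_ y. Suc y) (hd (tl e)))"
    by (intro cmp_rec_nat cmp_Suc cmp_vars cmp_vars_nat)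
  moreover have "rec_nat a (\<lambda>_ y. Suc y) b = a + b" for a b :: nat by (induction b) auto
  ultimately show "cmp (Suc (Suc 0)) (\<lambda>e. dec (hd e) + dec (hd (tl e)) :: nat)" by simp
qed

lemma cmp_mult: "cmp k f \<Longrightarrow> cmp k g \<Longrightarrow> cmp k (\<lambda>e. f e * g e :: nat)"
proof (rule cmp_app2[where F = "(*)"])
  have "cmp (Suc (Suc 0)) (\<lambda>e. rec_nat 0 (\<lambda>_ y. y + hd e) (hd (tl e)))"
    by (intro cmp_rec_nat cmp_add cmp_const cmp_vars cmp_vars_nat)
  moreover have "rec_nat 0 (\<lambda>_ y. y + a) b = a * b" for a b :: nat by (induction b) auto
  ultimately show "cmp (Suc (Suc 0)) (\<lambda>e. dec (hd e) * dec (hd (tl e)) :: nat)" by simp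
qed

lemma cmp_power: "cmp k f \<Longrightarrow> cmp k g \<Longrightarrow> cmp k (\<lambda>e. f e ^ g e :: nat)"
proof (rule cmp_app2[where F = "(^)"])
  have "cmp (Suc (Suc 0)) (\<lambda>e. rec_nat 1 (\<lambda>_ y. y * hd e) (hd (tl e)))"
    by (intro cmp_rec_nat cmp_mult cmp_const cmp_vars cmp_vars_nat)
  moreover have "rec_nat 1 (\<lambda>_ y. y * a) b = a ^ b" for a b :: nat by (induction b) auto
  ultimately show "cmp (Suc (Suc 0)) (\<lambda>e. dec (hd e) ^ dec (hd (tl e)) :: nat)" by simp
qed

lemma cmp_pred: "cmp k f \<Longrightarrow> cmp k (\<lambda>e. f e - Suc 0)"
proof (rule cmp_app1[where F = "\<lambda>n. n - Suc 0"])
  have "cmp (Suc 0) (\<lambda>e. rec_nat 0 (\<lambda>n _. n) (hd e))"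
    by (intro cmp_rec_nat cmp_const cmp_vars cmp_vars_nat)
  moreover have "rec_nat 0 (\<lambda>n _. n) b = b - Suc 0" for b :: nat by (cases b) auto
  ultimately show "cmp (Suc 0) (\<lambda>e. dec (hd e) - Suc 0)" by simp
qed

lemma cmp_diff: "cmp k f \<Longrightarrow> cmp k g \<Longrightarrow> cmp k (\<lambda>e. f e - g e :: nat)"
proof (rule cmp_app2[where F = "(-)"])
  have "cmp (Suc (Suc 0)) (\<lambda>e. rec_nat (hd e) (\<lambda>_ y. y - Suc 0) (hd (tl e)))"
    by (intro cmp_rec_nat cmp_pred cmp_const cmp_vars cmp_vars_nat)
  moreover have "rec_nat a (\<lambda>_ y. y - Suc 0) b = a - b" for a b :: nat by (induction b) auto
  ultimately show "cmp (Suc (Suc 0)) (\<lambda>e. dec (hd e) - dec (hd (tl e)) :: nat)" by simp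
qed

lemma dcd_le: "cmp k f \<Longrightarrow> cmp k g \<Longrightarrow> dcd k (\<lambda>e. (f e :: nat) \<le> g e)"
proof -
  assume fg: "cmp k f" "cmp k g"
  have "(of_bool (a \<le> b) :: nat) = 1 - (a - b)" for a b :: nat by auto
  then show ?thesis using cmp_diff[OF cmp_const cmp_diff[OF fg], of 1] by (simp only: dcd_def)
qed

lemma dcd_conj: "dcd k P \<Longrightarrow> dcd k Q \<Longrightarrow> dcd k (\<lambda>e. P e \<and> Q e)"
  unfolding dcd_def of_bool_conj by (rule cmp_mult)

lemma dcd_not: "dcd k P \<Longrightarrow> dcd k (\<lambda>e. \<not> P e)"
proof -
  have "(of_bool (\<not> b) :: nat) = 1 - of_bool b" for b by auto
  then show "dcd k P \<Longrightarrow> ?thesis" unfolding dcd_def using cmp_diff[OF cmp_const] by simp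
qed

lemma dcd_cong: "dcd k P \<Longrightarrow> (\<And>e. length e = k \<Longrightarrow> P e \<longleftrightarrow> Q e) \<Longrightarrow> dcd k Q"
  unfolding dcd_def by (erule cmp_cong) auto

lemma dcd_disj: "dcd k P \<Longrightarrow> dcd k Q \<Longrightarrow> dcd k (\<lambda>e. P e \<or> Q e)"
  by (rule dcd_cong[OF dcd_not[OF dcd_conj[OF dcd_not dcd_not]]]) auto

lemma dcd_less: "cmp k f \<Longrightarrow> cmp k g \<Longrightarrow> dcd k (\<lambda>e. (f e :: nat) < g e)"
  by (rule dcd_cong[OF dcd_not[OF dcd_le[of k g f]]]) auto

lemma dcd_eq: "cmp k f \<Longrightarrow> cmp k g \<Longrightarrow> dcd k (\<lambda>e. f e = g e)"
proof -
  assume "cmp k f" "cmp k g"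
  then have "dcd k (\<lambda>e. enc (f e) \<le> enc (g e) \<and> enc (g e) \<le> enc (f e))"
    by (intro dcd_conj dcd_le) (simp_all add: cmp_enc)
  then show ?thesis by (rule dcd_cong) (metis antisym enc_eq_iff order_refl)
qed

lemma cmp_if:
  assumes "dcd k P" "cmp k f" "cmp k g"
  shows "cmp k (\<lambda>e. if P e then f e else g e)"
proof -
  have "cmp k (\<lambda>e. of_bool (P e) * enc (f e) + of_bool (\<not> P e) * enc (g e))"
    using assms dcd_not[OF assms(1)] by (intro cmp_add cmp_mult) (simp_all add: cmp_enc dcd_def)
  then show ?thesis by (rule cmp_cong) auto
qed

lemma cmp_mod: "cmp k f \<Longrightarrow> cmp k g \<Longrightarrow> cmp k (\<lambda>e. f e mod g e :: nat)"
proof (rule cmp_app2[where F = "(mod)"])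
  have "cmp (Suc (Suc 0)) (\<lambda>e. rec_nat 0 (\<lambda>_ y. if Suc y = hd (tl e) then 0 else Suc y) (hd e))"
    by (intro cmp_rec_nat cmp_if dcd_eq cmp_Suc cmp_const cmp_vars cmp_vars_nat)
  \<comment> \<open>For \<open>b = 0\<close> the counter never wraps around, in agreement with
    \<open>a mod 0 = a\<close>.\<close>
  moreover have "rec_nat 0 (\<lambda>_ y. if Suc y = b then 0 else Suc y) a = a mod b" for a b :: nat
    by (induction a) (auto simp: mod_Suc)
  ultimately show "cmp (Suc (Suc 0)) (\<lambda>e. dec (hd e) mod dec (hd (tl e)) :: nat)" by simp
qed

lemma cmp_div: "cmp k f \<Longrightarrow> cmp k g \<Longrightarrow> cmp k (\<lambda>e. f e div g e :: nat)"
proof (rule cmp_app2[where F = "(div)"])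
  have "cmp (Suc (Suc 0)) (\<lambda>e. rec_nat 0 (\<lambda>n y. if Suc n mod hd (tl e) = 0 then Suc y else y) (hd e))"
    by (intro cmp_rec_nat cmp_if dcd_eq cmp_mod cmp_Suc cmp_const cmp_vars cmp_vars_nat)
  \<comment> \<open>The quotient counts the positive multiples of \<open>b\<close> up to
    \<open>a\<close>; for \<open>b = 0\<close> there are none, in agreement with
    \<open>a div 0 = 0\<close>.\<close>
  moreover have "rec_nat 0 (\<lambda>n y. if Suc n mod b = 0 then Suc y else y) a = a div b" for a b :: nat
    by (induction a) (auto simp: div_Suc)
  ultimately show "cmp (Suc (Suc 0)) (\<lambda>e. dec (hd e) div dec (hd (tl e)) :: nat)" by simp
qed

lemma dcd_odd: "cmp k f \<Longrightarrow> dcd k (\<lambda>e. odd (f e :: nat))"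
  by (rule dcd_cong[OF dcd_eq[OF cmp_mod[OF _ cmp_const[of _ 2]] cmp_const[of _ 1]]]) (auto simp: odd_iff_mod_2_eq_one)

lemma cmp_triangle: "cmp k f \<Longrightarrow> cmp k (\<lambda>e. triangle (f e))"
  unfolding triangle_def by (intro cmp_div cmp_mult cmp_Suc cmp_const)

text \<open>
  Decoding of pairs by primitive recursion on the code: the sum of the two components is a
  state that fits into a single number.
\<close>

definition diagonal :: "nat \<Rightarrow> nat" where
  "diagonal n = fst (prod_decode n) + snd (prod_decode n)"

lemma prod_decode_eqD: "prod_decode n = (a, b) \<Longrightarrow> n = triangle (a + b) + a"
  using prod_decode_inverse[of n] by (simp del: prod_decode_inverse add: prod_encode_def)

text \<open>Cantor's enumeration walks along a diagonal with rising first component; after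
  \<open>(a, 0)\<close> it enters the next diagonal at \<open>(0, Suc a)\<close>.\<close>

lemma prod_decode_Suc:
  "prod_decode (Suc n) = (case prod_decode n of (a, b) \<Rightarrow> if b = 0 then (0, Suc a) else (Suc a, b - 1))"
proof -
  obtain a b where ab: "prod_decode n = (a, b)" by fastforce
  from this have n: "n = triangle (a + b) + a" by (rule prod_decode_eqD)
  have "Suc n = prod_encode (if b = 0 then (0, Suc a) else (Suc a, b - 1))"
    by (cases b) (simp_all add: n prod_encode_def)
  then show ?thesis by (simp add: ab)
qed

text \<open>The diagonal \<open>y\<close> ends at the code \<open>triangle y + y\<close>, so the
  recursion can tell from \<open>n\<close> and \<open>y\<close> alone when to move on.\<close>

lemma diagonal_rec:
  "diagonal n = rec_nat 0 (\<lambda>n y. if n = triangle y + y then Suc y else y) n"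
proof (induction n)
  case 0 then show ?case using prod_encode_inverse[of "(0, 0)"]
    by (simp add: diagonal_def prod_encode_def)
next
  case (Suc n)
  obtain a b where ab: "prod_decode n = (a, b)" by fastforce
  from this have n: "n = triangle (a + b) + a" by (rule prod_decode_eqD)
  have "diagonal n = a + b" by (simp add: diagonal_def ab)
  moreover have "diagonal (Suc n) = (if b = 0 then Suc a else a + b)"
    by (auto simp: diagonal_def prod_decode_Suc ab)
  moreover have "n = triangle (a + b) + (a + b) \<longleftrightarrow> b = 0" by (subst n) simp
  ultimately show ?case by (simp flip: Suc)
qed

lemma cmp_diagonal: "cmp k f \<Longrightarrow> cmp k (\<lambda>e. diagonal (f e))"
  unfolding diagonal_rec
  by (rule cmp_app1[where F = "rec_nat 0 (\<lambda>n y. if n = triangle y + y then Suc y else y)"])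
    (simp, intro cmp_rec_nat cmp_if dcd_eq cmp_add cmp_triangle cmp_Suc cmp_const cmp_vars cmp_vars_nat)

lemma prod_decode_diagonal:
  "fst (prod_decode n) = n - triangle (diagonal n)" "snd (prod_decode n) = diagonal n - (n - triangle (diagonal n))"
proof -
  obtain a b where ab: "prod_decode n = (a, b)" by fastforce
  from prod_decode_eqD[OF this] have "n - triangle (a + b) = a" by simp
  then show "fst (prod_decode n) = n - triangle (diagonal n)" "snd (prod_decode n) = diagonal n - (n - triangle (diagonal n))"
    by (simp_all add: diagonal_def ab)
qed

lemma cmp_fst: "cmp k f \<Longrightarrow> cmp k (\<lambda>e. fst (f e))"
proof -
  assume "cmp k f"
  then have "cmp k (\<lambda>e. fst (prod_decode (enc (f e))))"
    unfolding prod_decode_diagonal by (intro cmp_diff cmp_triangle cmp_diagonal) (simp_all add: cmp_enc)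
  then show ?thesis by (simp add: enc_prod_def cmp_enc)
qed

lemma cmp_snd: "cmp k f \<Longrightarrow> cmp k (\<lambda>e. snd (f e))"
proof -
  assume "cmp k f"
  then have "cmp k (\<lambda>e. snd (prod_decode (enc (f e))))"
    unfolding prod_decode_diagonal by (intro cmp_diff cmp_triangle cmp_diagonal) (simp_all add: cmp_enc)
  then show ?thesis by (simp add: enc_prod_def cmp_enc)
qed

lemma cmp_Pair: "cmp k f \<Longrightarrow> cmp k g \<Longrightarrow> cmp k (\<lambda>e. (f e, g e))"
proof -
  assume "cmp k f" "cmp k g"
  then have "cmp k (\<lambda>e. triangle (enc (f e) + enc (g e)) + enc (f e))"
    by (intro cmp_add cmp_triangle) (simp_all add: cmp_enc)
  then show ?thesis by (rule cmp_cong) (simp add: enc_prod_def prod_encode_def)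
qed

section \<open>Lists\<close>

definition hd0 :: "'a :: nat_coded list \<Rightarrow> 'a" where
  "hd0 xs = (if xs = [] then dec 0 else hd xs)"

lemma cmp_Cons: "cmp k f \<Longrightarrow> cmp k g \<Longrightarrow> cmp k (\<lambda>e. f e # g e)"
proof -
  assume "cmp k f" "cmp k g"
  then have "cmp k (\<lambda>e. Suc (enc (f e, g e)))" by (intro cmp_Suc) (simp add: cmp_enc cmp_Pair)
  then show ?thesis by (rule cmp_cong) (simp add: enc_prod_def enc_list_def)
qed

lemma prod_decode_0: "prod_decode 0 = (0, 0)"
  using prod_encode_inverse[of "(0, 0)"] by (simp add: prod_encode_def)

lemma cmp_hd0: "cmp k f \<Longrightarrow> cmp k (\<lambda>e. hd0 (f e))"
proof -
  assume "cmp k f"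
  then have "cmp k (\<lambda>e. fst (dec (enc (f e) - Suc 0) :: nat \<times> nat))"
    by (intro cmp_fst cmp_dec cmp_pred) (simp add: cmp_enc)
  \<comment> \<open>The empty list has code 0, whose truncated predecessor 0 decodes to the pair (0,
    0); this dictates the default value in \<open>hd0\<close>.\<close>
  moreover have "fst (dec (enc xs - Suc 0) :: nat \<times> nat) = enc (hd0 xs)" for xs :: "'a list"
    by (cases xs) (simp_all add: hd0_def enc_list_def dec_prod_def prod_decode_0)
  ultimately show ?thesis by (simp add: cmp_enc)
qed

lemma cmp_tl: "cmp k f \<Longrightarrow> cmp k (\<lambda>e. tl (f e))"
proof -
  assume "cmp k f"
  then have "cmp k (\<lambda>e. snd (dec (enc (f e) - Suc 0) :: nat \<times> nat))"
    by (intro cmp_snd cmp_dec cmp_pred) (simp add: cmp_enc)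
  moreover have "snd (dec (enc xs - Suc 0) :: nat \<times> nat) = enc (tl xs)" for xs :: "'a list"
    by (cases xs) (simp_all add: enc_list_def dec_prod_def prod_decode_0)
  ultimately show ?thesis by (simp add: cmp_enc)
qed

lemma cmp_funpow:
  fixes G :: "'a :: nat_coded \<Rightarrow> nat list \<Rightarrow> 'a"
  assumes "cmp (Suc k) (\<lambda>e. G (dec (hd e)) (tl e))" "cmp k N" "cmp k A"
  shows "cmp k (\<lambda>e. ((\<lambda>y. G y e) ^^ N e) (A e))"
proof -
  have "cmp k (\<lambda>e. rec_nat (A e) (\<lambda>n y. G y e) (N e))"
    using cmp_weaken[OF assms(1), of 1] assms(2,3)
    by (intro cmp_rec_nat) (auto elim!: cmp_cong simp: drop_Suc dest!: length_SucD)
  moreover have "rec_nat (A e) (\<lambda>n y. G y e) n = ((\<lambda>y. G y e) ^^ n) (A e)" for n e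
    by (induction n) auto
  ultimately show ?thesis by simp
qed

text \<open>Supplies a computable number of iterations that is enough to consume a list.\<close>

lemma length_le_enc: "length xs \<le> enc xs" for xs :: "'a :: nat_coded list"
proof (induction xs)
  case (Cons x xs)
  then show ?case using le_prod_encode_2[of "enc xs" "enc x"] by (simp add: enc_list_def)
qed simp

text \<open>The state consists of the accumulator and the rest of the list. A step on an empty rest
  changes nothing, so it may be iterated \<open>enc (L e)\<close> times; the exact length is itself
  computed by a fold and is not yet available.\<close>

lemma cmp_fold:
  fixes F :: "'b :: nat_coded \<Rightarrow> 'c :: nat_coded \<Rightarrow> nat list \<Rightarrow> 'c"
  assumes F: "cmp (Suc (Suc k)) (\<lambda>e. F (dec (hd e)) (dec (hd (tl e))) (tl (tl e)))"
    and L: "cmp k L" and A: "cmp k A"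
  shows "cmp k (\<lambda>e. fold (\<lambda>x y. F x y e) (L e) (A e))"
proof -
  define G where "G y e = (if snd y = [] then y else (F (hd0 (snd y)) (fst y) e, tl (snd y)))" for y e
  have "cmp (Suc k) (\<lambda>e. F (hd0 (snd (dec (hd e) :: 'c \<times> 'b list))) (fst (dec (hd e) :: 'c \<times> 'b list)) (tl e))"
  proof -
    have "cmp (Suc k) (\<lambda>e. F (dec (hd (map (\<lambda>G. G e) Gs))) (dec (hd (tl (map (\<lambda>G. G e) Gs)))) (tl (tl (map (\<lambda>G. G e) Gs))))"
      if "Gs = (\<lambda>e. enc (hd0 (snd (dec (hd e) :: 'c \<times> 'b list)))) # (\<lambda>e. enc (fst (dec (hd e) :: 'c \<times> 'b list))) # map (\<lambda>i e. e ! Suc i) [0..<k]" for Gs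
      by (rule cmp_comp)
        (use that F cmp_proj[where 'a = nat, of _ "Suc k"] in
          \<open>auto simp: cmp_enc intro!: cmp_hd0 cmp_fst cmp_snd cmp_vars\<close>)
    from this[OF refl] show ?thesis
      by (rule cmp_cong)
        (auto simp: o_def map_nth dest!: length_SucD)
  qed
  then have "cmp (Suc k) (\<lambda>e. G (dec (hd e)) (tl e))"
    unfolding G_def by (intro cmp_if dcd_eq cmp_Pair cmp_snd cmp_const cmp_vars cmp_tl) simp
  then have "cmp k (\<lambda>e. fst (((\<lambda>y. G y e) ^^ enc (L e)) (A e, L e)))"
    using L A by (intro cmp_fst cmp_funpow cmp_Pair) (simp_all add: cmp_enc)
  moreover have r: "((\<lambda>y. G y e) ^^ n) (a, xs) = (fold (\<lambda>x y. F x y e) xs a, [])" if "length xs \<le> n" for n a xs e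
    using that
  proof (induction n arbitrary: a xs)
    case (Suc n)
    then show ?case
      using Suc.IH[of "tl xs" "F (hd xs) a e"] Suc.IH[of xs a]
      by (cases xs) (simp_all add: G_def hd0_def funpow_Suc_right del: funpow.simps)
  qed simp
  ultimately show ?thesis by (simp add: r length_le_enc)
qed

lemma fold_Cons_map: "fold (\<lambda>x y. f x # y) xs ys = rev (map f xs) @ ys"
  by (induction xs arbitrary: ys) auto

lemma cmp_rev: "cmp k L \<Longrightarrow> cmp k (\<lambda>e. rev (L e))"
  using cmp_fold[of k "\<lambda>x y e. x # y" L "\<lambda>e. []"]
  by (simp add: cmp_Cons cmp_vars cmp_const fold_Cons_map[of "\<lambda>x. x", simplified])

lemma cmp_append: "cmp k L \<Longrightarrow> cmp k M \<Longrightarrow> cmp k (\<lambda>e. L e @ M e)"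
  using cmp_fold[of k "\<lambda>x y e. x # y" "\<lambda>e. rev (L e)" M]
  by (simp add: cmp_Cons cmp_vars cmp_rev fold_Cons_map[of "\<lambda>x. x", simplified])

lemma cmp_skip': "cmp (Suc k) (\<lambda>e. F (dec (hd e)) (tl e)) \<Longrightarrow> cmp (Suc (Suc k)) (\<lambda>e. F (dec (hd e)) (tl (tl e)))"
  using cmp_skip[of k "\<lambda>e. F (dec (hd e)) (tl e)"] by simp

lemma dcd_skip': "dcd (Suc k) (\<lambda>e. P (dec (hd e)) (tl e)) \<Longrightarrow> dcd (Suc (Suc k)) (\<lambda>e. P (dec (hd e)) (tl (tl e)))"
  unfolding dcd_def by (rule cmp_skip')

lemma cmp_map:
  assumes "cmp (Suc k) (\<lambda>e. F (dec (hd e)) (tl e))" "cmp k L"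
  shows "cmp k (\<lambda>e. map (\<lambda>x. F x e) (L e))"
proof -
  have "cmp k (\<lambda>e. rev (fold (\<lambda>x y. F x e # y) (L e) []))"
    by (intro cmp_rev cmp_fold cmp_Cons cmp_skip' assms cmp_const cmp_vars)
  then show ?thesis by (simp add: fold_Cons_map)
qed

lemma cmp_filter:
  fixes P :: "'a :: nat_coded \<Rightarrow> nat list \<Rightarrow> bool"
  assumes "dcd (Suc k) (\<lambda>e. P (dec (hd e)) (tl e))" "cmp k L"
  shows "cmp k (\<lambda>e. filter (\<lambda>x. P x e) (L e))"
proof -
  have "cmp k (\<lambda>e. rev (fold (\<lambda>x y. if P x e then x # y else y) (L e) []))"
    by (intro cmp_rev cmp_fold cmp_if dcd_skip' cmp_Cons assms cmp_const cmp_vars)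
  moreover have "fold (\<lambda>x y. if Q x then x # y else y) xs ys = rev (filter Q xs) @ ys" for Q and xs ys :: "'a list"
    by (induction xs arbitrary: ys) auto
  ultimately show ?thesis by simp
qed

lemma cmp_concat: "cmp k L \<Longrightarrow> cmp k (\<lambda>e. concat (L e))"
proof -
  assume "cmp k L"
  then have "cmp k (\<lambda>e. fold (\<lambda>x y. x @ y) (rev (L e)) [])"
    by (intro cmp_rev cmp_fold cmp_append cmp_const cmp_vars)
  moreover have "fold (\<lambda>x y. x @ y) (rev xs) ys = concat xs @ ys" for xs and ys :: "'a list"
    by (induction xs arbitrary: ys) auto
  ultimately show ?thesis by simp
qed

lemma cmp_length: "cmp k L \<Longrightarrow> cmp k (\<lambda>e. length (L e))"
proof -
  assume "cmp k L"
  then have "cmp k (\<lambda>e. fold (\<lambda>x y. Suc y) (L e) 0)"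
    by (intro cmp_fold cmp_Suc cmp_const cmp_vars)
  moreover have "fold (\<lambda>x y. Suc y) xs n = length xs + n" for n and xs :: "'a list"
    by (induction xs arbitrary: n) auto
  ultimately show ?thesis by simp
qed

lemma cmp_upt: "cmp k N \<Longrightarrow> cmp k (\<lambda>e. [0..<N e])"
proof -
  assume "cmp k N"
  then have "cmp k (\<lambda>e. rec_nat [] (\<lambda>n y. y @ [n]) (N e))"
    by (intro cmp_rec_nat cmp_append cmp_Cons cmp_const cmp_vars cmp_vars_nat)
  moreover have "rec_nat [] (\<lambda>n y. y @ [n]) n = [0..<n]" for n by (induction n) auto
  ultimately show ?thesis by simp
qed

definition nth0 :: "'a :: nat_coded list \<Rightarrow> nat \<Rightarrow> 'a" where
  "nth0 xs i = hd0 ((tl ^^ i) xs)"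

lemma nth0 [simp]: "i < length xs \<Longrightarrow> nth0 xs i = xs ! i"
proof -
  have "(tl ^^ i) xs = drop i xs" by (induction i) (auto simp: drop_Suc tl_drop)
  then show "i < length xs \<Longrightarrow> ?thesis" by (simp add: nth0_def hd0_def hd_drop_conv_nth)
qed

lemma cmp_nth0: "cmp k L \<Longrightarrow> cmp k N \<Longrightarrow> cmp k (\<lambda>e. nth0 (L e) (N e))"
  unfolding nth0_def by (intro cmp_hd0 cmp_funpow[where G = "\<lambda>y e. tl y"] cmp_tl cmp_vars)

lemma dcd_Ball:
  assumes "dcd (Suc k) (\<lambda>e. P (dec (hd e)) (tl e))" "cmp k L"
  shows "dcd k (\<lambda>e. \<forall>x\<in>set (L e). P x e)"
proof -
  have "dcd k (\<lambda>e. filter (\<lambda>x. \<not> P x e) (L e) = [])"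
    by (intro dcd_eq cmp_filter dcd_not assms cmp_const)
  then show ?thesis by (rule dcd_cong) (simp add: filter_empty_conv)
qed

lemma dcd_Bex:
  assumes "dcd (Suc k) (\<lambda>e. P (dec (hd e)) (tl e))" "cmp k L"
  shows "dcd k (\<lambda>e. \<exists>x\<in>set (L e). P x e)"
  by (rule dcd_cong[OF dcd_not[OF dcd_Ball[OF dcd_not[OF assms(1)] assms(2)]]]) auto

lemma dcd_member: "cmp k f \<Longrightarrow> cmp k L \<Longrightarrow> dcd k (\<lambda>e. f e \<in> set (L e))"
proof -
  assume "cmp k f" "cmp k L"
  then have "dcd k (\<lambda>e. \<exists>x\<in>set (L e). x = f e)"
    by (intro dcd_Bex dcd_eq cmp_vars) (use cmp_weaken[of k f 1] in \<open>simp_all add: drop_Suc\<close>)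
  then show ?thesis by (rule dcd_cong) auto
qed

lemma dcd_app1:
  assumes "dcd (Suc 0) (\<lambda>e. P (dec (hd e)))" "cmp k f"
  shows "dcd k (\<lambda>e. P (f e))"
  using assms unfolding dcd_def by (rule cmp_app1)

lemma dcd_app3:
  assumes "dcd (Suc (Suc (Suc 0))) (\<lambda>e. P (dec (hd e)) (dec (hd (tl e))) (dec (hd (tl (tl e)))))"
    "cmp k f" "cmp k g" "cmp k h"
  shows "dcd k (\<lambda>e. P (f e) (g e) (h e))"
  using assms unfolding dcd_def by (rule cmp_app3)

lemmas cmp_intros = cmp_const cmp_vars cmp_vars_nat cmp_Suc cmp_add cmp_mult cmp_diff cmp_power cmp_mod cmp_div
  cmp_if cmp_fst cmp_snd cmp_Pair cmp_Cons cmp_append cmp_map cmp_filter cmp_concat cmp_length cmp_upt cmp_nth0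
  dcd_le dcd_less dcd_eq dcd_conj dcd_disj dcd_not dcd_odd dcd_Ball dcd_Bex dcd_member

text \<open>The characteristic function of the negation vanishes exactly where \<open>P\<close>
  holds. It is defined everywhere, so minimisation gets past all smaller numbers and stops at the
  least solution.\<close>

theorem unbounded_search:
  assumes "dcd (Suc k) (\<lambda>e. P (hd e) (tl e))"
  obtains r where "\<And>e. length e = k \<Longrightarrow> \<exists>n. P n e \<Longrightarrow> \<exists>n. P n e \<and> computes r e n"
proof -
  obtain f where f: "\<And>e. length e = Suc k \<Longrightarrow> computes f e (of_bool (\<not> P (hd e) (tl e)))"
    using dcd_not[OF assms] by (auto simp: dcd_def cmp_def)
  have "\<exists>n. P n e \<and> computes (Mu_f f) e n" if e: "length e = k" "\<exists>n. P n e" for e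
  proof (intro exI conjI)
    let ?n = "LEAST n. P n e"
    show n: "P ?n e" using e(2) by (rule LeastI_ex)
    show "computes (Mu_f f) e ?n"
    proof (rule computes.mu)
      show "computes f (?n # e) 0" using f[of "?n # e"] n e(1) by simp
      show "\<forall>i<?n. \<exists>v. computes f (i # e) (Suc v)"
      proof (intro allI impI)
        fix i assume "i < ?n"
        then have "\<not> P i e" by (rule not_less_Least)
        then show "\<exists>v. computes f (i # e) (Suc v)" using f[of "i # e"] e(1) by auto
      qed
    qed
  qed
  then show ?thesis using that by blast
qed

section \<open>A computable test for certificates\<close>

definition table_mult :: "nat list list \<Rightarrow> nat list list \<Rightarrow> nat \<Rightarrow> nat \<Rightarrow> nat" where
  "table_mult s t i j = nth0 (nth0 s (i div length t)) (j div length t) * length t +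
     nth0 (nth0 t (i mod length t)) (j mod length t)"

text \<open>The list form of \<open>set_decode\<close>, cut off at \<open>N\<close>.\<close>

definition bits :: "nat \<Rightarrow> nat \<Rightarrow> nat list" where
  "bits N s = filter (\<lambda>h. odd (s div 2 ^ h)) [0..<N]"

text \<open>The test uses the product alone, without unit or inverses: in a finite group a nonempty
  set closed under products is a subgroup, and two elements make it nontrivial. The iterate in the
  last line is \<open>a [^] q \<otimes> a\<close>, so the equation says that the \<open>q\<close>-th
  power of \<open>a\<close> is the unit. The prime may be bounded by \<open>N\<close> because it is
  the order of an element.\<close>

definition elab_code :: "nat \<Rightarrow> (nat \<Rightarrow> nat \<Rightarrow> nat) \<Rightarrow> nat \<Rightarrow> bool" where
  "elab_code N m s \<longleftrightarrow> s < 2 ^ N \<and> 2 \<le> length (bits N s) \<and>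
     (\<forall>a\<in>set (bits N s). \<forall>b\<in>set (bits N s). m a b \<in> set (bits N s) \<and> m a b = m b a) \<and>
     (\<exists>q\<in>set [0..<Suc N]. 2 \<le> q \<and> (\<forall>a\<in>set [0..<q]. \<forall>b\<in>set [0..<q]. a * b \<noteq> q) \<and>
        (\<forall>a\<in>set (bits N s). ((\<lambda>y. m a y) ^^ q) a = a))"

definition letter_ok :: "nat \<Rightarrow> (nat \<Rightarrow> nat \<Rightarrow> nat) \<Rightarrow> nat \<times> nat \<Rightarrow> bool" where
  "letter_ok N m l \<longleftrightarrow> fst l < N \<and> elab_code N m (snd l)"

definition translate :: "(nat \<Rightarrow> nat \<Rightarrow> nat) \<Rightarrow> nat \<Rightarrow> (nat \<times> nat) list \<Rightarrow> (nat \<times> nat) list" where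
  "translate m g w = map (\<lambda>l. (m g (fst l), snd l)) w"

text \<open>
  A signed word \<open>(c, w)\<close> stands for \<open>w\<close> if \<open>c = 2\<close> and for \<open>- w\<close> if \<open>c = 1\<close>: these are the codes of the
  integers \<open>1\<close> and \<open>-1\<close>. An entry \<open>(c, u, (g, s), v)\<close> of a certificate stands for the relation
  \<open>\<plusminus> u (g (N\<^sub>E x\<^sub>E) - 1) v\<close>, where \<open>s\<close> is the code of \<open>E\<close>.
\<close>

type_synonym sword = "nat \<times> (nat \<times> nat) list"
type_synonym rel = "nat \<times> (nat \<times> nat) list \<times> (nat \<times> nat) \<times> (nat \<times> nat) list"

text \<open>\<open>3 - fst j\<close> is the opposite sign. The first word comes from the constant 1
  in the relation, the others from the terms of the norm.\<close>

definition rel_words :: "nat \<Rightarrow> (nat \<Rightarrow> nat \<Rightarrow> nat) \<Rightarrow> rel \<Rightarrow> sword list" where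
  "rel_words N m j =
     (3 - fst j, fst (snd j) @ snd (snd (snd j))) #
     map (\<lambda>h. (fst j, fst (snd j) @ (m (fst (fst (snd (snd j)))) h, snd (fst (snd (snd j)))) # snd (snd (snd j))))
       (bits N (snd (fst (snd (snd j)))))"

definition norm_words :: "nat \<Rightarrow> (nat \<Rightarrow> nat \<Rightarrow> nat) \<Rightarrow> sword list \<Rightarrow> sword list" where
  "norm_words N m \<Phi> = concat (map (\<lambda>t. map (\<lambda>g. (fst t, translate m g (snd t))) [0..<N]) \<Phi>)"

text \<open>The test whether the value of \<open>L\<close> in the free ring is zero; only finitely
  many words have to be inspected, since all others have coefficient zero.\<close>

definition balanced :: "sword list \<Rightarrow> bool" where
  "balanced L \<longleftrightarrow> (\<forall>t\<in>set L.
     length (filter (\<lambda>t'. t' = (2, snd t)) L) = length (filter (\<lambda>t'. t' = (1, snd t)) L))"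

text \<open>\<open>(1, [])\<close> is the constant -1, so the last line says that the norm of
  \<open>\<Phi>\<close>, minus 1, plus the sum of the relations in \<open>J\<close> is zero in the
  free ring. The other lines make sure that only genuine variables and signs occur.\<close>

definition certifies :: "nat \<Rightarrow> (nat \<Rightarrow> nat \<Rightarrow> nat) \<Rightarrow> sword list \<Rightarrow> rel list \<Rightarrow> bool" where
  "certifies N m \<Phi> J \<longleftrightarrow>
     (\<forall>t\<in>set \<Phi>. (fst t = 1 \<or> fst t = 2) \<and> (\<forall>l\<in>set (snd t). letter_ok N m l)) \<and>
     (\<forall>j\<in>set J. (fst j = 1 \<or> fst j = 2) \<and> (\<forall>l\<in>set (fst (snd j)). letter_ok N m l) \<and>
        letter_ok N m (fst (snd (snd j))) \<and> (\<forall>l\<in>set (snd (snd (snd j))). letter_ok N m l)) \<and>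
     balanced (norm_words N m \<Phi> @ (1, []) # concat (map (\<lambda>j. rel_words N m j) J))"

lemma cmp_table_mult:
  "cmp k f \<Longrightarrow> cmp k g \<Longrightarrow> cmp k a \<Longrightarrow> cmp k b \<Longrightarrow> cmp k (\<lambda>e. table_mult (f e) (g e) (a e) (b e))"
  by (rule cmp_app4[where F = table_mult]) (unfold table_mult_def, intro cmp_intros)

lemma cmp_bits: "cmp k f \<Longrightarrow> cmp k g \<Longrightarrow> cmp k (\<lambda>e. bits (f e) (g e))"
  by (rule cmp_app2[where F = bits]) (unfold bits_def, intro cmp_intros)

text \<open>A function cannot be an input of a program, so the product is always given through the
  two tables.\<close>

lemma dcd_elab_code: "cmp k f \<Longrightarrow> cmp k g \<Longrightarrow> cmp k h \<Longrightarrow>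
    dcd k (\<lambda>e. elab_code (length (f e) * length (g e)) (table_mult (f e) (g e)) (h e))"
  by (rule dcd_app3[where P = "\<lambda>s t. elab_code (length s * length t) (table_mult s t)"])
    (unfold elab_code_def, intro cmp_intros cmp_funpow cmp_bits cmp_table_mult)

lemma dcd_letter_ok: "cmp k f \<Longrightarrow> cmp k g \<Longrightarrow> cmp k h \<Longrightarrow>
    dcd k (\<lambda>e. letter_ok (length (f e) * length (g e)) (table_mult (f e) (g e)) (h e))"
  unfolding letter_ok_def by (intro cmp_intros dcd_elab_code)

lemma cmp_translate: "cmp k f \<Longrightarrow> cmp k g \<Longrightarrow> cmp k a \<Longrightarrow> cmp k b \<Longrightarrow>
    cmp k (\<lambda>e. translate (table_mult (f e) (g e)) (a e) (b e))"
  by (rule cmp_app4[where F = "\<lambda>s t. translate (table_mult s t)"])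
    (unfold translate_def, intro cmp_intros cmp_table_mult)

lemma cmp_rel_words: "cmp k f \<Longrightarrow> cmp k g \<Longrightarrow> cmp k h \<Longrightarrow>
    cmp k (\<lambda>e. rel_words (length (f e) * length (g e)) (table_mult (f e) (g e)) (h e))"
  by (rule cmp_app3[where F = "\<lambda>s t. rel_words (length s * length t) (table_mult s t)"])
    (unfold rel_words_def, intro cmp_intros cmp_table_mult cmp_bits)

lemma cmp_norm_words: "cmp k f \<Longrightarrow> cmp k g \<Longrightarrow> cmp k h \<Longrightarrow>
    cmp k (\<lambda>e. norm_words (length (f e) * length (g e)) (table_mult (f e) (g e)) (h e))"
  by (rule cmp_app3[where F = "\<lambda>s t. norm_words (length s * length t) (table_mult s t)"])
    (unfold norm_words_def, intro cmp_intros cmp_translate)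

lemma dcd_balanced: "cmp k f \<Longrightarrow> dcd k (\<lambda>e. balanced (f e))"
  by (rule dcd_app1[where P = balanced]) (unfold balanced_def, intro cmp_intros)

lemma dcd_certifies: "dcd (Suc (Suc (Suc (Suc 0)))) (\<lambda>e. certifies
    (length (dec (hd (tl e)) :: nat list list) * length (dec (hd (tl (tl e))) :: nat list list))
    (table_mult (dec (hd (tl e))) (dec (hd (tl (tl e)))))
    (fst (dec (hd e) :: sword list \<times> rel list)) (snd (dec (hd e) :: sword list \<times> rel list)))"
  unfolding certifies_def
  by (intro cmp_intros dcd_letter_ok dcd_balanced cmp_norm_words cmp_rel_words)

text \<open>The search runs through the codes of pairs of a candidate and a certificate; a second
  program then forgets the certificate.\<close>

theorem formula_search:
  obtains r where "\<And>s t c. \<exists>\<Phi> J. certifies (length s * length t) (table_mult s t) \<Phi> J \<Longrightarrow>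
    \<exists>\<Phi> J. certifies (length s * length t) (table_mult s t) \<Phi> J \<and> computes r [enc s, enc t, c] (enc \<Phi>)"
proof -
  define P where "P n e = certifies
    (length (dec (hd e) :: nat list list) * length (dec (hd (tl e)) :: nat list list))
    (table_mult (dec (hd e)) (dec (hd (tl e))))
    (fst (dec n :: sword list \<times> rel list)) (snd (dec n :: sword list \<times> rel list))" for n e
  obtain r where r: "\<And>e. length e = 3 \<Longrightarrow> \<exists>n. P n e \<Longrightarrow> \<exists>n. P n e \<and> computes r e n"
    using unbounded_search[of "Suc (Suc (Suc 0))" P] dcd_certifies
    unfolding P_def numeral_3_eq_3 by blast
  have "cmp (Suc 0) (\<lambda>e. fst (dec (hd e) :: sword list \<times> rel list))" by (intro cmp_intros)
  then obtain f where f: "\<And>n. computes f [n] (enc (fst (dec n :: sword list \<times> rel list)))"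
    unfolding cmp_def by (metis length_Cons list.sel(1) list.size(3))
  show ?thesis
  proof (rule that[of "Comp_f f [r]"])
    fix s t :: "nat list list" and c
    assume "\<exists>\<Phi> J. certifies (length s * length t) (table_mult s t) \<Phi> J"
    then obtain \<Phi> J where "certifies (length s * length t) (table_mult s t) \<Phi> J" by blast
    then have "P (enc (\<Phi>, J)) [enc s, enc t, c]" by (simp add: P_def)
    then obtain n where n: "P n [enc s, enc t, c]" "computes r [enc s, enc t, c] n"
      using r[of "[enc s, enc t, c]"] by auto
    then have "computes (Comp_f f [r]) [enc s, enc t, c] (enc (fst (dec n :: sword list \<times> rel list)))"
      using f by (intro computes.comp[of _ _ "[n]"]) auto
    with n(1) show "\<exists>\<Phi> J. certifies (length s * length t) (table_mult s t) \<Phi> J \<and>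
        computes (Comp_f f [r]) [enc s, enc t, c] (enc \<Phi>)" by (auto simp: P_def)
  qed
qed

section \<open>Powers of an element and cyclic subgroups\<close>

lemma (in group) power_hom_integer_mod_group:
  assumes a: "a \<in> carrier G" and n: "0 < n" "a [^] (n :: nat) = \<one>"
  shows "(\<lambda>k :: int. a [^] k) \<in> hom (integer_mod_group n) G"
proof (rule homI)
  have "a [^] (k mod int n) = a [^] k" for k :: int
  proof -
    have "a [^] k = a [^] (int n * (k div int n) + k mod int n)" by simp
    also have "\<dots> = (a [^] int n) [^] (k div int n) \<otimes> a [^] (k mod int n)"
      using a by (simp only: int_pow_mult int_pow_pow)
    also have "a [^] int n = \<one>" using n a by (simp add: int_pow_int)
    finally show ?thesis using a by simp
  qed
  then show "a [^] (x \<otimes>\<^bsub>integer_mod_group n\<^esub> y) = a [^] x \<otimes> a [^] y" for x y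
    using a by (simp add: int_pow_mult)
qed (use a in simp)

lemma (in group) cyclic_subgroup_mon:
  assumes a: "a \<in> carrier G" and n: "0 < ord a"
  shows "(\<lambda>k :: int. a [^] k) \<in> mon (integer_mod_group (ord a)) G"
    "(\<lambda>k :: int. a [^] k) ` carrier (integer_mod_group (ord a)) = range (\<lambda>k :: int. a [^] k)"
proof -
  let ?Z = "integer_mod_group (ord a)"
  have hom: "(\<lambda>k :: int. a [^] k) \<in> hom ?Z G"
    using power_hom_integer_mod_group[of a "ord a"] a n by simp
  interpret h: group_hom ?Z G "\<lambda>k :: int. a [^] k"
    by (intro group_hom.intro group_hom_axioms.intro hom) simp_all
  have "inj_on (\<lambda>k :: int. a [^] k) (carrier ?Z)"
  proof (subst h.inj_on_one_iff, intro allI impI)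
    fix k assume k: "k \<in> carrier ?Z" "a [^] k = \<one>"
    then have "int (ord a) dvd k" using a by (simp add: int_pow_eq_id)
    then show "k = \<one>\<^bsub>?Z\<^esub>"
      using k n by (simp add: carrier_integer_mod_group) (metis zdvd_imp_le not_less order_le_less)
  qed
  then show "(\<lambda>k :: int. a [^] k) \<in> mon ?Z G" using hom by (simp add: mon_def)
  show "(\<lambda>k. a [^] k) ` carrier ?Z = range (\<lambda>k :: int. a [^] k)"
  proof (intro equalityI subsetI)
    fix x assume "x \<in> range (\<lambda>k :: int. a [^] k)"
    then obtain k :: int where x: "x = a [^] k" by blast
    have "k mod int (ord a) \<in> carrier ?Z" using n by (simp add: carrier_integer_mod_group)
    moreover have "a [^] (k mod int (ord a)) = a [^] k"
      using a by (simp flip: int_pow_eq_id add: int_pow_eq)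
    ultimately show "x \<in> (\<lambda>k. a [^] k) ` carrier ?Z" using x by (metis image_eqI)
  qed auto
qed

lemma (in group) cyclic_subgroup_iso:
  assumes a: "a \<in> carrier G" and n: "0 < ord a"
  shows "G\<lparr>carrier := range (\<lambda>k :: int. a [^] k)\<rparr> \<cong> integer_mod_group (ord a)"
proof -
  have "(\<lambda>k :: int. a [^] k) \<in> iso (integer_mod_group (ord a)) (G\<lparr>carrier := range (\<lambda>k :: int. a [^] k)\<rparr>)"
    using cyclic_subgroup_mon[OF a n] by (auto simp: iso_def mon_def bij_betw_def hom_def)
  then show ?thesis
    using group.iso_sym[OF group_integer_mod_group] by (auto simp: is_iso_def)
qed

section \<open>Elementary abelian groups\<close>

text \<open>By Bezout \<open>k\<close> is invertible modulo \<open>q\<close>, so \<open>a\<close> is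
  a power of \<open>a [^] k\<close>.\<close>

lemma (in group) prime_power_mem_subgroup:
  assumes "subgroup B G" "a \<in> carrier G" "a [^] k \<in> B" "Factorial_Ring.prime q" "a [^] (q :: nat) = \<one>" "\<not> int q dvd k"
  shows "a \<in> B"
proof -
  have "coprime k (int q)"
    using assms(4,6) by (metis coprime_commute prime_imp_coprime prime_nat_int_transfer)
  then obtain s t where st: "s * k + t * int q = 1" using bezout_int[of k "int q"] by auto
  have "a = a [^] (k * s + int q * t)" using st assms(2) by (simp add: mult.commute)
  also have "\<dots> = (a [^] k) [^] s \<otimes> (a [^] int q) [^] t"
    using assms(2) by (simp only: int_pow_mult int_pow_pow int_pow_closed)
  also have "a [^] int q = \<one>" using assms(5) by (simp add: int_pow_int)
  finally have "a = (a [^] k) [^] s" using assms(2) by simp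
  then show "a \<in> B" using subgroup_int_pow_closed[OF assms(1,3)] by metis
qed

text \<open>This is the extension of a linearly independent family by one vector, done without a
  vector space: a nontrivial power of \<open>a\<close> in the image of \<open>f\<close> would put
  \<open>a\<close> itself there, since \<open>q\<close> is prime.\<close>

lemma (in comm_group) extend_mon_cyclic_power:
  assumes q: "Factorial_Ring.prime q" "\<And>x. x \<in> carrier G \<Longrightarrow> x [^] (q :: nat) = \<one>"
    and f: "f \<in> mon (cyclic_power q r) G" and a: "a \<in> carrier G" "a \<notin> f ` carrier (cyclic_power q r)"
  shows "(\<lambda>v. f (restrict v {..<r}) \<otimes> a [^] v r) \<in> mon (cyclic_power q (Suc r)) G" (is "?f \<in> _")
proof -
  have q0: "0 < q" using q(1) prime_gt_0_nat by blast
  interpret f: group_hom "cyclic_power q r" G f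
    using f by (auto simp: mon_def intro!: group_hom.intro group_hom_axioms.intro)
  have restr: "restrict v {..<r} \<in> carrier (cyclic_power q r)" if "v \<in> carrier (cyclic_power q (Suc r))" for v
    using that by (auto simp: PiE_iff)
  have hom: "?f \<in> hom (cyclic_power q (Suc r)) G"
  proof (rule homI)
    fix v w assume v: "v \<in> carrier (cyclic_power q (Suc r))" and w: "w \<in> carrier (cyclic_power q (Suc r))"
    have "restrict (v \<otimes>\<^bsub>cyclic_power q (Suc r)\<^esub> w) {..<r} = restrict v {..<r} \<otimes>\<^bsub>cyclic_power q r\<^esub> restrict w {..<r}"
      by (auto simp: restrict_def fun_eq_iff)
    moreover have "a [^] ((v r + w r) mod int q) = a [^] v r \<otimes> a [^] w r"
      using power_hom_integer_mod_group[OF a(1) q0 q(2)[OF a(1)]] v w by (auto simp: hom_def PiE_iff)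
    ultimately show "?f (v \<otimes>\<^bsub>cyclic_power q (Suc r)\<^esub> w) = ?f v \<otimes> ?f w"
      using f.hom_mult[OF restr[OF v] restr[OF w]] f.hom_closed[OF restr[OF v]] f.hom_closed[OF restr[OF w]] a
      by (simp add: m_ac)
  qed (use a f.hom_closed[OF restr] in auto)
  interpret g: group_hom "cyclic_power q (Suc r)" G ?f
    using hom by (auto intro!: group_hom.intro group_hom_axioms.intro)
  have "inj_on ?f (carrier (cyclic_power q (Suc r)))"
  proof (subst g.inj_on_one_iff, intro allI impI)
    fix v assume v: "v \<in> carrier (cyclic_power q (Suc r))" and one: "?f v = \<one>"
    let ?B = "f ` carrier (cyclic_power q r)"
    have B: "subgroup ?B G" by (rule f.img_is_subgroup)
    have vr: "0 \<le> v r" "v r < int q" using v q0 by (auto simp: PiE_iff carrier_integer_mod_group)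
    have "a [^] v r = inv (f (restrict v {..<r}))"
      using one a f.hom_closed[OF restr[OF v]] by (metis inv_equality int_pow_closed inv_inv m_comm)
    then have aB: "a [^] v r \<in> ?B" using B restr[OF v] by (simp add: subgroup.m_inv_closed)
    have "v r = 0"
    proof (rule ccontr)
      assume "v r \<noteq> 0"
      then have "\<not> int q dvd v r" using vr by (intro zdvd_not_zless) auto
      then have "a \<in> ?B" using prime_power_mem_subgroup[OF B a(1) aB q(1) q(2)[OF a(1)]] by simp
      then show False using a by blast
    qed
    moreover from this have "f (restrict v {..<r}) = \<one>"
      using one f.hom_closed[OF restr[OF v]] by simp
    then have "restrict v {..<r} = \<one>\<^bsub>cyclic_power q r\<^esub>"
      using f restr[OF v] f.inj_on_one_iff by (auto simp: mon_def)
    then have "\<forall>i<r. v i = 0" by (auto simp: fun_eq_iff restrict_def split: if_splits)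
    ultimately show "v = \<one>\<^bsub>cyclic_power q (Suc r)\<^esub>"
      using v by (auto simp: fun_eq_iff less_Suc_eq PiE_iff extensional_def)
  qed
  with hom show ?thesis by (simp add: mon_def)
qed

lemma card_cyclic_power: "0 < q \<Longrightarrow> card (carrier (cyclic_power q r)) = q ^ r"
  by (simp add: card_PiE carrier_integer_mod_group)

text \<open>An embedding of maximal rank exists because \<open>r < q ^ r \<le> order G\<close>; it
  is onto because otherwise it could be extended by one more coordinate.\<close>

lemma (in comm_group) iso_cyclic_power:
  assumes q: "Factorial_Ring.prime q" "\<And>x. x \<in> carrier G \<Longrightarrow> x [^] (q :: nat) = \<one>"
    and fin: "finite (carrier G)"
  obtains r where "G \<cong> cyclic_power q r"
proof -
  define P where "P r \<longleftrightarrow> (\<exists>f. f \<in> mon (cyclic_power q r) G)" for r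
  have q0: "0 < q" and q2: "2 \<le> q" using q(1) prime_gt_0_nat prime_ge_2_nat by blast+
  have "(\<lambda>_. \<one>) \<in> mon (cyclic_power q 0) G" by (simp add: mon_def hom_def)
  then have P0: "P 0" by (auto simp: P_def)
  have bound: "r < order G" if "P r" for r
  proof -
    obtain f where "f \<in> mon (cyclic_power q r) G" using \<open>P r\<close> unfolding P_def by blast
    then have "card (carrier (cyclic_power q r)) \<le> order G"
      unfolding order_def using fin by (intro card_inj_on_le[of f]) (auto simp: mon_def hom_def)
    then have "q ^ r \<le> order G" using q0 by (simp only: card_cyclic_power)
    moreover have "r < q ^ r" using q2 using less_exp[of r] power_mono[of 2 q r] q2 by linarith
    ultimately show ?thesis by simp
  qed
  define r where "r = Greatest P"
  have r: "P r" unfolding r_def using P0 bound by (intro GreatestI_nat[of P 0 "order G"]) (auto simp: less_imp_le)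
  have max: "s \<le> r" if "P s" for s
    unfolding r_def using that bound by (intro Greatest_le_nat[of P s "order G"]) (auto simp: less_imp_le)
  obtain f where f: "f \<in> mon (cyclic_power q r) G" using r unfolding P_def by blast
  have "f ` carrier (cyclic_power q r) = carrier G"
  proof (rule ccontr)
    assume "f ` carrier (cyclic_power q r) \<noteq> carrier G"
    then obtain a where "a \<in> carrier G" "a \<notin> f ` carrier (cyclic_power q r)"
      using f by (auto simp: mon_def hom_def)
    then have "P (Suc r)" using extend_mon_cyclic_power[OF q f] by (auto simp: P_def)
    then show False using max by fastforce
  qed
  then have "f \<in> iso (cyclic_power q r) G" using f by (auto simp: iso_iff_mon_epi epi_def mon_def)
  then have "cyclic_power q r \<cong> G" by (auto simp: is_iso_def)
  then have "G \<cong> cyclic_power q r" using group.iso_sym[of "cyclic_power q r" G] by simp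
  then show ?thesis by (rule that)
qed

lemma pow_cyclic_power:
  "v \<in> carrier (cyclic_power q r) \<Longrightarrow> v [^]\<^bsub>cyclic_power q r\<^esub> (n :: nat) = (\<lambda>i\<in>{..<r}. (int n * v i) mod int q)"
proof (induction n)
  case (Suc n)
  then show ?case by (auto simp: restrict_def fun_eq_iff distrib_right mod_simps add.commute)
qed auto

text \<open>Replaces the isomorphism with a power of a cyclic group by conditions on elements, which
  can be moved along homomorphisms and tested by a program. Being nontrivial corresponds to
  \<open>1 \<le> r\<close>.\<close>

theorem elementary_abelian_iff:
  fixes G (structure)
  assumes "group G"
  shows "elementary_abelian G \<longleftrightarrow> finite (carrier G) \<and> carrier G \<noteq> {\<one>\<^bsub>G\<^esub>} \<and>
    (\<forall>x\<in>carrier G. \<forall>y\<in>carrier G. x \<otimes>\<^bsub>G\<^esub> y = y \<otimes>\<^bsub>G\<^esub> x) \<and>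
    (\<exists>q. Factorial_Ring.prime q \<and> (\<forall>x\<in>carrier G. x [^]\<^bsub>G\<^esub> (q :: nat) = \<one>\<^bsub>G\<^esub>))"
    (is "_ \<longleftrightarrow> ?R")
proof
  interpret group G by fact
  assume "elementary_abelian G"
  then obtain q r f where q: "Factorial_Ring.prime q" and r: "1 \<le> r" and f: "f \<in> iso G (cyclic_power q r)"
    by (auto simp: elementary_abelian_def is_iso_def)
  interpret f: group_hom G "cyclic_power q r" f
    using f by (auto simp: iso_def intro!: group_hom.intro group_hom_axioms.intro)
  have inj: "inj_on f (carrier G)" and im: "f ` carrier G = carrier (cyclic_power q r)"
    using f by (auto simp: iso_def bij_betw_def)
  have q2: "2 \<le> q" using q prime_ge_2_nat by blast
  have card: "card (carrier G) = q ^ r"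
    using card_image[OF inj] card_cyclic_power[of q r] q2 by (simp only: im)
  have "1 < q ^ r" using q2 r one_less_power[of q r] by simp
  then have fin: "finite (carrier G)" "carrier G \<noteq> {\<one>}" using card q2 card_ge_0_finite[of "carrier G"] by auto
  have comm: "x \<otimes> y = y \<otimes> x" if "x \<in> carrier G" "y \<in> carrier G" for x y
  proof -
    have "f (x \<otimes> y) = f (y \<otimes> x)" using that by (auto simp: add.commute)
    then show ?thesis using inj that by (meson inj_onD m_closed)
  qed
  have "x [^] q = \<one>" if x: "x \<in> carrier G" for x
  proof -
    have "f x \<in> carrier (cyclic_power q r)" using x by (rule f.hom_closed)
    then have "f (x [^] q) = f \<one>"
      using x pow_cyclic_power[of "f x" _ q] f.hom_nat_pow[OF x, of q] by simp
    then show ?thesis using inj x by (meson inj_onD nat_pow_closed one_closed)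
  qed
  with q fin comm show ?R by blast
next
  interpret group G by fact
  assume R: ?R
  then obtain q :: nat where q: "Factorial_Ring.prime q" "\<And>x. x \<in> carrier G \<Longrightarrow> x [^] q = \<one>" by blast
  interpret comm_group G using R by (intro group_comm_groupI) auto
  obtain r where r: "G \<cong> cyclic_power q r" using iso_cyclic_power[OF q] R by blast
  have "r \<noteq> 0"
  proof
    assume "r = 0"
    then obtain f where f: "f \<in> iso G (cyclic_power q 0)" using r by (auto simp: is_iso_def)
    then have "card (carrier G) = 1"
      using bij_betw_same_card[of f] by (fastforce simp: iso_def)
    then show False using R one_closed by (metis card_1_singletonE singletonD)
  qed
  then show "elementary_abelian G"
    using q r group_axioms unfolding elementary_abelian_def by (metis less_one not_le)
qed

lemma (in group) subgroup_pow: "(x [^]\<^bsub>G\<lparr>carrier := E\<rparr>\<^esub> (n :: nat)) = x [^] n"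
  by (simp add: nat_pow_def)

lemma (in group) elem_ab_subgroups_iff:
  "E \<in> elem_ab_subgroups G \<longleftrightarrow> subgroup E G \<and> finite E \<and> E \<noteq> {\<one>} \<and>
    (\<forall>x\<in>E. \<forall>y\<in>E. x \<otimes> y = y \<otimes> x) \<and>
    (\<exists>q. Factorial_Ring.prime q \<and> (\<forall>x\<in>E. x [^] (q :: nat) = \<one>))"
proof (cases "subgroup E G")
  case True
  then have "group (G\<lparr>carrier := E\<rparr>)" by (rule subgroup.subgroup_is_group[OF _ group_axioms])
  from elementary_abelian_iff[OF this] True show ?thesis
    by (simp add: elem_ab_subgroups_def subgroup_pow)
qed (simp add: elem_ab_subgroups_def)

lemma (in group) carrier_elementary_abelian:
  "elementary_abelian G \<Longrightarrow> carrier G \<in> elem_ab_subgroups G"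
  by (simp add: elem_ab_subgroups_def subgroup_self)

section \<open>Elements of norm one\<close>

definition has_norm_one :: "'r ring \<Rightarrow> ('g \<Rightarrow> 'r \<Rightarrow> 'r) \<Rightarrow> 'g set \<Rightarrow> bool" where
  "has_norm_one R \<phi> U \<longleftrightarrow> (\<exists>x\<in>carrier R. Nrm R \<phi> U x = \<one>\<^bsub>R\<^esub>)"

text \<open>The existence statement behind a formula, with no polynomial involved; this is what
  passes through extensions of groups. The type argument fixes the type of the ring elements, over
  which a definition cannot quantify.\<close>

definition detects :: "'r itself \<Rightarrow> ('g, 'm) monoid_scheme \<Rightarrow> bool" where
  "detects _ G \<longleftrightarrow> (\<forall>(R :: 'r ring) \<phi>. ring_action G R \<phi> \<longrightarrow>
     (\<forall>E\<in>elem_ab_subgroups G. has_norm_one R \<phi> E) \<longrightarrow> has_norm_one R \<phi> (carrier G))"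

text \<open>The elements of \<open>BijGroup\<close> are extensional functions, hence the restriction
  to the carrier.\<close>

lemma ring_actionI:
  fixes G (structure)
  assumes G: "group G" and R: "ring R"
    and hom: "\<And>g. g \<in> carrier G \<Longrightarrow> \<phi> g \<in> ring_hom R R"
    and one: "\<And>x. x \<in> carrier R \<Longrightarrow> \<phi> \<one> x = x"
    and mult: "\<And>g h x. g \<in> carrier G \<Longrightarrow> h \<in> carrier G \<Longrightarrow> x \<in> carrier R \<Longrightarrow> \<phi> (g \<otimes> h) x = \<phi> g (\<phi> h x)"
  shows "ring_action G R (\<lambda>g. restrict (\<phi> g) (carrier R))"
proof -
  interpret G: group G by fact
  interpret R: ring R by fact
  have cl: "\<phi> g x \<in> carrier R" if "g \<in> carrier G" "x \<in> carrier R" for g x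
    using hom[OF that(1)] that(2) by (auto simp: ring_hom_def)
  have bij: "bij_betw (\<phi> g) (carrier R) (carrier R)" if g: "g \<in> carrier G" for g
  proof (rule bij_betw_byWitness[where f' = "\<phi> (inv g)"])
    show "\<forall>a\<in>carrier R. \<phi> (inv g) (\<phi> g a) = a" "\<forall>a\<in>carrier R. \<phi> g (\<phi> (inv g) a) = a"
      using mult[of "inv g" g] mult[of g "inv g"] one g by auto
  qed (use cl g in auto)
  then have Bij: "restrict (\<phi> g) (carrier R) \<in> Bij (carrier R)" if "g \<in> carrier G" for g
    using that by (simp add: Bij_def)
  have "group_hom G (BijGroup (carrier R)) (\<lambda>g. restrict (\<phi> g) (carrier R))"
  proof (intro group_hom.intro group_hom_axioms.intro G group_BijGroup homI)
    fix g h assume "g \<in> carrier G" "h \<in> carrier G"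
    then show "restrict (\<phi> (g \<otimes> h)) (carrier R) =
        restrict (\<phi> g) (carrier R) \<otimes>\<^bsub>BijGroup (carrier R)\<^esub> restrict (\<phi> h) (carrier R)"
      using Bij mult cl by (auto simp: BijGroup_def fun_eq_iff compose_def restrict_def)
  qed (use Bij in \<open>auto simp: BijGroup_def\<close>)
  moreover have "restrict (\<phi> g) (carrier R) \<in> ring_iso R R" if "g \<in> carrier G" for g
    using hom[OF that] bij[OF that] by (auto simp: ring_iso_def ring_hom_def)
  ultimately show ?thesis using R by (auto simp: ring_action_def group_action_def)
qed

lemma Nrm_restrict:
  assumes "ring R" "x \<in> carrier R" "\<And>g. g \<in> U \<Longrightarrow> \<phi> g x \<in> carrier R"
  shows "Nrm R (\<lambda>g. restrict (\<phi> g) (carrier R)) U x = Nrm R \<phi> U x"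
  using assms by (simp add: Nrm_def)

lemma ring_actionD:
  assumes "ring_action G R \<phi>"
  shows "group G" "ring R"
    "\<And>g. g \<in> carrier G \<Longrightarrow> \<phi> g \<in> ring_hom R R"
    "\<And>g x. g \<in> carrier G \<Longrightarrow> x \<in> carrier R \<Longrightarrow> \<phi> g x \<in> carrier R"
    "\<And>x. x \<in> carrier R \<Longrightarrow> \<phi> \<one>\<^bsub>G\<^esub> x = x"
    "\<And>g h x. g \<in> carrier G \<Longrightarrow> h \<in> carrier G \<Longrightarrow> x \<in> carrier R \<Longrightarrow> \<phi> (g \<otimes>\<^bsub>G\<^esub> h) x = \<phi> g (\<phi> h x)"
proof -
  interpret group_action G "carrier R" \<phi> using assms by (simp add: ring_action_def)
  show "group G" "ring R" "\<And>g. g \<in> carrier G \<Longrightarrow> \<phi> g \<in> ring_hom R R"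
    using assms group_hom by (auto simp: ring_action_def ring_iso_def group_hom_def)
  show "\<And>g x. g \<in> carrier G \<Longrightarrow> x \<in> carrier R \<Longrightarrow> \<phi> g x \<in> carrier R" using element_image by blast
  show "\<And>x. x \<in> carrier R \<Longrightarrow> \<phi> \<one>\<^bsub>G\<^esub> x = x" using id_eq_one by (metis restrict_apply')
  show "\<And>g h x. g \<in> carrier G \<Longrightarrow> h \<in> carrier G \<Longrightarrow> x \<in> carrier R \<Longrightarrow> \<phi> (g \<otimes>\<^bsub>G\<^esub> h) x = \<phi> g (\<phi> h x)"
    using composition_rule by blast
qed

lemma restrict_ring_action:
  assumes "ring_action G R \<phi>" "subgroup H G"
  shows "ring_action (G\<lparr>carrier := H\<rparr>) R \<phi>"
proof -
  interpret act: group_action G "carrier R" \<phi> using assms(1) by (simp add: ring_action_def)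
  interpret G: group G using act.group_hom by (simp add: group_hom_def)
  interpret h: group_hom G "BijGroup (carrier R)" \<phi> by (rule act.group_hom)
  have H: "H \<subseteq> carrier G" using assms(2) by (rule subgroup.subset)
  have "group_hom (G\<lparr>carrier := H\<rparr>) (BijGroup (carrier R)) \<phi>"
    by (intro group_hom.intro group_hom_axioms.intro group_BijGroup homI
        subgroup.subgroup_is_group[OF assms(2)] G.group_axioms)
      (use h.hom_mult[OF subsetD[OF H] subsetD[OF H]] h.hom_closed H in auto)
  then show ?thesis using assms(1) H by (auto simp: ring_action_def group_action_def)
qed

lemma (in group) elem_ab_subgroups_subgroup:
  assumes "subgroup H G"
  shows "elem_ab_subgroups (G\<lparr>carrier := H\<rparr>) \<subseteq> elem_ab_subgroups G"
  using incl_subgroup[OF assms] by (auto simp: elem_ab_subgroups_def)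

lemma has_norm_one_subgroup:
  fixes R :: "'r ring"
  assumes "ring_action G R \<phi>" "subgroup H G" "\<And>E. E \<in> elem_ab_subgroups G \<Longrightarrow> has_norm_one R \<phi> E"
    and "detects TYPE('r) (G\<lparr>carrier := H\<rparr>)"
  shows "has_norm_one R \<phi> H"
proof -
  interpret group G using ring_actionD(1)[OF assms(1)] .
  show ?thesis
    using assms(4) restrict_ring_action[OF assms(1,2)] assms(3) elem_ab_subgroups_subgroup[OF assms(2)]
    unfolding detects_def by fastforce
qed

lemma has_norm_one_trivial:
  assumes "ring_action G R \<phi>"
  shows "has_norm_one R \<phi> {\<one>\<^bsub>G\<^esub>}"
proof -
  note D = ring_actionD[OF assms]
  interpret R: ring R by (rule D(2))
  have "Nrm R \<phi> {\<one>\<^bsub>G\<^esub>} \<one>\<^bsub>R\<^esub> = \<one>\<^bsub>R\<^esub>" by (simp add: Nrm_def D(5))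
  then show ?thesis unfolding has_norm_one_def by blast
qed

text \<open>The quotient is given by an epimorphism onto \<open>K\<close> rather than as a group of
  cosets, so that isomorphisms, projections of products and copies of quotients are all
  instances.\<close>

theorem has_norm_one_extension:
  fixes R :: "'r ring" and G (structure)
  assumes act: "ring_action G R \<phi>" and fin: "finite (carrier G)"
    and K: "group K" and \<pi>: "\<pi> \<in> epi G K"
    and ker: "has_norm_one R \<phi> (kernel G K \<pi>)"
    and pre: "\<And>E. E \<in> elem_ab_subgroups K \<Longrightarrow> has_norm_one R \<phi> {g \<in> carrier G. \<pi> g \<in> E}"
    and det: "detects TYPE('r) K"
  shows "has_norm_one R \<phi> (carrier G)"
proof -
  note D = ring_actionD[OF act]
  interpret G: group G by (rule D(1))
  interpret K: group K by (rule K)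
  interpret R: ring R by (rule D(2))
  interpret \<pi>: group_hom G K \<pi>
    using \<pi> by (auto simp: epi_def intro!: group_hom.intro group_hom_axioms.intro)
  have surj: "\<pi> ` carrier G = carrier K" using \<pi> by (simp add: epi_def)
  define N where "N = kernel G K \<pi>"
  have subN: "subgroup N G" unfolding N_def by (rule \<pi>.subgroup_kernel)
  have N: "N \<subseteq> carrier G" using subN by (rule subgroup.subset)
  have finN: "finite N" using N fin finite_subset by blast
  have \<phi>hom: "ring_hom_ring R R (\<phi> g)" if "g \<in> carrier G" for g
    using D(3)[OF that] by (intro ring_hom_ringI2 R.ring_axioms)
  have \<phi>sum: "\<phi> g (\<Oplus>\<^bsub>R\<^esub>i\<in>A. f i) = (\<Oplus>\<^bsub>R\<^esub>i\<in>A. \<phi> g (f i))" if "g \<in> carrier G" "f \<in> A \<rightarrow> carrier R" for g f and A :: "'a set"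
    using ring_hom_ring.hom_finsum[OF \<phi>hom[OF that(1)] that(2)] by (simp add: comp_def)
  define S where "S = {x \<in> carrier R. \<forall>n\<in>N. \<phi> n x = x}"
  let ?S = "R\<lparr>carrier := S\<rparr>"
  have "subring S R"
  proof (rule R.subringI)
    show "\<one>\<^bsub>R\<^esub> \<in> S" using ring_hom_one[OF D(3)[OF subsetD[OF N]]] by (auto simp: S_def)
  next
    fix h assume h: "h \<in> S"
    have "\<phi> n (\<ominus>\<^bsub>R\<^esub> h) = \<ominus>\<^bsub>R\<^esub> h" if "n \<in> N" for n
    proof -
      interpret n: ring_hom_ring R R "\<phi> n" using \<phi>hom that N by blast
      show ?thesis using h that by (simp add: S_def)
    qed
    then show "\<ominus>\<^bsub>R\<^esub> h \<in> S" using h by (simp add: S_def)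
  next
    fix a b assume "a \<in> S" "b \<in> S"
    then show "a \<otimes>\<^bsub>R\<^esub> b \<in> S" "a \<oplus>\<^bsub>R\<^esub> b \<in> S"
      using ring_hom_mult[OF D(3)[OF subsetD[OF N]]] ring_hom_add[OF D(3)[OF subsetD[OF N]]]
      by (auto simp: S_def)
  qed (auto simp: S_def)
  then have ringS: "ring ?S" by (rule R.subring_is_ring)
  \<comment> \<open>\<open>K\<close> acts on the ring \<open>S\<close> of
    \<open>N\<close>-invariants through arbitrarily chosen preimages: two preimages of the same
    element differ by an element of \<open>N\<close>, which acts trivially on
    \<open>S\<close>.\<close>
  define rep where "rep k = (SOME g. g \<in> carrier G \<and> \<pi> g = k)" for k
  have rep: "rep k \<in> carrier G" "\<pi> (rep k) = k" if "k \<in> carrier K" for k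
  proof -
    have "\<exists>g. g \<in> carrier G \<and> \<pi> g = k" using that surj by (metis imageE)
    from someI_ex[OF this] show "rep k \<in> carrier G" "\<pi> (rep k) = k" by (auto simp: rep_def)
  qed
  have fibre: "inv g \<otimes> h \<in> N" if "g \<in> carrier G" "h \<in> carrier G" "\<pi> g = \<pi> h" for g h
    using that by (simp add: N_def kernel_def)
  define \<psi> where "\<psi> k = \<phi> (rep k)" for k
  have \<psi>: "\<psi> (\<pi> g) x = \<phi> g x" if g: "g \<in> carrier G" and x: "x \<in> S" for g x
  proof -
    have r: "rep (\<pi> g) \<in> carrier G" "\<pi> (rep (\<pi> g)) = \<pi> g" using rep g by auto
    define n where "n = inv g \<otimes> rep (\<pi> g)"
    have "n \<in> N" unfolding n_def using fibre r g by simp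
    moreover have "rep (\<pi> g) = g \<otimes> n" using r(1) g by (simp add: n_def G.m_assoc[symmetric])
    ultimately show ?thesis using D(6)[of g n x] g x N by (auto simp: \<psi>_def S_def)
  qed
  have \<psi>S: "\<psi> k x \<in> S" if k: "k \<in> carrier K" and x: "x \<in> S" for k x
  proof -
    have xR: "x \<in> carrier R" using x by (simp add: S_def)
    have "\<phi> n (\<psi> k x) = \<psi> k x" if n: "n \<in> N" for n
    proof -
      have "\<phi> n (\<psi> k x) = \<phi> (n \<otimes> rep k) x" using D(6) n N rep k xR by (auto simp: \<psi>_def)
      also have "\<dots> = \<psi> (\<pi> (n \<otimes> rep k)) x" using \<psi> n N rep k x by (metis G.m_closed subsetD)
      also have "\<pi> (n \<otimes> rep k) = k" using n rep k by (auto simp: N_def kernel_def)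
      finally show ?thesis .
    qed
    then show ?thesis using D(4) rep k xR by (simp add: S_def \<psi>_def)
  qed
  have hom\<psi>: "\<psi> k \<in> ring_hom ?S ?S" if "k \<in> carrier K" for k
    using ring_hom_memE[OF D(3)[OF rep(1)[OF that]]] \<psi>S[OF that]
    by (auto intro!: ring_hom_memI simp: \<psi>_def S_def)
  have actS: "ring_action K ?S (\<lambda>k. restrict (\<psi> k) (carrier ?S))"
  proof (rule ring_actionI[OF K ringS hom\<psi>])
    fix x assume "x \<in> carrier ?S"
    then show "\<psi> \<one>\<^bsub>K\<^esub> x = x" using \<psi>[of "\<one>" x] D(5) by (simp add: S_def)
  next
    fix k l x assume k: "k \<in> carrier K" and l: "l \<in> carrier K" and x: "x \<in> carrier ?S"
    have "\<psi> (\<pi> (rep k \<otimes> rep l)) x = \<phi> (rep k \<otimes> rep l) x"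
      using k l x rep by (intro \<psi>) auto
    then show "\<psi> (k \<otimes>\<^bsub>K\<^esub> l) x = \<psi> k (\<psi> l x)"
      using k l x rep D(6)[of "rep k" "rep l" x] by (simp add: \<psi>_def S_def)
  qed
  have incl: "ring_hom_ring ?S R (\<lambda>x. x)"
    using ringS R.ring_axioms by (intro ring_hom_ringI2 ring_hom_memI) (auto simp: S_def)
  have NrmS: "Nrm ?S (\<lambda>k. restrict (\<psi> k) (carrier ?S)) V y \<in> S"
    "Nrm ?S (\<lambda>k. restrict (\<psi> k) (carrier ?S)) V y = Nrm R \<psi> V y"
    if "V \<subseteq> carrier K" "y \<in> S" for V y
  proof -
    have y: "y \<in> carrier ?S" using that(2) by simp
    have eq: "restrict (\<psi> k) (carrier ?S) z = \<psi> k z" if "k \<in> carrier K" "z \<in> carrier ?S" for k z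
      using that by simp
    show "Nrm ?S (\<lambda>k. restrict (\<psi> k) (carrier ?S)) V y \<in> S"
      "Nrm ?S (\<lambda>k. restrict (\<psi> k) (carrier ?S)) V y = Nrm R \<psi> V y"
      using hom_Nrm[where \<psi> = \<psi>, OF incl actS that(1) y eq] by (simp_all add: restrict_def)
  qed
  \<comment> \<open>The norm along \<open>N\<close>, with values in \<open>S\<close>. Sorting the
    sum over a preimage by the fibres of \<open>\<pi>\<close>, which are cosets of \<open>N\<close>,
    turns the norm over the preimage of \<open>V\<close> into the norm of \<open>\<tau> x\<close>
    over \<open>V\<close>.\<close>
  define \<tau> where "\<tau> x = Nrm R \<phi> N x" for x
  have \<tau>S: "\<tau> x \<in> S" if x: "x \<in> carrier R" for x
  proof -
    have "\<phi> n (\<tau> x) = \<tau> x" if n: "n \<in> N" for n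
    proof -
      have "\<phi> n (\<tau> x) = (\<Oplus>\<^bsub>R\<^esub>m\<in>N. \<phi> n (\<phi> m x))"
        unfolding \<tau>_def Nrm_def using n N x D(4) by (intro \<phi>sum) auto
      also have "\<dots> = (\<Oplus>\<^bsub>R\<^esub>m\<in>N. \<phi> (n \<otimes> m) x)"
        using n N x D(4,6) subsetD[OF N] by (intro R.finsum_cong') auto
      also have "\<dots> = (\<Oplus>\<^bsub>R\<^esub>m\<in>(\<lambda>m. n \<otimes> m) ` N. \<phi> m x)"
        using n N x D(4) subgroup.m_closed[OF subN n]
        by (intro R.finsum_reindex[symmetric]) (auto simp: inj_on_def subset_eq Pi_def)
      also have "(\<lambda>m. n \<otimes> m) ` N = N"
      proof (intro equalityI subsetI)
        fix m assume "m \<in> N"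
        then have "m = n \<otimes> (inv n \<otimes> m)" "inv n \<otimes> m \<in> N"
          using n N subN by (auto simp: subset_eq G.m_assoc[symmetric] subgroup.m_closed subgroup.m_inv_closed)
        then show "m \<in> (\<lambda>m. n \<otimes> m) ` N" by blast
      qed (use n subN subgroup.m_closed in auto)
      finally show ?thesis by (simp add: \<tau>_def Nrm_def)
    qed
    moreover have "\<tau> x \<in> carrier R" unfolding \<tau>_def Nrm_def using x D(4) N by (intro R.finsum_closed) auto
    ultimately show ?thesis by (simp add: S_def)
  qed
  have Nrm: "Nrm R \<phi> {g \<in> carrier G. \<pi> g \<in> V} x = Nrm R \<psi> V (\<tau> x)"
    if V: "V \<subseteq> carrier K" and x: "x \<in> carrier R" for V x
  proof -
    define F where "F k = {g \<in> carrier G. \<pi> g = k}" for k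
    have F: "(\<Oplus>\<^bsub>R\<^esub>g\<in>F k. \<phi> g x) = \<psi> k (\<tau> x)" if k: "k \<in> carrier K" for k
    proof -
      note r = rep[OF k]
      have "F k = (\<lambda>n. rep k \<otimes> n) ` N"
      proof (intro equalityI subsetI)
        fix g assume "g \<in> F k"
        then have "inv (rep k) \<otimes> g \<in> N" "g = rep k \<otimes> (inv (rep k) \<otimes> g)"
          using fibre[of "rep k" g] r by (auto simp: F_def G.m_assoc[symmetric])
        then show "g \<in> (\<lambda>n. rep k \<otimes> n) ` N" by blast
      qed (use r N k in \<open>auto simp: F_def N_def kernel_def\<close>)
      then have "(\<Oplus>\<^bsub>R\<^esub>g\<in>F k. \<phi> g x) = (\<Oplus>\<^bsub>R\<^esub>n\<in>N. \<phi> (rep k \<otimes> n) x)"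
        using r N x D(4) by (simp only:, intro R.finsum_reindex) (auto simp: inj_on_def subset_eq Pi_def)
      also have "\<dots> = (\<Oplus>\<^bsub>R\<^esub>n\<in>N. \<phi> (rep k) (\<phi> n x))"
        using r N x D(4,6) subsetD[OF N] by (intro R.finsum_cong') auto
      also have "\<dots> = \<psi> k (\<tau> x)"
        unfolding \<tau>_def Nrm_def \<psi>_def using r N x D(4) by (intro \<phi>sum[symmetric]) auto
      finally show ?thesis .
    qed
    have "finite (\<pi> ` carrier G)" using fin by simp
    then have finV: "finite V" using V surj finite_subset by auto
    have "{g \<in> carrier G. \<pi> g \<in> V} = (\<Union>k\<in>V. F k)" by (auto simp: F_def)
    then have "Nrm R \<phi> {g \<in> carrier G. \<pi> g \<in> V} x = (\<Oplus>\<^bsub>R\<^esub>k\<in>V. \<Oplus>\<^bsub>R\<^esub>g\<in>F k. \<phi> g x)"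
      unfolding Nrm_def
      using R.add.finprod_UN_disjoint[OF finV, of F "\<lambda>g. \<phi> g x"] fin x D(4)
      by (auto simp: F_def pairwise_def disjnt_def finsum_def)
    also have "\<dots> = Nrm R \<psi> V (\<tau> x)"
      unfolding Nrm_def using V F \<psi>S \<tau>S[OF x] by (intro R.finsum_cong') (auto simp: S_def)
    finally show ?thesis .
  qed
  have "has_norm_one ?S (\<lambda>k. restrict (\<psi> k) (carrier ?S)) E" if E: "E \<in> elem_ab_subgroups K" for E
  proof -
    have EK: "E \<subseteq> carrier K" using E K.elem_ab_subgroups_iff subgroup.subset by blast
    obtain x where x: "x \<in> carrier R" "Nrm R \<phi> {g \<in> carrier G. \<pi> g \<in> E} x = \<one>\<^bsub>R\<^esub>"
      using pre[OF E] by (auto simp: has_norm_one_def)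
    then have "Nrm ?S (\<lambda>k. restrict (\<psi> k) (carrier ?S)) E (\<tau> x) = \<one>\<^bsub>R\<^esub>"
      using NrmS(2)[OF EK \<tau>S[OF x(1)]] Nrm[OF EK x(1)] by simp
    then show ?thesis unfolding has_norm_one_def using \<tau>S[OF x(1)] by auto
  qed
  then have "has_norm_one ?S (\<lambda>k. restrict (\<psi> k) (carrier ?S)) (carrier K)"
    using det actS by (simp add: detects_def)
  then obtain y where y: "y \<in> S" "Nrm R \<psi> (carrier K) y = \<one>\<^bsub>R\<^esub>"
    using NrmS(2)[of "carrier K"] by (auto simp: has_norm_one_def)
  obtain x where x: "x \<in> carrier R" "\<tau> x = \<one>\<^bsub>R\<^esub>" using ker by (auto simp: has_norm_one_def \<tau>_def N_def)
  have yR: "y \<in> carrier R" using y by (simp add: S_def)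
  \<comment> \<open>As \<open>y\<close> is fixed by \<open>N\<close>, it can be taken out of the
    norm on the right, which leaves \<open>\<tau> x = 1\<close> as the other factor.\<close>
  have "\<tau> (x \<otimes>\<^bsub>R\<^esub> y) = (\<Oplus>\<^bsub>R\<^esub>n\<in>N. \<phi> n x \<otimes>\<^bsub>R\<^esub> y)"
    unfolding \<tau>_def Nrm_def using x yR y N D(4) ring_hom_mult[OF D(3)]
    by (intro R.finsum_cong') (auto simp: S_def subset_eq)
  also have "\<dots> = \<tau> x \<otimes>\<^bsub>R\<^esub> y"
    unfolding \<tau>_def Nrm_def using x yR N D(4) finN by (intro R.finsum_ldistr[symmetric]) auto
  finally have \<tau>: "\<tau> (x \<otimes>\<^bsub>R\<^esub> y) = y" using x yR by simp
  have "{g \<in> carrier G. \<pi> g \<in> carrier K} = carrier G" by auto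
  then have "Nrm R \<phi> (carrier G) (x \<otimes>\<^bsub>R\<^esub> y) = \<one>\<^bsub>R\<^esub>"
    using Nrm[of "carrier K" "x \<otimes>\<^bsub>R\<^esub> y"] x yR \<tau> y(2) by simp
  then show ?thesis unfolding has_norm_one_def using x yR by blast
qed

section \<open>Finite p-groups\<close>

lemma fin_p_groupD:
  assumes "fin_p_group p G"
  shows "group G" "finite (carrier G)" "\<exists>n. order G = p ^ n"
  using assms by (auto simp: fin_p_group_def)

lemma fin_p_group_card_dvd:
  assumes "fin_p_group p G" "Factorial_Ring.prime p" "n dvd order G"
  shows "\<exists>k. n = p ^ k"
  using assms divides_primepow_nat by (metis fin_p_groupD(3))

lemma fin_p_group_subgroup:
  assumes G: "fin_p_group p G" and p: "Factorial_Ring.prime p" and H: "subgroup H G"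
  shows "fin_p_group p (G\<lparr>carrier := H\<rparr>)"
proof -
  interpret group G using G by (rule fin_p_groupD)
  have "card H dvd order G" using lagrange[OF H] by (metis dvd_triv_right)
  then have "\<exists>k. card H = p ^ k" by (rule fin_p_group_card_dvd[OF G p])
  then show ?thesis
    using fin_p_groupD(2)[OF G] H subgroup.subset[OF H] finite_subset
    by (auto simp: fin_p_group_def order_def subgroup.subgroup_is_group[OF H is_group])
qed

lemma fin_p_group_epi:
  assumes G: "fin_p_group p G" and p: "Factorial_Ring.prime p" and K: "group K" and \<pi>: "\<pi> \<in> epi G K"
  shows "fin_p_group p K" "card (kernel G K \<pi>) * order K = order G"
proof -
  interpret group G using G by (rule fin_p_groupD)
  interpret \<pi>: group_hom G K \<pi>
    using \<pi> K by (auto simp: epi_def intro!: group_hom.intro group_hom_axioms.intro is_group)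
  have im: "\<pi> ` carrier G = carrier K" using \<pi> by (simp add: epi_def)
  have "(\<lambda>Y. the_elem (\<pi> ` Y)) \<in> iso (G Mod kernel G K \<pi>) K"
    by (rule \<pi>.FactGroup_iso_set) (rule im)
  then have "card (rcosets\<^bsub>G\<^esub> (kernel G K \<pi>)) = order K"
    by (auto simp: iso_def FactGroup_def order_def dest: bij_betw_same_card)
  then show *: "card (kernel G K \<pi>) * order K = order G"
    using lagrange[OF \<pi>.subgroup_kernel] by (simp add: mult.commute)
  then have "order K dvd order G" by (metis dvd_triv_right)
  moreover have "finite (carrier K)" using im fin_p_groupD(2)[OF G] by (metis finite_imageI)
  ultimately show "fin_p_group p K"
    using fin_p_group_card_dvd[OF G p] K by (auto simp: fin_p_group_def)
qed

lemma fin_p_group_ord: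
  assumes G: "fin_p_group p G" and p: "Factorial_Ring.prime p" and x: "x \<in> carrier G"
  shows "\<exists>k. group.ord G x = p ^ k"
  using fin_p_group_card_dvd[OF G p] group.ord_dvd_group_order[OF fin_p_groupD(1)[OF G] x] by blast

lemma prime_of_exponent:
  fixes G (structure)
  assumes G: "fin_p_group p G" and p: "Factorial_Ring.prime p" and x: "x \<in> carrier G" "x \<noteq> \<one>"
    and q: "Factorial_Ring.prime q" "x [^] (q :: nat) = \<one>"
  shows "q = p"
proof -
  interpret group G using G by (rule fin_p_groupD)
  have "ord x dvd q" using pow_eq_id x q by blast
  then have "ord x = q" using q(1) x ord_eq_1 prime_nat_iff by blast
  moreover obtain k where "ord x = p ^ k" using fin_p_group_ord[OF G p x(1)] by blast
  ultimately have "q dvd p ^ k" by simp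
  then show ?thesis using p q(1) by (meson prime_dvd_power primes_dvd_imp_eq)
qed

text \<open>A nontrivial element of prime exponent \<open>q\<close> has order \<open>q\<close>,
  which divides a power of \<open>p\<close>; hence the prime in the general criterion must be
  \<open>p\<close>.\<close>

lemma elem_ab_subgroups_p_group:
  fixes G (structure)
  assumes G: "fin_p_group p G" and p: "Factorial_Ring.prime p"
  shows "E \<in> elem_ab_subgroups G \<longleftrightarrow> subgroup E G \<and> E \<noteq> {\<one>} \<and>
    (\<forall>x\<in>E. \<forall>y\<in>E. x \<otimes> y = y \<otimes> x) \<and> (\<forall>x\<in>E. x [^] p = \<one>)" (is "_ \<longleftrightarrow> ?R")
proof -
  interpret group G using G by (rule fin_p_groupD)
  have fin: "finite E" if "subgroup E G"
    using that subgroup.subset fin_p_groupD(2)[OF G] finite_subset by blast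
  have "\<forall>x\<in>E. x [^] p = \<one>" if E: "subgroup E G" "E \<noteq> {\<one>}"
    and q: "Factorial_Ring.prime q" "\<forall>x\<in>E. x [^] (q :: nat) = \<one>" for q
  proof -
    obtain x where "x \<in> E" "x \<noteq> \<one>" using E subgroup.one_closed by fastforce
    then have "q = p" using prime_of_exponent[OF G p _ _ q(1)] q(2) E subgroup.mem_carrier by metis
    then show ?thesis using q by simp
  qed
  then show ?thesis using fin p unfolding elem_ab_subgroups_iff by blast
qed

lemma elementary_abelian_p_group:
  fixes G (structure)
  assumes G: "fin_p_group p G" and p: "Factorial_Ring.prime p"
  shows "elementary_abelian G \<longleftrightarrow> carrier G \<noteq> {\<one>} \<and>
    (\<forall>x\<in>carrier G. \<forall>y\<in>carrier G. x \<otimes> y = y \<otimes> x) \<and> (\<forall>x\<in>carrier G. x [^] p = \<one>)"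
  using elem_ab_subgroups_p_group[OF G p, of "carrier G"] group.subgroup_self[OF fin_p_groupD(1)[OF G]]
  by (simp add: elem_ab_subgroups_def)

text \<open>Class equation for the conjugation action: if the center were trivial, every class other
  than that of the unit would have size divisible by \<open>p\<close>, and the order of the group
  would be 1 modulo \<open>p\<close>.\<close>

lemma p_group_center_nontrivial:
  fixes G (structure)
  assumes G: "fin_p_group p G" and p: "Factorial_Ring.prime p" and nt: "carrier G \<noteq> {\<one>}"
  obtains z where "z \<in> center G" "z \<noteq> \<one>"
proof (rule ccontr)
  assume contr: "\<not> thesis"
  interpret group G using G by (rule fin_p_groupD)
  have triv: "\<forall>z\<in>center G. z = \<one>" using contr that by blast
  define c where "c = (\<lambda>g. \<lambda>h\<in>carrier G. g \<otimes> h \<otimes> inv g)"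
  interpret act: group_action G "carrier G" c unfolding c_def by (rule action_by_conjugation)
  define S where "S = orbits G (carrier G) c"
  have fin: "finite (carrier G)" by (rule fin_p_groupD(2)[OF G])
  have finO: "finite T" if "T \<in> S" for T
    using that fin act.orbits_coverture finite_subset by (metis Sup_upper S_def)
  have "{\<one>} = orbit G c \<one>" by (auto simp: orbit_def c_def intro!: exI[of _ "\<one>"])
  then have one: "{\<one>} \<in> S" by (auto simp: S_def orbits_def)
  have "p dvd card T" if "T \<in> S" "T \<noteq> {\<one>}" for T
  proof -
    obtain x where x: "x \<in> carrier G" "T = orbit G c x" using \<open>T \<in> S\<close> by (auto simp: S_def orbits_def)
    have xO: "x \<in> T" using act.orbit_refl x by simp
    have "card T dvd order G" using act.orbit_stabilizer_theorem[OF x(1)] x(2) by (metis dvd_triv_left)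
    then obtain k where k: "card T = p ^ k" using fin_p_group_card_dvd[OF G p] by blast
    have "k \<noteq> 0"
    proof
      assume "k = 0"
      then have "T = {x}" using k xO by (metis card_1_singletonE power_0 singletonD)
      then have "g \<otimes> x \<otimes> inv g = x" if "g \<in> carrier G" for g
        using that x by (auto simp: orbit_def c_def)
      then have "x \<otimes> g = g \<otimes> x" if "g \<in> carrier G" for g
        using that x(1) by (metis inv_solve_right m_closed)
      then have "x \<in> center G" using x by (auto simp: center_def)
      then show False using triv \<open>T = {x}\<close> that(2) by blast
    qed
    then show ?thesis using k by simp
  qed
  then have "p dvd (\<Sum>T\<in>S - {{\<one>}}. card T)" by (intro dvd_sum) auto
  moreover have finX: "finite S" unfolding S_def orbits_def using fin by simp
  have "card (carrier G) = (\<Sum>T\<in>S. card T)"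
  proof -
    have "card (\<Union>S) = (\<Sum>T\<in>S. card T)"
      using finO act.disjoint_union by (intro card_Union_disjoint) (auto simp: S_def pairwise_def disjnt_def)
    then show ?thesis using act.orbits_coverture by (simp add: S_def)
  qed
  then have "card (carrier G) = 1 + (\<Sum>T\<in>S - {{\<one>}}. card T)"
    using sum.remove[OF finX one, of card] by simp
  moreover have "p dvd card (carrier G)"
  proof -
    obtain n where n: "card (carrier G) = p ^ n" using fin_p_groupD(3)[OF G] by (auto simp: order_def)
    have "n \<noteq> 0" using n nt one_closed by (metis card_1_singletonE power_0 singletonD)
    then show ?thesis using n by simp
  qed
  ultimately have "p dvd 1" by (metis dvd_add_left_iff)
  then show False using p by simp
qed

lemma (in group) subgroup_range_pow:
  assumes a: "a \<in> carrier G"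
  shows "subgroup (range (\<lambda>k :: int. a [^] k)) G"
proof (rule subgroupI)
  fix x assume "x \<in> range (\<lambda>k :: int. a [^] k)"
  then obtain k :: int where "x = a [^] k" by blast
  then have "inv x = a [^] (- k)" using a by (simp add: int_pow_neg)
  then show "inv x \<in> range (\<lambda>k :: int. a [^] k)" by blast
next
  fix x y assume "x \<in> range (\<lambda>k :: int. a [^] k)" "y \<in> range (\<lambda>k :: int. a [^] k)"
  then obtain k l :: int where "x = a [^] k" "y = a [^] l" by blast
  then have "x \<otimes> y = a [^] (k + l)" using a by (simp add: int_pow_mult)
  then show "x \<otimes> y \<in> range (\<lambda>k :: int. a [^] k)" by blast
qed (use a in auto)

lemma (in group) subgroup_center: "subgroup (center G) G"
proof (rule subgroupI)
  fix a assume a: "a \<in> center G"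
  then have aG: "a \<in> carrier G" by (simp add: center_def)
  have "inv a \<otimes> x = x \<otimes> inv a" if x: "x \<in> carrier G" for x
  proof -
    have "inv a \<otimes> x = inv a \<otimes> (x \<otimes> a) \<otimes> inv a" using aG x by (simp add: m_assoc)
    also have "x \<otimes> a = a \<otimes> x" using a x by (simp add: center_def)
    also have "inv a \<otimes> (a \<otimes> x) = x" using aG x by (simp add: m_assoc[symmetric])
    finally show ?thesis .
  qed
  then show "inv a \<in> center G" using aG by (simp add: center_def)
next
  fix a b assume a: "a \<in> center G" and b: "b \<in> center G"
  then have G: "a \<in> carrier G" "b \<in> carrier G" by (simp_all add: center_def)
  have "a \<otimes> b \<otimes> x = x \<otimes> (a \<otimes> b)" if x: "x \<in> carrier G" for x
  proof -
    have "a \<otimes> b \<otimes> x = a \<otimes> (x \<otimes> b)" using b x G by (simp add: center_def m_assoc)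
    also have "\<dots> = (a \<otimes> x) \<otimes> b" using x G by (simp add: m_assoc)
    also have "\<dots> = x \<otimes> a \<otimes> b" using a x by (simp add: center_def)
    finally show ?thesis using x G by (simp add: m_assoc)
  qed
  then show "a \<otimes> b \<in> center G" using G by (simp add: center_def)
qed (auto simp: center_def)

lemma (in group) normal_subset_center:
  assumes "subgroup N G" "N \<subseteq> center G"
  shows "N \<lhd> G"
proof (rule normal_invI[OF assms(1)])
  fix x h assume "x \<in> carrier G" "h \<in> N"
  then have "x \<otimes> h \<otimes> inv x = h" using assms by (auto simp: center_def subset_eq inv_solve_right')
  then show "x \<otimes> h \<otimes> inv x \<in> N" using \<open>h \<in> N\<close> by simp
qed

lemma (in group) mod_elementary_abelianD:
  assumes G: "fin_p_group p G" and p: "Factorial_Ring.prime p" and N: "N \<lhd> G"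
    and el: "elementary_abelian (G Mod N)"
  shows "\<And>x y. x \<in> carrier G \<Longrightarrow> y \<in> carrier G \<Longrightarrow> (x \<otimes> y) \<otimes> inv (y \<otimes> x) \<in> N"
    "\<And>x. x \<in> carrier G \<Longrightarrow> x [^] p \<in> N"
proof -
  interpret N: normal N G by (rule N)
  have epi: "(\<lambda>a. N #> a) \<in> epi G (G Mod N)"
    using N.r_coset_hom_Mod by (auto simp: epi_def carrier_FactGroup)
  have pG: "fin_p_group p (G Mod N)" by (rule fin_p_group_epi[OF G p N.factorgroup_is_group epi])
  note E = el[unfolded elementary_abelian_p_group[OF pG p]]
  show "(x \<otimes> y) \<otimes> inv (y \<otimes> x) \<in> N" if x: "x \<in> carrier G" and y: "y \<in> carrier G" for x y
  proof -
    have "N #> (x \<otimes> y) = N #> (y \<otimes> x)"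
      using E x y by (auto simp: carrier_FactGroup N.rcos_sum)
    then show ?thesis using x y
      by (metis N.rcos_module N.rcos_const N.is_subgroup is_group m_closed rcos_self subgroup.rcos_module)
  qed
  show "x [^] p \<in> N" if x: "x \<in> carrier G" for x
  proof -
    have "N #> (x [^] p) = N"
      using E x N.FactGroup_pow[OF x, of p] by (auto simp: carrier_FactGroup)
    then show ?thesis using x rcos_self[OF nat_pow_closed[OF x] N.is_subgroup] by auto
  qed
qed

lemma (in normal) iso_factor_epi:
  assumes f: "f \<in> iso (G Mod H) K" and K: "group K"
  shows "(\<lambda>x. f (H #> x)) \<in> epi G K" "kernel G K (\<lambda>x. f (H #> x)) = H"
proof -
  have im: "f ` carrier (G Mod H) = carrier K" and inj: "inj_on f (carrier (G Mod H))"
    and hom: "f \<in> hom (G Mod H) K"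
    using f by (auto simp: iso_def bij_betw_def)
  have "(\<lambda>x. f (H #> x)) \<in> hom G K"
    using r_coset_hom_Mod hom by (auto simp: hom_def Pi_iff)
  then show "(\<lambda>x. f (H #> x)) \<in> epi G K"
    using im by (auto simp: epi_def carrier_FactGroup image_image)
  interpret f: group_hom "G Mod H" K f
    using hom K by (intro group_hom.intro group_hom_axioms.intro factorgroup_is_group)
  have "f (H #> x) = \<one>\<^bsub>K\<^esub> \<longleftrightarrow> x \<in> H" if x: "x \<in> carrier G" for x
  proof -
    have "f (H #> x) = \<one>\<^bsub>K\<^esub> \<longleftrightarrow> H #> x = H"
      using inj x f.hom_one by (metis carrier_FactGroup image_eqI inj_onD f.G.one_closed one_FactGroup)
    also have "\<dots> \<longleftrightarrow> x \<in> H"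
      using x by (metis is_subgroup rcos_const rcos_self is_group)
    finally show ?thesis .
  qed
  then show "kernel G K (\<lambda>x. f (H #> x)) = H" using subset by (auto simp: kernel_def)
qed

lemma (in group) int_pow_nat_pow_commute:
  assumes "a \<in> carrier G"
  shows "(a [^] (i :: int)) [^] (n :: nat) = (a [^] n) [^] i"
proof -
  have "(a [^] i) [^] n = (a [^] i) [^] int n" by (simp only: int_pow_int)
  also have "\<dots> = (a [^] int n) [^] i" using assms by (simp only: int_pow_pow mult.commute)
  finally show ?thesis by (simp only: int_pow_int)
qed

text \<open>
  Let \<open>C\<close> be central of order \<open>p\<close>. If \<open>v \<notin> C\<close> were central of order \<open>p\<close>, then all commutators and
  \<open>p\<close>-th powers would lie in \<open>C \<inter> \<langle>v\<rangle> = 1\<close>, and \<open>G\<close> would be elementary abelian. Hence the center has a single subgroup of order \<open>p\<close>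
  and, modulo it, exponent \<open>p\<close>.
\<close>

theorem minimal_p_group:
  fixes G (structure)
  assumes G: "fin_p_group p G" and p: "Factorial_Ring.prime p"
    and nt: "carrier G \<noteq> {\<one>}" and nel: "\<not> elementary_abelian G"
    and quot: "\<And>N. N \<lhd> G \<Longrightarrow> N \<noteq> {\<one>} \<Longrightarrow> N \<noteq> carrier G \<Longrightarrow> elementary_abelian (G Mod N)"
  shows "extraspecial p G \<or> almost_extraspecial p G"
proof -
  interpret group G using G by (rule fin_p_groupD)
  note elab_iff = elementary_abelian_p_group[OF G p]
  have p1: "1 < p" using p prime_gt_1_nat by blast
  obtain z where z: "z \<in> center G" "z \<noteq> \<one>" using p_group_center_nontrivial[OF G p nt] .
  have Zsub: "subgroup (center G) G" by (rule subgroup_center)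
  have ZG: "x \<in> carrier G" if "x \<in> center G" for x using that by (simp add: center_def)
  have Zcomm: "x \<otimes> y = y \<otimes> x" if "x \<in> center G" "y \<in> carrier G" for x y using that by (simp add: center_def)
  obtain k where k: "ord z = p ^ k" using fin_p_group_ord[OF G p] ZG z by blast
  have "k \<noteq> 0" using k z ZG ord_eq_1 by (metis power_0)
  then obtain k' where k': "k = Suc k'" by (cases k) auto
  \<comment> \<open>In the chain of successive \<open>p\<close>-th powers of \<open>z\<close> this
    is the last nontrivial one, so it has order \<open>p\<close>.\<close>
  define w where "w = z [^] (p ^ k')"
  have wZ: "w \<in> center G" unfolding w_def using z Zsub by (metis subgroup_int_pow_closed int_pow_int)
  have wG: "w \<in> carrier G" using wZ by (rule ZG)
  have wp: "w [^] p = \<one>"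
    using z ZG pow_ord_eq_1[of z] by (simp add: w_def nat_pow_pow k k' mult.commute)
  have w1: "w \<noteq> \<one>"
  proof
    assume "w = \<one>"
    then have "p ^ k dvd p ^ k'" using pow_eq_id[of z "p ^ k'"] z ZG by (simp add: w_def k)
    then show False using p1 k' by (simp add: power_dvd_imp_le)
  qed
  have ordw: "ord a = p" if "a \<in> carrier G" "a \<noteq> \<one>" "a [^] p = \<one>" for a
  proof -
    have "ord a dvd p" using that pow_eq_id by blast
    then show ?thesis using that p ord_eq_1 prime_nat_iff by blast
  qed
  define cyc where "cyc a = range (\<lambda>k :: int. a [^] k)" for a
  have cyc_sub: "subgroup (cyc a) G" if "a \<in> carrier G" for a
    unfolding cyc_def using that by (rule subgroup_range_pow)
  have cyc_self: "a \<in> cyc a" if "a \<in> carrier G" for a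
    unfolding cyc_def using that by (metis int_pow_1 rangeI)
  have cycZ: "cyc a \<subseteq> center G" if "a \<in> center G" for a
    unfolding cyc_def using that subgroup_int_pow_closed[OF Zsub] by blast
  have cyc_p: "x [^] p = \<one>" if "a \<in> carrier G" "a [^] p = \<one>" "x \<in> cyc a" for a x
  proof -
    obtain i :: int where "x = a [^] i" using \<open>x \<in> cyc a\<close> by (auto simp: cyc_def)
    then show ?thesis using that by (simp add: int_pow_nat_pow_commute)
  qed
  have cyc_mem: "a \<in> B" if "subgroup B G" "a \<in> carrier G" "a [^] p = \<one>" "x \<in> cyc a" "x \<noteq> \<one>" "x \<in> B" for a x B
  proof -
    obtain i :: int where i: "x = a [^] i" using \<open>x \<in> cyc a\<close> by (auto simp: cyc_def)
    have "\<not> int p dvd i"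
    proof
      assume "int p dvd i"
      then obtain j where "i = int p * j" by (elim dvdE)
      then have "x = (a [^] int p) [^] j" using that i by (simp add: int_pow_pow)
      then show False using that by (simp add: int_pow_int)
    qed
    then show ?thesis using prime_power_mem_subgroup[of B a i p] that i p by simp
  qed
  have proper: "cyc a \<noteq> carrier G" if a: "a \<in> center G" "a [^] p = \<one>" for a
  proof
    assume "cyc a = carrier G"
    then have "elementary_abelian G"
      unfolding elab_iff using nt cycZ[OF a(1)] Zcomm cyc_p[OF ZG[OF a(1)] a(2)] by (metis subsetD)
    then show False using nel by simp
  qed
  have cyc_elab: "elementary_abelian (G Mod cyc a)" "cyc a \<lhd> G" if a: "a \<in> center G" "a \<noteq> \<one>" "a [^] p = \<one>" for a
  proof -
    show "cyc a \<lhd> G" using normal_subset_center cyc_sub cycZ ZG a by blast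
    then show "elementary_abelian (G Mod cyc a)"
      using quot proper a cyc_self ZG by (metis singletonD)
  qed
  define C where "C = cyc w"
  note C = cyc_elab[OF wZ w1 wp, folded C_def]
  note modC = mod_elementary_abelianD[OF G p C(2,1)]
  have uniq: "v \<in> C" if v: "v \<in> center G" "v [^] p = \<one>" for v
  proof (rule ccontr)
    assume vC: "v \<notin> C"
    have vG: "v \<in> carrier G" using v by (intro ZG)
    have Csub: "subgroup C G" unfolding C_def using cyc_sub wG by blast
    have v1: "v \<noteq> \<one>" using vC subgroup.one_closed[OF Csub] by metis
    note modD = mod_elementary_abelianD[OF G p cyc_elab(2,1)[OF v(1) v1 v(2)]]
    have meet: "x = \<one>" if "x \<in> C" "x \<in> cyc v" for x
      using cyc_mem[OF Csub vG v(2) that(2) _ that(1)] vC by blast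
    have "x \<otimes> y = y \<otimes> x" if "x \<in> carrier G" "y \<in> carrier G" for x y
    proof -
      have "(x \<otimes> y) \<otimes> inv (y \<otimes> x) = \<one>" using meet modC(1) modD(1) that by blast
      then show ?thesis using that by (metis inv_equality inv_inv m_closed inv_closed)
    qed
    moreover have "x [^] p = \<one>" if "x \<in> carrier G" for x
      using meet modC(2) modD(2) that by blast
    ultimately have "elementary_abelian G" unfolding elab_iff using nt by blast
    then show False using nel by simp
  qed
  have ext: "central_ext p G"
  proof -
    obtain q r f where q: "Factorial_Ring.prime q" "1 \<le> r" and f: "f \<in> iso (G Mod C) (cyclic_power q r)"
      using C(1) by (auto simp: elementary_abelian_def is_iso_def)
    interpret C: normal C G by (rule C(2))
    define \<pi> where "\<pi> x = f (C #> x)" for x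
    have \<pi>: "\<pi> \<in> epi G (cyclic_power q r)" "kernel G (cyclic_power q r) \<pi> = C"
      using C.iso_factor_epi[OF f] by (simp_all add: \<pi>_def[abs_def])
    \<comment> \<open>The prime \<open>q\<close> comes from the definition of an elementary abelian
      group; comparing orders identifies it with \<open>p\<close>.\<close>
    have "fin_p_group p (cyclic_power q r)" by (rule fin_p_group_epi[OF G p _ \<pi>(1)]) simp
    then obtain n where "card (carrier (cyclic_power q r)) = p ^ n"
      by (auto simp: fin_p_group_def order_def)
    then have "q ^ r = p ^ n" using q(1) card_cyclic_power prime_gt_0_nat by metis
    then have "q dvd p ^ n" using q(2) by (metis dvd_power less_le_trans zero_less_one)
    then have "q = p" using q(1) p by (meson prime_dvd_power primes_dvd_imp_eq)
    note pow = cyclic_subgroup_mon[OF wG, unfolded ordw[OF wG w1 wp]]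
    have "(\<lambda>k :: int. w [^] k) ` carrier (integer_mod_group p) = C"
      using pow(2) p1 by (simp add: C_def cyc_def)
    moreover have "C \<subseteq> center G" unfolding C_def by (rule cycZ[OF wZ])
    ultimately show ?thesis
      unfolding central_ext_def using q(2) \<pi> pow(1) p1 \<open>q = p\<close>
      by (intro exI[of _ r] exI[of _ "\<lambda>k :: int. w [^] k"] exI[of _ \<pi>]) auto
  qed
  show ?thesis
  proof (cases "center G \<subseteq> C")
    case True
    then have "center G = cyc w" using cycZ[OF wZ] by (auto simp: C_def)
    then have "G\<lparr>carrier := center G\<rparr> \<cong> integer_mod_group p"
      using cyclic_subgroup_iso[OF wG] ordw[OF wG w1 wp] p1 by (simp add: cyc_def)
    then show ?thesis using G ext by (simp add: extraspecial_def)
  next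
    case False
    then obtain y where y: "y \<in> center G" "y \<notin> C" by blast
    have yG: "y \<in> carrier G" using y(1) by (rule ZG)
    \<comment> \<open>\<open>y\<close> will have order \<open>p ^ 2\<close>: its \<open>p\<close>-th
      power lies in \<open>C\<close>, since \<open>G Mod C\<close> has exponent \<open>p\<close>,
      and is nontrivial, since otherwise \<open>uniq\<close> would put \<open>y\<close> into
      \<open>C\<close>.\<close>
    have ypC: "y [^] p \<in> C" using modC(2) yG by blast
    have yp1: "y [^] p \<noteq> \<one>" using uniq y by blast
    have "(y [^] p) [^] p = \<one>" using cyc_p[OF wG wp] ypC by (simp add: C_def)
    then have "y [^] (p ^ 2) = \<one>" using yG by (simp add: nat_pow_pow power2_eq_square)
    then have "ord y dvd p ^ 2" using pow_eq_id yG by blast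
    then obtain i where i: "i \<le> 2" "ord y = p ^ i" using divides_primepow_nat[OF p] by blast
    have "\<not> p ^ i dvd p" using yp1 pow_eq_id yG i(2) by metis
    then have "i \<noteq> 0" "i \<noteq> 1" by (metis one_dvd power_0, metis dvd_refl power_one_right)
    then have "i = 2" using i(1) by simp
    with i(2) have ordy: "ord y = p ^ 2" by simp
    \<comment> \<open>Since \<open>y [^] p\<close> generates \<open>C\<close>, the
      \<open>p\<close>-th power of \<open>t\<close> is that of some power \<open>y [^] l\<close>.
      Then \<open>t \<otimes> y [^] (- l)\<close> is central with trivial \<open>p\<close>-th power,
      so it lies in \<open>C\<close> and hence among the powers of \<open>y\<close>.\<close>
    have "t \<in> cyc y" if t: "t \<in> center G" for t
    proof -
      have tG: "t \<in> carrier G" using t by (rule ZG)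
      have B: "subgroup (cyc (y [^] p)) G" using cyc_sub yG by simp
      have wB: "w \<in> cyc (y [^] p)"
        using cyc_mem[OF B wG wp _ yp1] ypC cyc_self yG by (simp add: C_def)
      then have CB: "C \<subseteq> cyc (y [^] p)"
        unfolding C_def cyc_def[of w] using subgroup_int_pow_closed[OF B] by blast
      have By: "cyc (y [^] p) \<subseteq> cyc y"
        using subgroup_int_pow_closed[OF cyc_sub[OF yG]] cyc_self[OF yG]
        by (auto simp: cyc_def[of "y [^] p"]) (metis int_pow_int)
      have "t [^] p \<in> C" using modC(2) tG by blast
      then obtain l :: int where l: "t [^] p = (y [^] p) [^] l" using CB by (auto simp: cyc_def)
      define u where "u = t \<otimes> y [^] (- l)"
      have yl: "y [^] (- l) \<in> center G" using subgroup_int_pow_closed[OF Zsub y(1)] .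
      have uZ: "u \<in> center G" unfolding u_def using subgroup.m_closed[OF Zsub t yl] .
      have "u [^] p = t [^] p \<otimes> (y [^] (- l)) [^] p"
        unfolding u_def using Zcomm[OF t] tG yG by (intro pow_mult_distrib) auto
      also have "(y [^] (- l)) [^] p = (y [^] p) [^] (- l)"
        using yG by (rule int_pow_nat_pow_commute)
      also have "t [^] p \<otimes> (y [^] p) [^] (- l) = \<one>" using l yG by (simp add: int_pow_neg)
      finally have "u \<in> C" using uniq uZ by blast
      then have "u \<in> cyc y" using CB By by blast
      then have "u \<otimes> y [^] l \<in> cyc y"
        using subgroup.m_closed[OF cyc_sub[OF yG]] by (auto simp: cyc_def)
      also have "u \<otimes> y [^] l = t" unfolding u_def using tG yG by (simp add: m_assoc int_pow_neg)
      finally show ?thesis .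
    qed
    then have "center G = cyc y" using cycZ[OF y(1)] by blast
    then have "G\<lparr>carrier := center G\<rparr> \<cong> integer_mod_group (p ^ 2)"
      using cyclic_subgroup_iso[OF yG] ordy p1 by (simp add: cyc_def)
    then show ?thesis using G ext by (simp add: almost_extraspecial_def)
  qed
qed

section \<open>Existence of elements of norm one\<close>

text \<open>Elements of norm one are chosen simultaneously for all subgroups and inserted into the
  polynomial. \<open>is_formula_all_rings\<close> makes a formula, whose definition concerns rings
  over \<open>nat\<close>, usable over \<open>'r\<close>.\<close>

lemma detects_formula:
  assumes \<Phi>: "is_formula G \<Phi>" and G: "group G" "finite (carrier G)"
  shows "detects TYPE('r) G"
  unfolding detects_def
proof (intro allI impI)
  fix R :: "'r ring" and \<phi>
  assume act: "ring_action G R \<phi>" and sol: "\<forall>E\<in>elem_ab_subgroups G. has_norm_one R \<phi> E"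
  note D = ring_actionD[OF act]
  have "\<forall>E\<in>elem_ab_subgroups G. \<exists>y. y \<in> carrier R \<and> Nrm R \<phi> E y = \<one>\<^bsub>R\<^esub>"
    using sol by (auto simp: has_norm_one_def)
  from bchoice[OF this] obtain x
    where x: "\<forall>E\<in>elem_ab_subgroups G. x E \<in> carrier R \<and> Nrm R \<phi> E (x E) = \<one>\<^bsub>R\<^esub>" by blast
  have "ring_hom_ring R R (\<lambda>y. y)" using D(2) by (intro ring_hom_ringI2 ring_hom_memI) auto
  then have "eval_expr R \<phi> x \<Phi> \<in> carrier R"
    using hom_eval_expr(1)[of R R "\<lambda>y. y" G \<phi> x \<phi> \<Phi>] act x \<Phi> by (simp add: is_formula_def)
  moreover have "valid_in R G \<Phi>" using is_formula_all_rings[OF \<Phi> G] .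
  then have "ring_action G R \<phi> \<and>
      (\<forall>E\<in>elem_ab_subgroups G. x E \<in> carrier R \<and> Nrm R \<phi> E (x E) = \<one>\<^bsub>R\<^esub>) \<longrightarrow>
      Nrm R \<phi> (carrier G) (eval_expr R \<phi> x \<Phi>) = \<one>\<^bsub>R\<^esub>"
    unfolding valid_in_def by (elim allE)
  then have "Nrm R \<phi> (carrier G) (eval_expr R \<phi> x \<Phi>) = \<one>\<^bsub>R\<^esub>" using act x by simp
  ultimately show "has_norm_one R \<phi> (carrier G)" unfolding has_norm_one_def by blast
qed

lemma (in group_hom) subgroup_vimage:
  assumes "subgroup I H"
  shows "subgroup {x \<in> carrier G. h x \<in> I} G"
proof (rule G.subgroupI)
  have "\<one> \<in> {x \<in> carrier G. h x \<in> I}" using subgroup.one_closed[OF assms] by simp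
  then show "{x \<in> carrier G. h x \<in> I} \<noteq> {}" by blast
qed (use assms in \<open>auto simp: subgroup.m_closed subgroup.m_inv_closed\<close>)

lemma iso_epi_kernel:
  assumes "group G" "group K" "f \<in> iso G K"
  shows "f \<in> epi G K" "kernel G K f = {\<one>\<^bsub>G\<^esub>}"
proof -
  interpret group_hom G K f
    using assms by (auto simp: iso_def intro!: group_hom.intro group_hom_axioms.intro)
  show "f \<in> epi G K" using assms(3) by (auto simp: iso_iff_mon_epi)
  show "kernel G K f = {\<one>\<^bsub>G\<^esub>}"
    using assms(3) inj_iff_trivial_ker by (auto simp: iso_def bij_betw_def)
qed

lemma elem_ab_subgroups_preimage_iso:
  fixes G (structure)
  assumes G: "group G" and fin: "finite (carrier G)" and K: "group K" and f: "f \<in> iso G K"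
    and E: "E \<in> elem_ab_subgroups K"
  shows "{g \<in> carrier G. f g \<in> E} \<in> elem_ab_subgroups G" (is "?E \<in> _")
proof -
  interpret G: group G by fact
  interpret K: group K by fact
  interpret f: group_hom G K f
    using f by (auto simp: iso_def intro!: group_hom.intro group_hom_axioms.intro G.is_group K.is_group)
  have inj: "inj_on f (carrier G)" and im: "f ` carrier G = carrier K"
    using f by (auto simp: iso_def bij_betw_def)
  note E = E[unfolded K.elem_ab_subgroups_iff]
  have sub: "subgroup ?E G" using f.subgroup_vimage E by auto
  have "E \<subseteq> carrier K" using E by (intro subgroup.subset) simp
  moreover have "f ` ?E = f ` carrier G \<inter> E" by auto
  ultimately have imE: "f ` ?E = E" by (simp add: im Int_absorb1)
  have "?E \<noteq> {\<one>}"
  proof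
    assume "?E = {\<one>}"
    then have "E = f ` {\<one>}" using imE by simp
    then show False using E by simp
  qed
  moreover have "x \<otimes> y = y \<otimes> x" if "x \<in> ?E" "y \<in> ?E" for x y
  proof -
    have "f (x \<otimes> y) = f (y \<otimes> x)" using that E by auto
    from inj_onD[OF inj this] show ?thesis using that by simp
  qed
  moreover obtain q :: nat where q: "Factorial_Ring.prime q" "\<forall>x\<in>E. x [^]\<^bsub>K\<^esub> q = \<one>\<^bsub>K\<^esub>" using E by blast
  have "x [^] q = \<one>" if "x \<in> ?E" for x
  proof -
    have "f (x [^] q) = f \<one>" using that q by (simp add: f.hom_nat_pow)
    from inj_onD[OF inj this] show ?thesis using that by simp
  qed
  ultimately show ?thesis using sub fin q(1) unfolding G.elem_ab_subgroups_iff by auto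
qed

text \<open>An isomorphism is an epimorphism with trivial kernel, so this is a case of the extension
  theorem.\<close>

lemma detects_iso:
  assumes G: "group G" and fin: "finite (carrier G)" and K: "group K" and iso: "G \<cong> K"
    and det: "detects TYPE('r) K"
  shows "detects TYPE('r) G"
  unfolding detects_def
proof (intro allI impI)
  fix R :: "'r ring" and \<phi>
  assume act: "ring_action G R \<phi>" and sol: "\<forall>E\<in>elem_ab_subgroups G. has_norm_one R \<phi> E"
  obtain f where f: "f \<in> iso G K" using iso by (auto simp: is_iso_def)
  show "has_norm_one R \<phi> (carrier G)"
    using has_norm_one_extension[OF act fin K iso_epi_kernel(1)[OF G K f] _ _ det]
      elem_ab_subgroups_preimage_iso[OF G fin K f] sol
      has_norm_one_trivial[OF act] iso_epi_kernel(2)[OF G K f] by simp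
qed

lemma detects_trivial:
  assumes "carrier G = {\<one>\<^bsub>G\<^esub>}"
  shows "detects TYPE('r) G"
  using has_norm_one_trivial by (fastforce simp: detects_def assms)

text \<open>Quotients are groups of cosets and thus change the type. Copying them back to
  \<open>nat\<close> keeps an induction over quotients within one type, the one in which the members
  of \<open>FF\<close> live.\<close>

lemma nat_copy:
  assumes "group G" "finite (carrier G)"
  obtains K :: "nat monoid" and f where "group K" "f \<in> iso G K"
proof -
  obtain f :: "'a \<Rightarrow> nat" where "inj_on f (carrier G)"
    using finite_imp_inj_to_nat_seg[OF assms(2)] by blast
  then show ?thesis
    using that group.inj_imp_image_group_is_group[OF assms(1)] inj_imp_image_group_iso by blast
qed

lemma subquotient_epi:
  assumes G: "group G" and K: "group K" and f: "f \<in> epi G K" and L: "subquotient L K"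
  shows "subquotient L G"
proof -
  interpret f: group_hom G K f
    using f G K by (auto simp: epi_def intro!: group_hom.intro group_hom_axioms.intro)
  obtain H h where H: "subgroup H K" and h: "h \<in> epi (K\<lparr>carrier := H\<rparr>) L" and L: "group L"
    using L by (auto simp: subquotient_def)
  have im: "f ` carrier G = carrier K" using f by (simp add: epi_def)
  let ?H = "{g \<in> carrier G. f g \<in> H}"
  have sub: "subgroup ?H G" using f.subgroup_vimage[OF H] .
  have "f ` ?H = f ` carrier G \<inter> H" by auto
  then have "f ` ?H = H" by (simp add: im Int_absorb1 subgroup.subset[OF H])
  then have "h \<circ> f \<in> epi (G\<lparr>carrier := ?H\<rparr>) L"
    using h image_comp[of h f ?H] by (auto simp: epi_def hom_def Pi_iff)
  then show ?thesis using sub L unfolding subquotient_def by blast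
qed

lemma subquotient_subgroup:
  assumes "group G" "subgroup H G" "subquotient L (G\<lparr>carrier := H\<rparr>)"
  shows "subquotient L G"
  using assms group.incl_subgroup[OF assms(1,2)] unfolding subquotient_def by fastforce

lemma subquotient_refl: "group G \<Longrightarrow> subquotient G G"
  unfolding subquotient_def
  by (intro conjI exI[of _ "carrier G"] exI[of _ "\<lambda>x. x"]) (auto simp: epi_def hom_def group.subgroup_self)

lemma elementary_abelian_iso:
  "group G \<Longrightarrow> G \<cong> K \<Longrightarrow> elementary_abelian K \<Longrightarrow> elementary_abelian G"
  unfolding elementary_abelian_def using iso_trans by blast

text \<open>Induction on the order. If some proper nontrivial quotient is not elementary abelian,
  the group is an extension of smaller groups to which the induction applies, because subgroups and
  quotients have no new members in their \<open>FF\<close>. Otherwise the group is trivial,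
  elementary abelian or itself a member of \<open>FF\<close>.\<close>

lemma detects_nat_p_group:
  fixes G :: "nat monoid"
  assumes p: "Factorial_Ring.prime p" and G: "fin_p_group p G"
    and FF: "\<And>K. K \<in> FF p G \<Longrightarrow> detects TYPE('r) K"
  shows "detects TYPE('r) G"
  using G FF
proof (induction "order G" arbitrary: G rule: less_induct)
  case less
  note G = less.prems(1)
  interpret group G using G by (rule fin_p_groupD)
  have fin: "finite (carrier G)" by (rule fin_p_groupD(2)[OF G])
  have IHsub: "detects TYPE('r) (G\<lparr>carrier := H\<rparr>)" if H: "subgroup H G" "H \<noteq> carrier G" for H
  proof (rule less.hyps)
    show "order (G\<lparr>carrier := H\<rparr>) < order G"
      using psubset_card_mono[OF fin] H subgroup.subset[OF H(1)] by (simp add: order_def psubset_eq)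
    show "fin_p_group p (G\<lparr>carrier := H\<rparr>)" by (rule fin_p_group_subgroup[OF G p H(1)])
    show "detects TYPE('r) K" if "K \<in> FF p (G\<lparr>carrier := H\<rparr>)" for K
      using that subquotient_subgroup[OF is_group H(1)] by (intro less.prems(2)) (auto simp: FF_def)
  qed
  consider "carrier G = {\<one>\<^bsub>G\<^esub>}" | "elementary_abelian G"
    | N where "N \<lhd> G" "N \<noteq> {\<one>\<^bsub>G\<^esub>}" "N \<noteq> carrier G" "\<not> elementary_abelian (G Mod N)"
    | "extraspecial p G \<or> almost_extraspecial p G"
    using minimal_p_group[OF G p] by blast
  then show ?case
  proof cases
    case 1 then show ?thesis by (rule detects_trivial)
  next
    case 2 then show ?thesis using carrier_elementary_abelian by (simp add: detects_def)
  next
    case 3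
    interpret N: normal N G by (rule 3)
    have "finite (carrier (G Mod N))" using fin by (simp add: carrier_FactGroup)
    then obtain K :: "nat monoid" and f where K: "group K" and f: "f \<in> iso (G Mod N) K"
      using nat_copy[OF N.factorgroup_is_group] by blast
    define \<pi> where "\<pi> x = f (N #>\<^bsub>G\<^esub> x)" for x
    have \<pi>: "\<pi> \<in> epi G K" "kernel G K \<pi> = N"
      using N.iso_factor_epi[OF f K] by (simp_all add: \<pi>_def[abs_def])
    have "\<not> elementary_abelian K"
      using 3(4) elementary_abelian_iso[OF N.factorgroup_is_group] f by (auto simp: is_iso_def)
    have "detects TYPE('r) K"
    proof (rule less.hyps)
      show pK: "fin_p_group p K" by (rule fin_p_group_epi[OF G p K \<pi>(1)])
      have "card N * order K = order G" using fin_p_group_epi(2)[OF G p K \<pi>(1)] \<pi>(2) by simp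
      moreover have "0 < order K" using group.is_monoid[OF K] monoid.one_closed fin_p_groupD(2)[OF pK]
        by (fastforce simp: order_def card_gt_0_iff)
      moreover have "1 < card N"
      proof -
        have "finite N" using fin N.subset finite_subset by blast
        moreover have one: "\<one>\<^bsub>G\<^esub> \<in> N" by (rule subgroup.one_closed[OF N.is_subgroup])
        ultimately have "card N \<noteq> 0" by (metis card_0_eq empty_iff)
        moreover have "card N \<noteq> 1" using 3(2) one by (metis card_1_singletonE singletonD)
        ultimately show ?thesis by simp
      qed
      ultimately show "order K < order G" by (metis mult_less_mono1 nat_mult_1)
      show "detects TYPE('r) L" if "L \<in> FF p K" for L
        using that subquotient_epi[OF is_group K \<pi>(1)] by (intro less.prems(2)) (auto simp: FF_def)
    qed
    show ?thesis unfolding detects_def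
    proof (intro allI impI)
      fix R :: "'r ring" and \<phi>
      assume act: "ring_action G R \<phi>" and sol: "\<forall>E\<in>elem_ab_subgroups G. has_norm_one R \<phi> E"
      have sub: "has_norm_one R \<phi> H" if "subgroup H G" "H \<noteq> carrier G" for H
        using has_norm_one_subgroup[OF act that(1) _ IHsub[OF that]] sol by blast
      show "has_norm_one R \<phi> (carrier G)"
      proof (rule has_norm_one_extension[OF act fin K \<pi>(1) _ _ \<open>detects TYPE('r) K\<close>])
        show "has_norm_one R \<phi> (kernel G K \<pi>)" unfolding \<pi>(2) by (rule sub[OF N.is_subgroup 3(3)])
      next
        fix E assume E: "E \<in> elem_ab_subgroups K"
        interpret \<pi>: group_hom G K \<pi>
          using \<pi>(1) K by (auto simp: epi_def intro!: group_hom.intro group_hom_axioms.intro is_group)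
        have E': "subgroup E K" "elementary_abelian (K\<lparr>carrier := E\<rparr>)"
          using E by (auto simp: elem_ab_subgroups_def)
        \<comment> \<open>If the preimage were all of \<open>G\<close>, then \<open>E\<close> would
          be all of \<open>K\<close>, which would be elementary abelian against the choice of
          \<open>N\<close>.\<close>
        have "{g \<in> carrier G. \<pi> g \<in> E} \<noteq> carrier G"
        proof
          assume "{g \<in> carrier G. \<pi> g \<in> E} = carrier G"
          then have "\<pi> ` carrier G \<subseteq> E" by blast
          then have "carrier K \<subseteq> E" using \<pi>(1) by (simp add: epi_def)
          then have "E = carrier K" using subgroup.subset[OF E'(1)] by blast
          then show False using E'(2) \<open>\<not> elementary_abelian K\<close> by simp
        qed
        then show "has_norm_one R \<phi> {g \<in> carrier G. \<pi> g \<in> E}"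
          using sub \<pi>.subgroup_vimage[OF E'(1)] by blast
      qed
    qed
  next
    case 4
    then have "G \<in> FF p G" using subquotient_refl[OF is_group] by (simp add: FF_def)
    then show ?thesis by (rule less.prems(2))
  qed
qed

theorem detects_p_group:
  assumes p: "Factorial_Ring.prime p" and G: "fin_p_group p G"
    and FF: "\<And>K. K \<in> FF p G \<Longrightarrow> detects TYPE('r) K"
  shows "detects TYPE('r) G"
proof -
  have grp: "group G" and fin: "finite (carrier G)" using fin_p_groupD[OF G] by blast+
  obtain K :: "nat monoid" and f where K: "group K" and f: "f \<in> iso G K" using nat_copy[OF grp fin] .
  note epi = iso_epi_kernel(1)[OF grp K f]
  have "detects TYPE('r) K"
    using p fin_p_group_epi(1)[OF G p K epi]
  proof (rule detects_nat_p_group)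
    show "detects TYPE('r) L" if "L \<in> FF p K" for L
      using that subquotient_epi[OF grp K epi] by (intro FF) (auto simp: FF_def)
  qed
  then show ?thesis using detects_iso[OF grp fin K] f by (auto simp: is_iso_def)
qed

lemma pow_DirProd: "(x, y) [^]\<^bsub>G \<times>\<times> H\<^esub> (n :: nat) = (x [^]\<^bsub>G\<^esub> n, y [^]\<^bsub>H\<^esub> n)"
  by (induction n) auto

theorem detects_product:
  fixes G1 :: "'a monoid" and G2 :: "'b monoid"
  assumes p: "Factorial_Ring.prime p" and G1: "fin_p_group p G1" and G2: "fin_p_group p G2"
    and d1: "detects TYPE('r) G1" and d2: "detects TYPE('r) G2"
  shows "detects TYPE('r) (G1 \<times>\<times> G2)"
  unfolding detects_def
proof (intro allI impI)
  fix R :: "'r ring" and \<phi>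
  assume act: "ring_action (G1 \<times>\<times> G2) R \<phi>" and sol: "\<forall>E\<in>elem_ab_subgroups (G1 \<times>\<times> G2). has_norm_one R \<phi> E"
  let ?G = "G1 \<times>\<times> G2"
  interpret G1: group G1 using G1 by (rule fin_p_groupD)
  interpret G2: group G2 using G2 by (rule fin_p_groupD)
  interpret G: group ?G by (intro DirProd_group G1.is_group G2.is_group)
  have fin: "finite (carrier ?G)" using fin_p_groupD(2)[OF G1] fin_p_groupD(2)[OF G2] by simp
  obtain n1 n2 where "order G1 = p ^ n1" "order G2 = p ^ n2" using fin_p_groupD(3) G1 G2 by metis
  then have "order ?G = p ^ (n1 + n2)" by (simp add: order_def power_add card_cartesian_product)
  then have pG: "fin_p_group p ?G" using fin G.is_group unfolding fin_p_group_def by blast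
  have elab: "E \<times> T \<in> elem_ab_subgroups ?G"
    if "E = {\<one>\<^bsub>G1\<^esub>} \<or> E \<in> elem_ab_subgroups G1" "T = {\<one>\<^bsub>G2\<^esub>} \<or> T \<in> elem_ab_subgroups G2"
      "E \<noteq> {\<one>\<^bsub>G1\<^esub>} \<or> T \<noteq> {\<one>\<^bsub>G2\<^esub>}" for E T
  proof -
    have E: "subgroup E G1" "\<forall>x\<in>E. \<forall>y\<in>E. x \<otimes>\<^bsub>G1\<^esub> y = y \<otimes>\<^bsub>G1\<^esub> x" "\<forall>x\<in>E. x [^]\<^bsub>G1\<^esub> p = \<one>\<^bsub>G1\<^esub>"
      using that(1) G1.triv_subgroup by (auto simp: elem_ab_subgroups_p_group[OF G1 p])
    have T: "subgroup T G2" "\<forall>x\<in>T. \<forall>y\<in>T. x \<otimes>\<^bsub>G2\<^esub> y = y \<otimes>\<^bsub>G2\<^esub> x" "\<forall>x\<in>T. x [^]\<^bsub>G2\<^esub> p = \<one>\<^bsub>G2\<^esub>"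
      using that(2) G2.triv_subgroup by (auto simp: elem_ab_subgroups_p_group[OF G2 p])
    have "\<one>\<^bsub>G1\<^esub> \<in> E" "\<one>\<^bsub>G2\<^esub> \<in> T" using E(1) T(1) subgroup.one_closed by blast+
    then have "E \<times> T \<noteq> {\<one>\<^bsub>?G\<^esub>}" using that(3) by auto
    then show ?thesis
      using E T DirProd_subgroups[OF G1.is_group E(1) G2.is_group T(1)]
      unfolding elem_ab_subgroups_p_group[OF pG p] by (auto simp: pow_DirProd)
  qed
  \<comment> \<open>These are exactly the subgroups that the second projection asks for: its kernel
    is the case of trivial \<open>T\<close>, and the preimages of elementary abelian subgroups are
    the other case.\<close>
  have left: "has_norm_one R \<phi> (carrier G1 \<times> T)" if T: "T = {\<one>\<^bsub>G2\<^esub>} \<or> T \<in> elem_ab_subgroups G2" for T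
  proof -
    have Tsub: "subgroup T G2" using T G2.triv_subgroup by (auto simp: elem_ab_subgroups_def)
    have T1: "\<one>\<^bsub>G2\<^esub> \<in> T" using Tsub by (rule subgroup.one_closed)
    let ?H = "?G\<lparr>carrier := carrier G1 \<times> T\<rparr>"
    have sub: "subgroup (carrier G1 \<times> T) ?G"
      using DirProd_subgroups[OF G1.is_group G1.subgroup_self G2.is_group Tsub] .
    have "has_norm_one R \<phi> (carrier ?H)"
    proof (rule has_norm_one_extension[OF restrict_ring_action[OF act sub] _ G1.is_group _ _ _ d1])
      show "finite (carrier ?H)" using fin sub subgroup.subset finite_subset by fastforce
      show "fst \<in> epi ?H G1" using T1 by (force simp: epi_def hom_def mult_DirProd' image_iff)
      have "kernel ?H G1 fst = {\<one>\<^bsub>G1\<^esub>} \<times> T" by (auto simp: kernel_def)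
      moreover have "has_norm_one R \<phi> ({\<one>\<^bsub>G1\<^esub>} \<times> T)"
      proof (cases "T = {\<one>\<^bsub>G2\<^esub>}")
        case True then show ?thesis using has_norm_one_trivial[OF act] by simp
      next
        case False then show ?thesis using elab T sol by blast
      qed
      ultimately show "has_norm_one R \<phi> (kernel ?H G1 fst)" by simp
    next
      fix E assume E: "E \<in> elem_ab_subgroups G1"
      have "E \<subseteq> carrier G1" using E G1.elem_ab_subgroups_iff subgroup.subset by blast
      then have "{g \<in> carrier ?H. fst g \<in> E} = E \<times> T" by auto
      moreover have "E \<noteq> {\<one>\<^bsub>G1\<^esub>}" using E by (simp add: G1.elem_ab_subgroups_iff)
      then have "E \<times> T \<in> elem_ab_subgroups ?G" using elab E T by blast
      ultimately show "has_norm_one R \<phi> {g \<in> carrier ?H. fst g \<in> E}" using sol by simp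
    qed
    then show ?thesis by simp
  qed
  show "has_norm_one R \<phi> (carrier ?G)"
  proof (rule has_norm_one_extension[OF act fin G2.is_group _ _ _ d2])
    show "snd \<in> epi ?G G2" using G1.one_closed by (force simp: epi_def hom_def mult_DirProd' image_iff)
    have "kernel ?G G2 snd = carrier G1 \<times> {\<one>\<^bsub>G2\<^esub>}" by (auto simp: kernel_def)
    then show "has_norm_one R \<phi> (kernel ?G G2 snd)" using left by simp
  next
    fix E assume E: "E \<in> elem_ab_subgroups G2"
    have "E \<subseteq> carrier G2" using E G2.elem_ab_subgroups_iff subgroup.subset by blast
    then have "{g \<in> carrier ?G. snd g \<in> E} = carrier G1 \<times> E" by auto
    then show "has_norm_one R \<phi> {g \<in> carrier ?G. snd g \<in> E}" using left E by simp
  qed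
qed

text \<open>The family meets each isomorphism class in a single representative;
  \<open>detects_iso\<close> carries the property to the other members of the class.\<close>

theorem detects_formula_family:
  fixes G1 :: "'a monoid" and G2 :: "'b monoid"
  assumes p: "Factorial_Ring.prime p" and G1: "fin_p_group p G1" and G2: "fin_p_group p G2"
    and fam: "formula_family p G1 G2 fam"
  shows "detects TYPE('r) (G1 \<times>\<times> G2)"
proof -
  have fp: "fin_p_group p K" if "K \<in> FF p G1 \<union> FF p G2" for K
    using that by (auto simp: FF_def extraspecial_def almost_extraspecial_def)
  have "detects TYPE('r) H" if H: "H \<in> FF p G1 \<union> FF p G2" for H
  proof -
    obtain j where j: "j < length fam" "fst (fam ! j) \<cong> H"
      using fam H unfolding formula_family_def by blast
    obtain K zs \<Psi> where K: "fam ! j = (K, zs, \<Psi>)" by (cases "fam ! j")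
    then have "(K, zs, \<Psi>) \<in> set fam" using j(1) by (metis nth_mem)
    then have KF: "K \<in> FF p G1 \<union> FF p G2" and \<Psi>: "is_formula K \<Psi>"
      using fam by (auto simp: formula_family_def)
    note fK = fin_p_groupD[OF fp[OF KF]] and fH = fin_p_groupD[OF fp[OF H]]
    have "H \<cong> K" using j(2) K group.iso_sym[OF fK(1)] by simp
    then show ?thesis
      by (rule detects_iso[OF fH(1,2) fK(1) _ detects_formula[OF \<Psi> fK(1,2)]])
  qed
  then show ?thesis
    using detects_product[OF p G1 G2] detects_p_group[OF p G1] detects_p_group[OF p G2] by blast
qed

section \<open>Certificates\<close>

lemma set_bits: "set (bits N s) = set_decode s \<inter> {..<N}"
  by (auto simp: bits_def set_decode_def)

lemma distinct_bits: "distinct (bits N s)"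
  by (simp add: bits_def)

lemma set_decode_subset: "s < 2 ^ N \<Longrightarrow> set_decode s \<subseteq> {..<N}"
proof
  fix n assume "s < 2 ^ N" "n \<in> set_decode s"
  then have "s div 2 ^ n \<noteq> 0" by (auto simp: set_decode_def intro: Nat.gr0I)
  then have "2 ^ n \<le> s" by (metis div_less not_le)
  from this \<open>s < 2 ^ N\<close> have "(2 :: nat) ^ n < 2 ^ N" by (rule order.strict_trans1)
  then show "n \<in> {..<N}" using power_less_imp_less_exp[of 2 n N] by simp
qed

lemma set_encode_less:
  assumes "E \<subseteq> {..<N}"
  shows "set_encode E < 2 ^ N"
proof -
  have "set_encode E \<le> (\<Sum>i<N. 2 ^ i)" unfolding set_encode_def using assms by (intro sum_mono2) auto
  also have "\<dots> < 2 ^ N" by (induction N) auto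
  finally show ?thesis .
qed

lemma prime_factor_test:
  assumes "2 \<le> (q :: nat)"
  shows "(\<forall>a\<in>set [0..<q]. \<forall>b\<in>set [0..<q]. a * b \<noteq> q) \<longleftrightarrow> Factorial_Ring.prime q"
proof
  assume L: "\<forall>a\<in>set [0..<q]. \<forall>b\<in>set [0..<q]. a * b \<noteq> q"
  have "d = 1 \<or> d = q" if "d dvd q" for d
  proof (rule ccontr)
    assume d: "\<not> (d = 1 \<or> d = q)"
    obtain b where b: "q = d * b" using \<open>d dvd q\<close> by (elim dvdE)
    have "d < q" using d that assms by (metis dvd_imp_le le_neq_implies_less not_less_eq_eq numeral_2_eq_2 order_less_le_trans zero_less_Suc)
    moreover have "0 < b" using b assms by (cases b) auto
    then have "b < q" using b d assms by (cases d) auto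
    ultimately have "d * b \<noteq> q" using L by simp
    then show False using b by simp
  qed
  then show "Factorial_Ring.prime q" using assms by (simp add: prime_nat_iff)
next
  assume q: "Factorial_Ring.prime q"
  then show "\<forall>a\<in>set [0..<q]. \<forall>b\<in>set [0..<q]. a * b \<noteq> q"
    using assms by (metis atLeastLessThan_iff dvd_triv_left less_irrefl mult.right_neutral nat_mult_1 prime_nat_iff set_upt)
qed

text \<open>Elements are their own indices, so that a set of elements is coded by a number below
  \<open>2 ^ N\<close>.\<close>

locale nat_group = group H for H :: "nat monoid" (structure) +
  fixes N
  assumes carrier: "carrier H = {..<N}"
begin

abbreviation "m \<equiv> (\<lambda>a b. a \<otimes> b)"

lemma funpow_mult: "a \<in> carrier H \<Longrightarrow> ((\<lambda>y. a \<otimes> y) ^^ n) a = a [^] n \<otimes> a"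
proof (induction n)
  case (Suc n)
  then show ?case by (simp add: m_assoc[symmetric] nat_pow_mult[symmetric] del: nat_pow_Suc)
    (metis nat_pow_Suc nat_pow_Suc2)
qed simp

lemma elab_codeD:
  assumes "elab_code N m s"
  shows "set_decode s \<in> elem_ab_subgroups H" "set (bits N s) = set_decode s"
proof -
  let ?B = "set (bits N s)"
  have s: "s < 2 ^ N" and len: "2 \<le> length (bits N s)"
    and B: "\<And>a b. a \<in> ?B \<Longrightarrow> b \<in> ?B \<Longrightarrow> a \<otimes> b \<in> ?B \<and> a \<otimes> b = b \<otimes> a"
    using assms by (auto simp: elab_code_def)
  show bits: "?B = set_decode s" using set_decode_subset[OF s] by (auto simp: set_bits)
  have BH: "?B \<subseteq> carrier H" by (auto simp: set_bits carrier)
  obtain q where "2 \<le> q" "\<forall>a\<in>set [0..<q]. \<forall>b\<in>set [0..<q]. a * b \<noteq> q"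
    and pow: "\<forall>a\<in>?B. ((\<lambda>y. a \<otimes> y) ^^ q) a = a"
    using assms unfolding elab_code_def by blast
  then have q: "2 \<le> q" "Factorial_Ring.prime q" using prime_factor_test by blast+
  have aq: "a [^] q = \<one>" if "a \<in> ?B" for a
    using bspec[OF pow that] funpow_mult[of a q] BH that by (metis nat_pow_closed r_cancel_one subsetD)
  have pw: "a [^] Suc n \<in> ?B" if "a \<in> ?B" for a n
  proof (induction n)
    case 0 then show ?case using that BH by auto
  next
    case (Suc n) then show ?case using B that by simp
  qed
  have card: "2 \<le> card ?B" using len distinct_card[OF distinct_bits[of N s]] by simp
  have "subgroup ?B H"
  proof (rule subgroupI)
    show "?B \<noteq> {}" using card by auto
    fix a assume a: "a \<in> ?B"
    have "a [^] (q - 1) \<otimes> a = \<one>" using aq[OF a] q(1) by (simp flip: nat_pow_Suc)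
    then have "inv a = a [^] (q - 1)" using a BH by (intro inv_equality) auto
    \<comment> \<open>The exponent is positive, so the inverse is a nonempty product of elements of
      \<open>?B\<close>, to which closure under products applies.\<close>
    moreover have "q - 1 = Suc (q - 2)" using q(1) by simp
    ultimately show "inv a \<in> ?B" using pw[OF a] by metis
  qed (use BH B in auto)
  moreover have "?B \<noteq> {\<one>}" using card by auto
  ultimately show "set_decode s \<in> elem_ab_subgroups H"
    unfolding elem_ab_subgroups_iff bits[symmetric] using B aq q(2) by auto
qed

lemma elab_code_set_encode:
  assumes E: "E \<in> elem_ab_subgroups H"
  shows "elab_code N m (set_encode E)" "set_decode (set_encode E) = E"
proof -
  note E' = E[unfolded elem_ab_subgroups_iff]
  have EN: "E \<subseteq> {..<N}" using E' subgroup.subset carrier by auto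
  have fin: "finite E" using E' by blast
  show dec: "set_decode (set_encode E) = E" by (rule set_encode_inverse[OF fin])
  then have bits: "set (bits N (set_encode E)) = E" using EN by (auto simp: set_bits)
  have one: "\<one> \<in> E" using E' subgroup.one_closed by blast
  obtain a where a: "a \<in> E" "a \<noteq> \<one>" using E' one by blast
  have "card {\<one>, a} \<le> card E" using fin one a by (intro card_mono) auto
  then have len: "2 \<le> length (bits N (set_encode E))"
    using a distinct_card[OF distinct_bits[of N "set_encode E"]] by (simp add: bits)
  obtain q where q: "Factorial_Ring.prime q" "\<forall>x\<in>E. x [^] (q :: nat) = \<one>" using E' by blast
  have EH: "x \<in> carrier H" if "x \<in> E" for x using that EN carrier by auto
  \<comment> \<open>As the order of a nontrivial element, \<open>q\<close> is at most
    \<open>N\<close>; hence it lies in the range searched by \<open>elab_code\<close>.\<close>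
  have "ord a dvd q" using pow_eq_id[of a q] q(2) a(1) EH by blast
  then have "ord a = q" using q(1) a(2) EH[OF a(1)] ord_eq_1 prime_nat_iff by blast
  moreover have "finite (carrier H)" by (simp add: carrier)
  then have "ord a \<le> N" using ord_le_group_order[of a] EH[OF a(1)] by (simp add: order_def carrier)
  ultimately have qN: "q \<in> set [0..<Suc N]" by auto
  have q2: "2 \<le> q" using q(1) by (rule prime_ge_2_nat)
  have fp: "((\<lambda>y. x \<otimes> y) ^^ q) x = x" if "x \<in> E" for x
    using funpow_mult[OF EH[OF that], of q] q(2) EH that by simp
  have cl: "x \<otimes> y \<in> E \<and> x \<otimes> y = y \<otimes> x" if "x \<in> E" "y \<in> E" for x y
    using E' that subgroup.m_closed by metis
  show "elab_code N m (set_encode E)"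
    unfolding elab_code_def bits
    using set_encode_less[OF EN] len cl fp q2 iffD2[OF prime_factor_test[OF q2] q(1)] qN by blast
qed

end

section \<open>Soundness: evaluating certificates in a ring with an action\<close>

locale nat_group_action = nat_group H N for H :: "nat monoid" (structure) and N +
  fixes R :: "'r ring" and \<psi> and x :: "nat \<Rightarrow> 'r"
  assumes act: "ring_action H R \<psi>"
    and x: "\<And>s. elab_code N m s \<Longrightarrow> x s \<in> carrier R"
    and norm_x: "\<And>s. elab_code N m s \<Longrightarrow> Nrm R \<psi> (set_decode s) (x s) = \<one>\<^bsub>R\<^esub>"
begin

sublocale R: ring R using ring_actionD(2)[OF act] .

lemmas D = ring_actionD[OF act]

abbreviation scale :: "nat \<Rightarrow> 'r \<Rightarrow> 'r" (infixr \<open>\<star>\<close> 75) where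
  "c \<star> y \<equiv> [int_decode c] \<cdot>\<^bsub>R\<^esub> y"

definition ev :: "(nat \<times> nat) list \<Rightarrow> 'r" where
  "ev w = foldr (\<lambda>l y. \<psi> (fst l) (x (snd l)) \<otimes>\<^bsub>R\<^esub> y) w \<one>\<^bsub>R\<^esub>"

definition evs :: "sword list \<Rightarrow> 'r" where
  "evs L = foldr (\<lambda>t y. (fst t) \<star> ev (snd t) \<oplus>\<^bsub>R\<^esub> y) L \<zero>\<^bsub>R\<^esub>"

abbreviation "ok_word w \<equiv> \<forall>l\<in>set w. letter_ok N m l"
abbreviation "ok_sword t \<equiv> (fst t = 1 \<or> fst t = 2) \<and> ok_word (snd t)"

lemma letter_closed: "letter_ok N m l \<Longrightarrow> \<psi> (fst l) (x (snd l)) \<in> carrier R"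
  using D(4) x by (simp add: letter_ok_def carrier)

lemma ev_closed: "ok_word w \<Longrightarrow> ev w \<in> carrier R"
  by (induction w) (auto simp: ev_def letter_closed)

lemma ev_append: "ok_word u \<Longrightarrow> ok_word v \<Longrightarrow> ev (u @ v) = ev u \<otimes>\<^bsub>R\<^esub> ev v"
proof (induction u)
  case Nil then show ?case using ev_closed[of v] by (simp add: ev_def)
next
  case (Cons l u)
  then show ?case using ev_closed[of u] ev_closed[of v] letter_closed[of l]
    by (simp add: ev_def R.m_assoc)
qed

lemma int_pow_sign: "y \<in> carrier R \<Longrightarrow> 2 \<star> y = y" "y \<in> carrier R \<Longrightarrow> 1 \<star> y = \<ominus>\<^bsub>R\<^esub> y"
proof -
  assume y: "y \<in> carrier R"
  have "int_decode 2 = 1" "int_decode 1 = - 1" by (simp_all add: int_decode_def sum_decode_def)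
  then show "2 \<star> y = y" "1 \<star> y = \<ominus>\<^bsub>R\<^esub> y"
    using R.add.int_pow_1[OF y] R.add.int_pow_neg[OF y, of 1] by (simp_all add: add_pow_def a_inv_def)
qed

lemmas int_pow_sign_simps = int_pow_sign int_pow_sign(2)[unfolded One_nat_def]

lemma sign_closed: "y \<in> carrier R \<Longrightarrow> c \<star> y \<in> carrier R"
  using R.add.int_pow_closed[of y "int_decode c"] by (simp add: add_pow_def)

lemma evs_Nil [simp]: "evs [] = \<zero>\<^bsub>R\<^esub>" by (simp add: evs_def)
lemma evs_Cons: "evs (t # L) = (fst t) \<star> ev (snd t) \<oplus>\<^bsub>R\<^esub> evs L" by (simp add: evs_def)

lemma evs_closed: "\<forall>t\<in>set L. ok_word (snd t) \<Longrightarrow> evs L \<in> carrier R"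
  by (induction L) (auto simp: evs_Cons sign_closed ev_closed)

lemma evs_append:
  "\<forall>t\<in>set L. ok_word (snd t) \<Longrightarrow> \<forall>t\<in>set M. ok_word (snd t) \<Longrightarrow> evs (L @ M) = evs L \<oplus>\<^bsub>R\<^esub> evs M"
proof (induction L)
  case (Cons t L)
  then show ?case
    using sign_closed[OF ev_closed[of "snd t"]] evs_closed[of L] evs_closed[of M]
    by (simp add: evs_Cons R.a_assoc)
qed (simp add: evs_closed)

lemma evs_concat:
  "(\<And>L t. L \<in> set Ls \<Longrightarrow> t \<in> set L \<Longrightarrow> ok_word (snd t)) \<Longrightarrow> (\<And>L. L \<in> set Ls \<Longrightarrow> evs L = \<zero>\<^bsub>R\<^esub>) \<Longrightarrow>
    evs (concat Ls) = \<zero>\<^bsub>R\<^esub>"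
proof (induction Ls)
  case (Cons L Ls)
  have "evs (L @ concat Ls) = evs L \<oplus>\<^bsub>R\<^esub> evs (concat Ls)" 
    using Cons.prems(1) by (intro evs_append) auto
  moreover have "evs (concat Ls) = \<zero>\<^bsub>R\<^esub>" by (rule Cons.IH) (use Cons.prems in auto)
  ultimately show ?case using Cons.prems(2) by simp
qed simp

lemma evs_map_distinct:
  "distinct is \<Longrightarrow> (\<And>i. i \<in> set is \<Longrightarrow> ok_word (F i)) \<Longrightarrow>
     evs (map (\<lambda>i. (c, F i)) is) = (\<Oplus>\<^bsub>R\<^esub>i\<in>set is. c \<star> ev (F i))"
proof (induction "is")
  case (Cons i "is")
  have "c \<star> ev (F j) \<in> carrier R" if "j \<in> set (i # is)" for j
    using Cons.prems(2)[OF that] by (intro sign_closed ev_closed)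
  moreover have "evs (map (\<lambda>i. (c, F i)) is) = (\<Oplus>\<^bsub>R\<^esub>i\<in>set is. c \<star> ev (F i))"
    by (rule Cons.IH) (use Cons.prems in auto)
  ultimately show ?case using Cons.prems(1) by (simp add: evs_Cons R.finsum_insert Pi_def)
qed simp

lemma balanced_count:
  assumes "\<forall>t\<in>set L. fst t = 1 \<or> fst t = 2" "balanced L"
  shows "count_list L (2, w) = count_list L (1, w)"
proof (cases "\<exists>t\<in>set L. snd t = w")
  case True
  then have "length (filter (\<lambda>t. t = (2, w)) L) = length (filter (\<lambda>t. t = (1, w)) L)"
    using assms(2) by (auto simp: balanced_def)
  moreover have "count_list L y = length (filter (\<lambda>t. t = y) L)" for y by (induction L) auto
  ultimately show ?thesis by simp
next
  case False
  then have "(2, w) \<notin> set L" "(1, w) \<notin> set L" by auto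
  then show ?thesis by (metis count_notin)
qed

text \<open>By the counts, the first signed word has a partner of opposite sign further on in the
  list. Removing both keeps the counts balanced and does not change the value, as addition is
  commutative.\<close>

lemma evs_cancel:
  assumes "\<forall>t\<in>set L. ok_sword t" "\<And>w. count_list L (2, w) = count_list L (1, w)"
  shows "evs L = \<zero>\<^bsub>R\<^esub>"
  using assms
proof (induction "length L" arbitrary: L rule: less_induct)
  case less
  show ?case
  proof (cases L)
    case (Cons t L')
    obtain c w where t: "t = (c, w)" by fastforce
    have c: "c = 1 \<or> c = 2" and w: "ok_word w" using less.prems(1) Cons t by auto
    have "(3 - c, w) \<in> set L'"
    proof (rule ccontr)
      assume "(3 - c, w) \<notin> set L'"
      then have "count_list L' (3 - c, w) = 0" by simp
      then show False using less.prems(2)[of w] c by (auto simp: Cons t)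
    qed
    then obtain A B where L': "L' = A @ (3 - c, w) # B" by (meson split_list)
    have AB: "\<forall>t\<in>set A. ok_word (snd t)" "\<forall>t\<in>set B. ok_word (snd t)" using less.prems(1) Cons L' by auto
    have "evs (A @ B) = \<zero>\<^bsub>R\<^esub>"
    proof (rule less.hyps)
      show "count_list (A @ B) (2, v) = count_list (A @ B) (1, v)" for v
        using less.prems(2)[of v] c by (auto simp: Cons L' t split: if_splits)
    qed (use less.prems(1) in \<open>auto simp: Cons L'\<close>)
    then have "evs A \<oplus>\<^bsub>R\<^esub> evs B = \<zero>\<^bsub>R\<^esub>" using AB by (simp add: evs_append)
    moreover have "c \<star> ev w \<oplus>\<^bsub>R\<^esub> (3 - c) \<star> ev w = \<zero>\<^bsub>R\<^esub>"
      using c int_pow_sign[OF ev_closed[OF w]] ev_closed[OF w] by (auto simp: R.r_neg R.l_neg)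
    moreover have "evs L = (c \<star> ev w \<oplus>\<^bsub>R\<^esub> (3 - c) \<star> ev w) \<oplus>\<^bsub>R\<^esub> (evs A \<oplus>\<^bsub>R\<^esub> evs B)"
      using AB w evs_closed[OF AB(1)] evs_closed[OF AB(2)] sign_closed[OF ev_closed[OF w]]
      by (simp add: Cons L' t evs_Cons evs_append R.a_ac)
    ultimately show ?thesis by simp
  qed simp
qed

lemma letter_ok_translate: "g < N \<Longrightarrow> letter_ok N m l \<Longrightarrow> letter_ok N m (g \<otimes> fst l, snd l)"
  using m_closed[of g "fst l"] by (simp add: letter_ok_def carrier)

lemma ok_word_translate: "g < N \<Longrightarrow> ok_word w \<Longrightarrow> ok_word (translate m g w)"
  by (auto simp: translate_def letter_ok_translate)

lemma ev_translate: "g < N \<Longrightarrow> ok_word w \<Longrightarrow> ev (translate m g w) = \<psi> g (ev w)"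
proof (induction w)
  case Nil
  then show ?case using ring_hom_one[OF D(3)[of g]] by (simp add: translate_def ev_def carrier)
next
  case (Cons l w)
  have "\<psi> (g \<otimes> fst l) (x (snd l)) = \<psi> g (\<psi> (fst l) (x (snd l)))"
    using Cons.prems x by (intro D(6)) (auto simp: letter_ok_def carrier)
  then show ?case
    using Cons letter_closed[of l] ev_closed[of w] ring_hom_mult[OF D(3)[of g]]
    by (simp add: translate_def ev_def carrier)
qed

lemma sign_hom:
  assumes "g < N" "y \<in> carrier R" "c = 1 \<or> c = 2"
  shows "\<psi> g (c \<star> y) = c \<star> \<psi> g y"
proof -
  interpret g: ring_hom_ring R R "\<psi> g"
    using D(3)[of g] assms(1) by (intro ring_hom_ringI2 R.ring_axioms) (simp add: carrier)
  show ?thesis using assms(2,3) int_pow_sign by auto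
qed

lemma evs_norm_words:
  "\<forall>t\<in>set \<Phi>. ok_sword t \<Longrightarrow> evs (norm_words N m \<Phi>) = Nrm R \<psi> {..<N} (evs \<Phi>)"
proof (induction \<Phi>)
  case Nil
  have "\<psi> g \<zero>\<^bsub>R\<^esub> = \<zero>\<^bsub>R\<^esub>" if "g < N" for g
  proof -
    interpret g: ring_hom_ring R R "\<psi> g"
      using D(3)[of g] that by (intro ring_hom_ringI2 R.ring_axioms) (simp add: carrier)
    show ?thesis by simp
  qed
  then show ?case by (simp add: norm_words_def Nrm_def cong: R.finsum_cong)
next
  case (Cons t \<Phi>)
  obtain c w where t: "t = (c, w)" by fastforce
  have c: "c = 1 \<or> c = 2" and w: "ok_word w" using Cons.prems t by auto
  have ok: "\<forall>t\<in>set (norm_words N m \<Phi>). ok_word (snd t)"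
    using Cons.prems ok_word_translate by (auto simp: norm_words_def)
  let ?y = "c \<star> ev w"
  have y: "?y \<in> carrier R" by (rule sign_closed[OF ev_closed[OF w]])
  have \<Phi>: "evs \<Phi> \<in> carrier R" using Cons.prems by (intro evs_closed) auto
  have "evs (norm_words N m (t # \<Phi>)) =
      evs (map (\<lambda>g. (c, translate m g w)) [0..<N]) \<oplus>\<^bsub>R\<^esub> evs (norm_words N m \<Phi>)"
    using evs_append[of "map (\<lambda>g. (c, translate m g w)) [0..<N]", OF _ ok] w ok_word_translate
    by (auto simp: norm_words_def t)
  also have "evs (map (\<lambda>g. (c, translate m g w)) [0..<N]) = (\<Oplus>\<^bsub>R\<^esub>g\<in>{..<N}. c \<star> ev (translate m g w))"
    using w ok_word_translate by (subst evs_map_distinct) (auto simp: lessThan_atLeast0)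
  also have "\<dots> = (\<Oplus>\<^bsub>R\<^esub>g\<in>{..<N}. \<psi> g ?y)"
    using w c ev_closed[OF w] D(4)[OF _ y]
    by (intro R.finsum_cong') (auto simp: sign_hom ev_translate carrier)
  also have "evs (norm_words N m \<Phi>) = (\<Oplus>\<^bsub>R\<^esub>g\<in>{..<N}. \<psi> g (evs \<Phi>))"
    using Cons by (simp add: Nrm_def)
  also have "(\<Oplus>\<^bsub>R\<^esub>g\<in>{..<N}. \<psi> g ?y) \<oplus>\<^bsub>R\<^esub> (\<Oplus>\<^bsub>R\<^esub>g\<in>{..<N}. \<psi> g (evs \<Phi>)) =
      (\<Oplus>\<^bsub>R\<^esub>g\<in>{..<N}. \<psi> g ?y \<oplus>\<^bsub>R\<^esub> \<psi> g (evs \<Phi>))"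
    using D(4)[OF _ y] D(4)[OF _ \<Phi>] by (intro R.finsum_addf[symmetric]) (auto simp: carrier)
  also have "\<dots> = Nrm R \<psi> {..<N} (evs (t # \<Phi>))"
    unfolding Nrm_def using D(4)[OF _ R.add.m_closed[OF y \<Phi>]] ring_hom_add[OF D(3) y \<Phi>]
    by (intro R.finsum_cong') (auto simp: carrier evs_Cons t)
  finally show ?case .
qed

text \<open>Ring automorphisms fix 1, so applying \<open>g\<close> to the equation
  \<open>N_E(x_E) = 1\<close> shows that the terms with index \<open>g \<otimes> h\<close> add up to
  1; then multiply by the values of \<open>u\<close> and \<open>v\<close>.\<close>

lemma evs_rel_words:
  assumes c: "c = 1 \<or> c = 2" and u: "ok_word u" and v: "ok_word v" and l: "letter_ok N m (g, s)"
  shows "evs (rel_words N m (c, u, (g, s), v)) = \<zero>\<^bsub>R\<^esub>"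
proof -
  have g: "g < N" and s: "elab_code N m s" using l by (auto simp: letter_ok_def)
  note B = elab_codeD[OF s]
  have BN: "set_decode s \<subseteq> {..<N}" using B(2) by (auto simp: set_bits)
  have ok: "letter_ok N m (g \<otimes> h, s)" if "h \<in> set_decode s" for h
    using letter_ok_translate[of g "(h, s)"] that BN g s by (auto simp: letter_ok_def)
  have xs: "x s \<in> carrier R" by (rule x[OF s])
  have \<psi>g: "\<psi> g \<in> ring_hom R R" using D(3) g by (simp add: carrier)
  have cl: "\<psi> h (x s) \<in> carrier R" if "h \<in> set_decode s" for h using D(4) xs that BN by (auto simp: carrier)
  have cl': "\<psi> (g \<otimes> h) (x s) \<in> carrier R" if "h \<in> set_decode s" for h
    using letter_closed[OF ok[OF that]] by simp
  have "(\<Oplus>\<^bsub>R\<^esub>h\<in>set_decode s. \<psi> (g \<otimes> h) (x s)) = (\<Oplus>\<^bsub>R\<^esub>h\<in>set_decode s. \<psi> g (\<psi> h (x s)))"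
    using D(6) xs g BN cl' by (intro R.finsum_cong') (auto simp: carrier subset_iff)
  also have "\<dots> = \<psi> g (\<Oplus>\<^bsub>R\<^esub>h\<in>set_decode s. \<psi> h (x s))"
    using ring_hom_ring.hom_finsum[OF ring_hom_ringI2[OF R.ring_axioms R.ring_axioms \<psi>g], of "\<lambda>h. \<psi> h (x s)" "set_decode s"] cl
    by (simp add: comp_def Pi_def)
  also have "\<dots> = \<one>\<^bsub>R\<^esub>" using norm_x[OF s] ring_hom_one[OF \<psi>g] by (simp add: Nrm_def)
  finally have sum: "(\<Oplus>\<^bsub>R\<^esub>h\<in>set_decode s. \<psi> (g \<otimes> h) (x s)) = \<one>\<^bsub>R\<^esub>" .
  note uR = ev_closed[OF u] and vR = ev_closed[OF v]
  have word: "ev (u @ (g \<otimes> h, s) # v) = ev u \<otimes>\<^bsub>R\<^esub> (\<psi> (g \<otimes> h) (x s) \<otimes>\<^bsub>R\<^esub> ev v)" if "h \<in> set_decode s" for h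
    using ev_append[OF u, of "(g \<otimes> h, s) # v"] ok[OF that] v by (simp add: ev_def)
  have "(\<Oplus>\<^bsub>R\<^esub>h\<in>set_decode s. ev (u @ (g \<otimes> h, s) # v)) =
      (\<Oplus>\<^bsub>R\<^esub>h\<in>set_decode s. ev u \<otimes>\<^bsub>R\<^esub> (\<psi> (g \<otimes> h) (x s) \<otimes>\<^bsub>R\<^esub> ev v))"
    using word cl' uR vR by (intro R.finsum_cong') auto
  also have "\<dots> = ev u \<otimes>\<^bsub>R\<^esub> ((\<Oplus>\<^bsub>R\<^esub>h\<in>set_decode s. \<psi> (g \<otimes> h) (x s)) \<otimes>\<^bsub>R\<^esub> ev v)"
    using cl' uR vR by (simp add: R.finsum_rdistr R.finsum_ldistr Pi_def)
  also have "\<dots> = ev (u @ v)" using sum uR vR ev_append[OF u v] by simp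
  finally have tot: "(\<Oplus>\<^bsub>R\<^esub>h\<in>set_decode s. ev (u @ (g \<otimes> h, s) # v)) = ev (u @ v)" .
  have okw: "ok_word (u @ (g \<otimes> h, s) # v)" if "h \<in> set_decode s" for h using u v ok[OF that] by auto
  have wcl': "ev (u @ (g \<otimes> h, s) # v) \<in> carrier R" if "h \<in> set_decode s" for h
    by (rule ev_closed[OF okw[OF that]])
  have wcl: "(\<lambda>h. ev (u @ (g \<otimes> h, s) # v)) \<in> set_decode s \<rightarrow> carrier R"
    using ev_closed[OF okw] by auto
  have uvR: "ev (u @ v) \<in> carrier R" using u v by (intro ev_closed) auto
  have "evs (rel_words N m (c, u, (g, s), v)) = (3 - c) \<star> ev (u @ v) \<oplus>\<^bsub>R\<^esub>
      (\<Oplus>\<^bsub>R\<^esub>h\<in>set_decode s. c \<star> ev (u @ (g \<otimes> h, s) # v))"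
    using evs_map_distinct[OF distinct_bits[of N s], of "\<lambda>h. u @ (g \<otimes> h, s) # v" c] okw
    unfolding B(2) by (simp add: rel_words_def evs_Cons)
  also have "(\<Oplus>\<^bsub>R\<^esub>h\<in>set_decode s. c \<star> ev (u @ (g \<otimes> h, s) # v)) = c \<star> ev (u @ v)"
    using c
  proof
    assume "c = 2"
    then show ?thesis
      using wcl uvR tot by (simp add: int_pow_sign_simps Pi_def cong: R.finsum_cong)
  next
    assume "c = 1"
    have "(\<Oplus>\<^bsub>R\<^esub>h\<in>set_decode s. \<ominus>\<^bsub>R\<^esub> ev (u @ (g \<otimes> h, s) # v)) =
        (\<Oplus>\<^bsub>R\<^esub>h\<in>set_decode s. (\<ominus>\<^bsub>R\<^esub> \<one>\<^bsub>R\<^esub>) \<otimes>\<^bsub>R\<^esub> ev (u @ (g \<otimes> h, s) # v))"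
      using wcl' by (intro R.finsum_cong') (auto simp: R.l_minus)
    also have "\<dots> = (\<ominus>\<^bsub>R\<^esub> \<one>\<^bsub>R\<^esub>) \<otimes>\<^bsub>R\<^esub> ev (u @ v)"
      using wcl by (simp add: R.finsum_rdistr[symmetric] tot)
    finally show ?thesis using \<open>c = 1\<close> wcl uvR
      by (simp add: int_pow_sign_simps R.l_minus Pi_def cong: R.finsum_cong)
  qed
  also have "(3 - c) \<star> ev (u @ v) \<oplus>\<^bsub>R\<^esub> c \<star> ev (u @ v) = \<zero>\<^bsub>R\<^esub>"
    using c int_pow_sign[OF uvR] uvR by (auto simp: R.r_neg R.l_neg)
  finally show ?thesis .
qed

lemma ok_rel_words:
  assumes "c = 1 \<or> c = 2" "ok_word u" "ok_word v" "letter_ok N m (g, s)" "t \<in> set (rel_words N m (c, u, (g, s), v))"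
  shows "ok_sword t"
proof -
  have g: "g < N" and s: "elab_code N m s" using assms(4) by (auto simp: letter_ok_def)
  have "letter_ok N m (g \<otimes> h, s)" if "h \<in> set (bits N s)" for h
    using letter_ok_translate[of g "(h, s)"] that g s by (auto simp: letter_ok_def set_bits)
  then show ?thesis using assms by (auto simp: rel_words_def)
qed

text \<open>The balanced list has value zero in every ring with an action, and the relations in it
  have value zero because the given elements have norm one. What remains is the norm of the
  candidate minus 1.\<close>

theorem certifies_sound:
  assumes "certifies N m \<Phi> J"
  shows "Nrm R \<psi> {..<N} (evs \<Phi>) = \<one>\<^bsub>R\<^esub>"
proof -
  have \<Phi>: "\<forall>t\<in>set \<Phi>. ok_sword t" using assms by (auto simp: certifies_def)
  have J: "fst j = 1 \<or> fst j = 2" "ok_word (fst (snd j))" "ok_word (snd (snd (snd j)))"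
    "letter_ok N m (fst (snd (snd j)))" if "j \<in> set J" for j
    using assms that by (auto simp: certifies_def)
  let ?A = "norm_words N m \<Phi>" and ?B = "concat (map (\<lambda>j. rel_words N m j) J)"
  have okJ: "\<forall>t\<in>set (rel_words N m j). ok_sword t" "evs (rel_words N m j) = \<zero>\<^bsub>R\<^esub>" if "j \<in> set J" for j
    using ok_rel_words[of "fst j" "fst (snd j)" "snd (snd (snd j))"] evs_rel_words[of "fst j" "fst (snd j)" "snd (snd (snd j))"]
      J[OF that] by (metis prod.collapse)+
  have okA: "\<forall>t\<in>set ?A. ok_sword t" using \<Phi> ok_word_translate by (auto simp: norm_words_def)
  have okB: "\<forall>t\<in>set ?B. ok_sword t" using okJ(1) by auto
  have "evs ?B = \<zero>\<^bsub>R\<^esub>" using okJ by (intro evs_concat) auto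
  moreover have "balanced (?A @ (1, []) # ?B)" using assms by (simp add: certifies_def)
  then have "evs (?A @ (1, []) # ?B) = \<zero>\<^bsub>R\<^esub>"
    using okA okB by (intro evs_cancel balanced_count) auto
  ultimately have "evs ?A \<oplus>\<^bsub>R\<^esub> 1 \<star> ev [] = \<zero>\<^bsub>R\<^esub>"
    using okA okB sign_closed[OF ev_closed[of "[]"], of 1]
    by (simp add: evs_append evs_Cons)
  moreover have "ev [] = \<one>\<^bsub>R\<^esub>" by (simp add: ev_def)
  ultimately have "evs ?A \<oplus>\<^bsub>R\<^esub> \<ominus>\<^bsub>R\<^esub> \<one>\<^bsub>R\<^esub> = \<zero>\<^bsub>R\<^esub>" by (simp add: int_pow_sign_simps)
  then have "evs ?A = \<one>\<^bsub>R\<^esub>"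
    using evs_closed[of ?A] okA R.r_right_minus_eq[of "evs ?A" "\<one>\<^bsub>R\<^esub>"] by (simp add: a_minus_def)
  then show ?thesis using evs_norm_words[OF \<Phi>] by simp
qed

end

section \<open>The universal ring\<close>

text \<open>With concatenation as addition on words, \<open>'a list \<Rightarrow>\<^sub>0 int\<close> is the free ring on \<open>'a\<close>.\<close>

instantiation list :: (type) monoid_add
begin
definition zero_list :: "'a list" where "zero_list = []"
definition plus_list :: "'a list \<Rightarrow> 'a list \<Rightarrow> 'a list" where "plus_list = (@)"
instance by standard (simp_all add: zero_list_def plus_list_def)
end

type_synonym free = "(nat \<times> nat) list \<Rightarrow>\<^sub>0 int"

lemma frag_of_mult: "(frag_of u :: 'a list \<Rightarrow>\<^sub>0 int) * frag_of v = frag_of (u @ v)"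
  by (simp add: mult_single plus_list_def)

lemma frag_of_Nil: "frag_of [] = (1 :: 'a list \<Rightarrow>\<^sub>0 int)"
  by (simp add: zero_list_def flip: single_one)

definition sg :: "nat \<Rightarrow> free \<Rightarrow> free" where
  "sg c f = (if c = 2 then f else - f)"

definition sval :: "sword list \<Rightarrow> free" where
  "sval L = (\<Sum>t\<leftarrow>L. sg (fst t) (frag_of (snd t)))"

lemma sval_simps [simp]: "sval [] = 0" "sval (t # L) = sg (fst t) (frag_of (snd t)) + sval L"
  "sval (L @ M) = sval L + sval M"
  by (simp_all add: sval_def)

lemma lookup_sval:
  "\<forall>t\<in>set L. fst t = 1 \<or> fst t = 2 \<Longrightarrow>
     Poly_Mapping.lookup (sval L) w = int (count_list L (2, w)) - int (count_list L (1, w))"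
proof (induction L)
  case (Cons t L)
  then show ?case by (cases t) (auto simp: sg_def lookup_add)
qed simp

text \<open>Words form a basis of the free ring, and the coefficient of a word in
  \<open>sval L\<close> is the difference of its two counts.\<close>

lemma balanced_of_sval:
  assumes "\<forall>t\<in>set L. fst t = 1 \<or> fst t = 2" "sval L = 0"
  shows "balanced L"
proof -
  have "count_list L (2, w) = count_list L (1, w)" for w
    using lookup_sval[OF assms(1), of w] assms(2) by simp
  moreover have "count_list L y = length (filter (\<lambda>t. t = y) L)" for y by (induction L) auto
  ultimately show ?thesis by (simp add: balanced_def)
qed

section \<open>The free ring on the variables and its action\<close>

context nat_group
begin

abbreviation "W \<equiv> lists {l. letter_ok N m l}"
definition "C = {f :: free. Poly_Mapping.keys f \<subseteq> W}"
definition A :: "free ring" where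
  "A = \<lparr>carrier = C, monoid.mult = (*), one = 1, ring.zero = 0, ring.add = (+)\<rparr>"

lemma A_simps [simp]:
  "carrier A = C" "x \<otimes>\<^bsub>A\<^esub> y = x * y" "\<one>\<^bsub>A\<^esub> = 1" "\<zero>\<^bsub>A\<^esub> = 0" "x \<oplus>\<^bsub>A\<^esub> y = x + y"
  by (simp_all add: A_def)

lemma C_closed:
  "0 \<in> C" "1 \<in> C" "f \<in> C \<Longrightarrow> g \<in> C \<Longrightarrow> f + g \<in> C" "f \<in> C \<Longrightarrow> - f \<in> C"
  "f \<in> C \<Longrightarrow> g \<in> C \<Longrightarrow> f - g \<in> C" "f \<in> C \<Longrightarrow> g \<in> C \<Longrightarrow> f * g \<in> C" "frag_of w \<in> C \<longleftrightarrow> w \<in> W"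
proof -
  show w: "frag_of w \<in> C \<longleftrightarrow> w \<in> W" for w by (simp add: C_def)
  show "0 \<in> C" by (simp add: C_def)
  show "1 \<in> C" using w[of "[]"] by (simp add: frag_of_Nil)
  show add: "f \<in> C \<Longrightarrow> g \<in> C \<Longrightarrow> f + g \<in> C" for f g using keys_add[of f g] by (auto simp: C_def)
  show neg: "f \<in> C \<Longrightarrow> - f \<in> C" for f by (simp add: C_def)
  show "f \<in> C \<Longrightarrow> g \<in> C \<Longrightarrow> f - g \<in> C" using add[of f "- g"] neg[of g] by simp
  show "f \<in> C \<Longrightarrow> g \<in> C \<Longrightarrow> f * g \<in> C" using keys_mult[of f g] by (fastforce simp: C_def plus_list_def)
qed

lemma ring_A: "ring A"
proof (intro ringI abelian_groupI monoidI)
  show "\<exists>y\<in>carrier A. y \<oplus>\<^bsub>A\<^esub> x = \<zero>\<^bsub>A\<^esub>" if "x \<in> carrier A" for x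
    using that C_closed(4) by (intro bexI[of _ "- x"]) auto
qed (auto simp: C_closed algebra_simps)

sublocale A: ring A by (rule ring_A)

lemma a_inv_A: "f \<in> C \<Longrightarrow> \<ominus>\<^bsub>A\<^esub> f = - f"
  using A.minus_equality[of "- f" f] C_closed(4)[of f] by simp

lemma finsum_A: "finite U \<Longrightarrow> (\<And>i. i \<in> U \<Longrightarrow> F i \<in> C) \<Longrightarrow> (\<Oplus>\<^bsub>A\<^esub>i\<in>U. F i) = (\<Sum>i\<in>U. F i)"
proof (induction U rule: finite_induct)
  case (insert i U)
  then show ?case using A.finsum_insert[of U i F] by (auto simp: Pi_def)
qed simp

definition act :: "nat \<Rightarrow> free \<Rightarrow> free" where
  "act g = frag_extend (\<lambda>w. frag_of (translate m g w))"

lemma act_simps [simp]: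
  "act g 0 = 0" "act g (frag_of w) = frag_of (translate m g w)" "act g (a + b) = act g a + act g b"
  "act g (- a) = - act g a" "act g (a - b) = act g a - act g b" "act g 1 = 1"
proof -
  show "act g 1 = 1" by (simp add: act_def translate_def flip: frag_of_Nil)
qed (simp_all add: act_def frag_extend_add frag_extend_minus frag_extend_diff)

lemma act_sum: "act g (\<Sum>i\<in>U. F i) = (\<Sum>i\<in>U. act g (F i))"
  by (induction U rule: infinite_finite_induct) auto

lemma translate_append: "translate m g (u @ v) = translate m g u @ translate m g v"
  by (simp add: translate_def)

lemma act_mult: "act g (a * b) = act g a * act g b"
proof -
  have *: "act g (frag_of u * b) = frag_of (translate m g u) * act g b" for u
    by (rule frag_induction[of b UNIV]) (auto simp: frag_of_mult translate_append right_diff_distrib)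
  show ?thesis
    by (rule frag_induction[of a UNIV]) (auto simp: * left_diff_distrib)
qed

lemma translate_W: "g < N \<Longrightarrow> w \<in> W \<Longrightarrow> translate m g w \<in> W"
  using m_closed[of g] by (fastforce simp: translate_def letter_ok_def carrier)

lemma act_closed: "g < N \<Longrightarrow> f \<in> C \<Longrightarrow> act g f \<in> C"
  using keys_frag_extend[of "\<lambda>w. frag_of (translate m g w)" f] translate_W
  by (fastforce simp: act_def C_def)

lemma act_act:
  assumes g: "g < N" and h: "h < N" and f: "f \<in> C"
  shows "act (g \<otimes> h) f = act g (act h f)"
proof -
  have "translate m (g \<otimes> h) w = translate m g (translate m h w)" if "w \<in> W" for w
    using that g h by (auto simp: translate_def letter_ok_def carrier m_assoc)
  moreover have "Poly_Mapping.keys f \<subseteq> W" using f by (simp add: C_def)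
  ultimately show ?thesis by (rule_tac frag_induction[of f W]) auto
qed

lemma act_one:
  assumes f: "f \<in> C"
  shows "act \<one> f = f"
proof -
  have "translate m \<one> w = w" if "w \<in> W" for w
    using that by (auto simp: translate_def letter_ok_def carrier intro!: map_idI)
  moreover have "Poly_Mapping.keys f \<subseteq> W" using f by (simp add: C_def)
  ultimately show ?thesis by (rule_tac frag_induction[of f W]) auto
qed

lemma ring_action_A: "ring_action H A (\<lambda>g. restrict (act g) (carrier A))"
  by (rule ring_actionI[OF is_group ring_A])
    (auto simp: carrier act_one act_act act_mult act_closed intro!: ring_hom_memI)

section \<open>The ideal of relations\<close>

definition relator :: "nat \<Rightarrow> nat \<Rightarrow> free" where
  "relator g s = (\<Sum>h\<in>set_decode s. frag_of [(g \<otimes> h, s)]) - 1"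

definition ok_rel :: "rel \<Rightarrow> bool" where
  "ok_rel j \<longleftrightarrow> (fst j = 1 \<or> fst j = 2) \<and> fst (snd j) \<in> W \<and>
     letter_ok N m (fst (snd (snd j))) \<and> snd (snd (snd j)) \<in> W"

definition rsum :: "rel list \<Rightarrow> free" where
  "rsum J = sval (concat (map (\<lambda>j. rel_words N m j) J))"

lemma rsum_simps [simp]: "rsum [] = 0" "rsum (j # J) = sval (rel_words N m j) + rsum J" "rsum (J @ K) = rsum J + rsum K"
  by (simp_all add: rsum_def)

lemma sval_map_distinct:
  "distinct is \<Longrightarrow> sval (map (\<lambda>i. (c, F i)) is) = sg c (\<Sum>i\<in>set is. frag_of (F i))"
  by (induction "is") (auto simp: sg_def)

lemma sval_rel_words:
  assumes "ok_rel (c, u, (g, s), v)"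
  shows "sval (rel_words N m (c, u, (g, s), v)) = sg c (frag_of u * relator g s * frag_of v)"
proof -
  have s: "elab_code N m s" and c: "c = 1 \<or> c = 2" using assms by (auto simp: ok_rel_def letter_ok_def)
  have "frag_of u * relator g s * frag_of v =
      (\<Sum>h\<in>set_decode s. frag_of (u @ (g \<otimes> h, s) # v)) - frag_of (u @ v)"
    by (simp add: relator_def left_diff_distrib right_diff_distrib sum_distrib_left sum_distrib_right frag_of_mult)
  moreover have "sval (rel_words N m (c, u, (g, s), v)) =
      sg (3 - c) (frag_of (u @ v)) + sg c (\<Sum>h\<in>set_decode s. frag_of (u @ (g \<otimes> h, s) # v))"
    using elab_codeD(2)[OF s]
      sval_map_distinct[OF distinct_bits[of N s], of c "\<lambda>h. u @ (g \<otimes> h, s) # v"]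
    by (simp add: rel_words_def)
  ultimately show ?thesis using c by (auto simp: sg_def)
qed

lemma relator_closed: "letter_ok N m (g, s) \<Longrightarrow> relator g s \<in> C"
proof -
  assume l: "letter_ok N m (g, s)"
  then have g: "g < N" and s: "elab_code N m s" by (auto simp: letter_ok_def)
  have "frag_of [(g \<otimes> h, s)] \<in> C" if "h \<in> set_decode s" for h
    using that elab_codeD(2)[OF s] g s m_closed[of g h] by (auto simp: C_closed(7) letter_ok_def carrier set_bits)
  then have "(\<Sum>h\<in>U. frag_of [(g \<otimes> h, s)]) \<in> C" if "U \<subseteq> set_decode s" for U
    using that by (induction U rule: infinite_finite_induct) (auto simp: C_closed)
  then show ?thesis unfolding relator_def by (intro C_closed) auto
qed

text \<open>The ideal is defined as the set of values of certificates, so membership provides a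
  certificate at once. The ideal axioms then become operations on lists: concatenation, change of
  sign, extension of the outer words.\<close>

definition "I = {rsum J | J. \<forall>j\<in>set J. ok_rel j}"

text \<open>The common pattern of the closure properties: an additive map \<open>\<theta>\<close>
  that is realised by \<open>F\<close> on single relations is realised by mapping \<open>F\<close>
  over the certificate. It serves for negation, multiplication by words and the action.\<close>

lemma rsum_map:
  assumes "\<And>c u g s v. ok_rel (c, u, (g, s), v) \<Longrightarrow> ok_rel (F (c, u, (g, s), v)) \<and>
      sval (rel_words N m (F (c, u, (g, s), v))) = \<theta> (sg c (frag_of u * relator g s * frag_of v))"
    and "\<theta> 0 = 0" "\<And>a b. \<theta> (a + b) = \<theta> a + \<theta> b" and J: "\<forall>j\<in>set J. ok_rel j"
  shows "(\<forall>j\<in>set (map F J). ok_rel j) \<and> rsum (map F J) = \<theta> (rsum J)"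
  using J
proof (induction J)
  case (Cons j J)
  obtain c u g s v where j: "j = (c, u, (g, s), v)" by (metis prod.collapse)
  then have "ok_rel (c, u, (g, s), v)" using Cons.prems by simp
  from assms(1)[OF this] sval_rel_words[OF this] Cons show ?case by (simp add: assms(3) j)
qed (simp add: assms(2))

lemma I_neg: "a \<in> I \<Longrightarrow> - a \<in> I"
proof -
  assume "a \<in> I"
  then obtain J where J: "\<forall>j\<in>set J. ok_rel j" "a = rsum J" by (auto simp: I_def)
  define F :: "rel \<Rightarrow> rel" where "F j = (3 - fst j, snd j)" for j
  have "(\<forall>j\<in>set (map F J). ok_rel j) \<and> rsum (map F J) = - rsum J"
  proof (rule rsum_map[OF _ _ _ J(1)])
    fix c u g s v assume ok: "ok_rel (c, u, (g, s), v)"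
    then have "ok_rel (3 - c, u, (g, s), v)" by (auto simp: ok_rel_def)
    from sval_rel_words[OF this] this ok show "ok_rel (F (c, u, (g, s), v)) \<and>
        sval (rel_words N m (F (c, u, (g, s), v))) = - sg c (frag_of u * relator g s * frag_of v)"
      by (auto simp: F_def sg_def ok_rel_def)
  qed auto
  then show ?thesis unfolding I_def using J(2) by (intro CollectI exI[of _ "map F J"]) simp
qed

lemma I_add: "a \<in> I \<Longrightarrow> b \<in> I \<Longrightarrow> a + b \<in> I"
proof -
  assume "a \<in> I" "b \<in> I"
  then obtain J K where "\<forall>j\<in>set J. ok_rel j" "a = rsum J" "\<forall>j\<in>set K. ok_rel j" "b = rsum K" by (auto simp: I_def)
  then show ?thesis unfolding I_def by (intro CollectI exI[of _ "J @ K"]) auto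
qed

lemma I_zero: "0 \<in> I" unfolding I_def by (intro CollectI exI[of _ "[]"]) auto

lemma I_mult_word:
  assumes "a \<in> I" "p \<in> W" "q \<in> W"
  shows "frag_of p * a * frag_of q \<in> I"
proof -
  obtain J where J: "\<forall>j\<in>set J. ok_rel j" "a = rsum J" using assms(1) by (auto simp: I_def)
  define F :: "rel \<Rightarrow> rel" where "F j = (fst j, p @ fst (snd j), fst (snd (snd j)), snd (snd (snd j)) @ q)" for j
  have "(\<forall>j\<in>set (map F J). ok_rel j) \<and> rsum (map F J) = frag_of p * rsum J * frag_of q"
  proof (rule rsum_map[where \<theta> = "\<lambda>a. frag_of p * a * frag_of q", OF _ _ _ J(1)])
    fix c u g s v assume ok: "ok_rel (c, u, (g, s), v)"
    then have "ok_rel (c, p @ u, (g, s), v @ q)" using assms(2,3) by (auto simp: ok_rel_def)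
    from sval_rel_words[OF this] this show "ok_rel (F (c, u, (g, s), v)) \<and>
        sval (rel_words N m (F (c, u, (g, s), v))) = frag_of p * sg c (frag_of u * relator g s * frag_of v) * frag_of q"
      by (simp add: F_def sg_def mult.assoc flip: frag_of_mult)
  qed (simp_all add: distrib_left distrib_right)
  then show ?thesis unfolding I_def using J(2) by (intro CollectI exI[of _ "map F J"]) simp
qed

lemma I_act:
  assumes "a \<in> I" "k < N"
  shows "act k a \<in> I"
proof -
  obtain J where J: "\<forall>j\<in>set J. ok_rel j" "a = rsum J" using assms(1) by (auto simp: I_def)
  define F :: "rel \<Rightarrow> rel" where "F j = (fst j, translate m k (fst (snd j)),
    (k \<otimes> fst (fst (snd (snd j))), snd (fst (snd (snd j)))), translate m k (snd (snd (snd j))))" for j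
  have "(\<forall>j\<in>set (map F J). ok_rel j) \<and> rsum (map F J) = act k (rsum J)"
  proof (rule rsum_map[where \<theta> = "act k", OF _ _ _ J(1)])
    fix c u g s v assume ok: "ok_rel (c, u, (g, s), v)"
    then have l: "g < N" "elab_code N m s" by (auto simp: ok_rel_def letter_ok_def)
    have ok': "ok_rel (c, translate m k u, (k \<otimes> g, s), translate m k v)"
    proof -
      have "letter_ok N m (k \<otimes> g, s)"
        using l assms(2) m_closed[of k g] by (simp add: letter_ok_def carrier)
      then show ?thesis using ok translate_W[OF assms(2)] unfolding ok_rel_def fst_conv snd_conv by blast
    qed
    have "(k \<otimes> g) \<otimes> h = k \<otimes> (g \<otimes> h)" if "h \<in> set_decode s" for h
      using that elab_codeD(2)[OF l(2)] l(1) assms(2) by (intro m_assoc) (auto simp: carrier set_bits)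
    \<comment> \<open>A translate of a relator is again a relator. To have this, the relators
      include a group element, and it makes the ideal stable under the action.\<close>
    then have "relator (k \<otimes> g) s = act k (relator g s)"
      by (simp add: relator_def act_sum translate_def)
    with sval_rel_words[OF ok'] ok' show "ok_rel (F (c, u, (g, s), v)) \<and>
        sval (rel_words N m (F (c, u, (g, s), v))) = act k (sg c (frag_of u * relator g s * frag_of v))"
      by (simp add: F_def sg_def act_mult)
  qed simp_all
  then show ?thesis unfolding I_def using J(2) by (intro CollectI exI[of _ "map F J"]) simp
qed

text \<open>\<open>C\<close> is spanned by words, so multiplication by words and closure under
  differences suffice.\<close>

lemma I_mult:
  assumes a: "a \<in> I" and f: "f \<in> C"
  shows "f * a \<in> I" "a * f \<in> I"
proof -
  have sub: "x - y \<in> I" if "x \<in> I" "y \<in> I" for x y using I_add[OF that(1) I_neg[OF that(2)]] by simp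
  have word: "frag_of w * a \<in> I" "a * frag_of w \<in> I" if "w \<in> W" for w
    using I_mult_word[OF a that, of "[]"] I_mult_word[OF a _ that, of "[]"] by (simp_all add: frag_of_Nil)
  have f: "Poly_Mapping.keys f \<subseteq> W" using f by (simp add: C_def)
  show "f * a \<in> I"
    by (rule frag_induction[OF f]) (use word in \<open>auto simp: I_zero left_diff_distrib sub\<close>)
  show "a * f \<in> I"
    by (rule frag_induction[OF f]) (use word in \<open>auto simp: I_zero right_diff_distrib sub\<close>)
qed

lemma I_C: "a \<in> I \<Longrightarrow> a \<in> C"
proof -
  have "(\<forall>j\<in>set J. ok_rel j) \<Longrightarrow> rsum J \<in> C" for J
  proof (induction J)
    case (Cons j J)
    obtain c u g s v where j: "j = (c, u, (g, s), v)" by (metis prod.collapse)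
    then have ok: "ok_rel (c, u, (g, s), v)" using Cons.prems by simp
    then have "frag_of u * relator g s * frag_of v \<in> C"
      by (intro C_closed relator_closed) (auto simp: ok_rel_def C_closed(7))
    then have "sval (rel_words N m j) \<in> C" using sval_rel_words[OF ok] by (simp add: j sg_def C_closed)
    then show ?case using Cons by (simp add: C_closed)
  qed (simp add: C_closed)
  then show "a \<in> I \<Longrightarrow> a \<in> C" by (auto simp: I_def)
qed

lemma ideal_I: "ideal I A"
proof (rule idealI[OF ring_A])
  show "subgroup I (add_monoid A)"
  proof (rule A.add.subgroupI)
    show "\<ominus>\<^bsub>A\<^esub> a \<in> I" if "a \<in> I" for a
      using that a_inv_A[OF I_C[OF that]] I_neg by simp
  qed (use I_C I_zero I_add in auto)
qed (auto simp: I_mult)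

sublocale I: ideal I A by (rule ideal_I)

end

section \<open>The quotient by the ideal and the completeness of certificates\<close>

context nat_group
begin

abbreviation "Q \<equiv> A Quot I"
abbreviation \<pi> :: "free \<Rightarrow> free set" where "\<pi> f \<equiv> I +>\<^bsub>A\<^esub> f"

sublocale P: ring_hom_ring A Q \<pi> by (rule I.rcos_ring_hom_ring)

lemma carrier_Q: "carrier Q = \<pi> ` C"
  by (auto simp: FactRing_def A_RCOSETS_def')

lemma \<pi>_eq_iff:
  assumes f: "f \<in> C" and g: "g \<in> C"
  shows "\<pi> f = \<pi> g \<longleftrightarrow> f - g \<in> I"
proof -
  have zero: "\<pi> h = \<zero>\<^bsub>Q\<^esub> \<longleftrightarrow> h \<in> I" if "h \<in> C" for h
    using I.a_rcos_const[of h] I.a_rcos_self[of h] that by (auto simp: FactRing_def)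
  have "\<pi> (f - g) = \<pi> f \<ominus>\<^bsub>Q\<^esub> \<pi> g"
  proof -
    have "\<pi> (f + - g) = \<pi> f \<oplus>\<^bsub>Q\<^esub> \<pi> (- g)" using P.hom_add[of f "- g"] f g C_closed(4) by simp
    moreover have "\<pi> (- g) = \<ominus>\<^bsub>Q\<^esub> \<pi> g" using P.hom_a_inv[of g] g a_inv_A by simp
    ultimately show ?thesis by (simp add: a_minus_def)
  qed
  then show ?thesis
    using zero[OF C_closed(5)[OF f g]] P.S.r_right_minus_eq[of "\<pi> f" "\<pi> g"] P.hom_closed f g by simp
qed

text \<open>The action on cosets is given by images of sets, so \<open>act g\<close> has to map
  \<open>I\<close> onto itself and not merely into itself; the action of the inverse of
  \<open>g\<close> provides this.\<close>

lemma act_coset: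
  assumes g: "g < N" and f: "f \<in> C"
  shows "act g ` \<pi> f = \<pi> (act g f)"
proof -
  have coset: "\<pi> h = (\<lambda>i. i + h) ` I" for h by (auto simp: a_r_coset_def')
  have "act g ` I = I"
  proof (intro equalityI subsetI)
    fix i assume i: "i \<in> I"
    have gH: "g \<in> carrier H" and ginv: "inv g < N" using g inv_closed[of g] by (simp_all add: carrier)
    have "i = act g (act (inv g) i)"
      using act_act[OF g ginv I_C[OF i]] act_one[OF I_C[OF i]] gH by simp
    then show "i \<in> act g ` I" using I_act[OF i ginv] by blast
  qed (use I_act g in auto)
  then have "(\<lambda>i. i + act g f) ` I = (\<lambda>i. i + act g f) ` act g ` I" by simp
  then show ?thesis by (simp add: coset image_image)
qed

definition act_Q :: "nat \<Rightarrow> free set \<Rightarrow> free set" where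
  "act_Q g = restrict (\<lambda>Y. act g ` Y) (carrier Q)"

lemma act_Q: "g < N \<Longrightarrow> f \<in> C \<Longrightarrow> act_Q g (\<pi> f) = \<pi> (act g f)"
  by (simp add: act_Q_def carrier_Q act_coset)

lemma ring_action_Q: "ring_action H Q act_Q"
  unfolding act_Q_def
proof (rule ring_actionI[OF is_group P.S.ring_axioms])
  fix g assume "g \<in> carrier H"
  then have g: "g < N" by (simp add: carrier)
  show "(`) (act g) \<in> ring_hom Q Q"
  proof (rule ring_hom_memI)
    fix Y Z assume "Y \<in> carrier Q" "Z \<in> carrier Q"
    then obtain a b where ab: "a \<in> C" "b \<in> C" "Y = \<pi> a" "Z = \<pi> b" by (auto simp: carrier_Q)
    show "act g ` Y \<in> carrier Q" using ab g by (simp add: act_coset act_closed carrier_Q)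
    show "act g ` (Y \<otimes>\<^bsub>Q\<^esub> Z) = act g ` Y \<otimes>\<^bsub>Q\<^esub> act g ` Z"
      using P.hom_mult[of a b, symmetric] P.hom_mult[of "act g a" "act g b", symmetric] ab g
      by (simp add: act_coset act_closed act_mult C_closed)
    show "act g ` (Y \<oplus>\<^bsub>Q\<^esub> Z) = act g ` Y \<oplus>\<^bsub>Q\<^esub> act g ` Z"
      using P.hom_add[of a b, symmetric] P.hom_add[of "act g a" "act g b", symmetric] ab g
      by (simp add: act_coset act_closed C_closed)
  next
    show "act g ` \<one>\<^bsub>Q\<^esub> = \<one>\<^bsub>Q\<^esub>" using P.hom_one act_coset[OF g, of 1] C_closed(2) by simp
  qed
next
  fix Y assume "Y \<in> carrier Q"
  then obtain f where f: "f \<in> C" "Y = \<pi> f" by (auto simp: carrier_Q)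
  show "act \<one> ` Y = Y" using f one_closed by (simp add: act_coset act_one carrier)
  fix g h assume "g \<in> carrier H" "h \<in> carrier H"
  then have "g < N" "h < N" "g \<otimes> h < N" using m_closed[of g h] by (simp_all add: carrier)
  then show "act (g \<otimes> h) ` Y = act g ` act h ` Y" using f by (simp add: act_coset act_closed act_act)
qed

lemma Nrm_Q:
  assumes U: "U \<subseteq> carrier H" and f: "f \<in> C"
  shows "Nrm Q act_Q U (\<pi> f) = \<pi> (\<Sum>g\<in>U. act g f)"
proof -
  have fC: "f \<in> carrier A" using f by simp
  have U': "g < N" if "g \<in> U" for g using that U by (auto simp: carrier)
  have fin: "finite U" using U finite_subset by (auto simp: carrier)
  have eq: "\<pi> (restrict (act g) (carrier A) y) = act_Q g (\<pi> y)"
    if "g \<in> carrier H" "y \<in> carrier A" for g y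
    using that by (simp add: act_Q carrier)
  have "Nrm A (\<lambda>g. restrict (act g) (carrier A)) U f = (\<Sum>g\<in>U. act g f)"
    unfolding Nrm_def using f act_closed U' by (simp add: finsum_A[OF fin])
  then show ?thesis
    using hom_Nrm(2)[where \<psi> = act_Q, OF P.ring_hom_ring_axioms ring_action_A U fC eq] by (simp add: restrict_def)
qed

lemma sum_C: "(\<And>i. i \<in> U \<Longrightarrow> F i \<in> C) \<Longrightarrow> (\<Sum>i\<in>U. F i) \<in> C"
  by (induction U rule: infinite_finite_induct) (auto simp: C_closed)

text \<open>The witness is the class of the variable \<open>1(x_E)\<close>: its norm minus 1 is the
  relator with trivial \<open>g\<close>.\<close>

lemma has_norm_one_Q:
  assumes E: "E \<in> elem_ab_subgroups H"
  shows "has_norm_one Q act_Q E"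
proof -
  let ?s = "set_encode E"
  note s = elab_code_set_encode[OF E]
  have EH: "E \<subseteq> carrier H" using E elem_ab_subgroups_iff subgroup.subset by blast
  have one: "\<one> < N" using one_closed by (simp add: carrier)
  then have l: "letter_ok N m (\<one>, ?s)" using s(1) by (simp add: letter_ok_def)
  then have x: "frag_of [(\<one>, ?s)] \<in> C" by (simp add: C_closed(7))
  have "(\<Sum>g\<in>E. act g (frag_of [(\<one>, ?s)])) = relator \<one> ?s + 1"
    using EH by (auto simp: relator_def s(2) translate_def intro!: sum.cong)
  moreover have "relator \<one> ?s \<in> I"
  proof -
    have ok: "ok_rel (2, [], (\<one>, ?s), [])" using l by (simp add: ok_rel_def)
    have "relator \<one> ?s = rsum [(2, [], (\<one>, ?s), [])]"
      using sval_rel_words[OF ok] by (simp add: sg_def frag_of_Nil)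
    then show ?thesis unfolding I_def using ok by (intro CollectI exI[of _ "[(2, [], (\<one>, ?s), [])]"]) auto
  qed
  then have "\<pi> (relator \<one> ?s + 1) = \<pi> 1"
    using I_C by (subst \<pi>_eq_iff) (auto simp: C_closed)
  ultimately have "Nrm Q act_Q E (\<pi> (frag_of [(\<one>, ?s)])) = \<one>\<^bsub>Q\<^esub>"
    using Nrm_Q[OF EH x] P.hom_one by simp
  then show ?thesis unfolding has_norm_one_def using x by (auto simp: carrier_Q)
qed

lemma sval_surj:
  assumes "f \<in> C"
  shows "\<exists>\<Phi>. (\<forall>t\<in>set \<Phi>. (fst t = 1 \<or> fst t = 2) \<and> snd t \<in> W) \<and> f = sval \<Phi>"
proof -
  have "Poly_Mapping.keys f \<subseteq> W" using assms by (simp add: C_def)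
  then show ?thesis
  proof (induction rule: frag_induction)
    case zero then show ?case by (intro exI[of _ "[]"]) simp
  next
    case (one w) then show ?case by (intro exI[of _ "[(2, w)]"]) (simp add: sg_def)
  next
    case (diff a b)
    then obtain \<Phi> \<Psi> where
      \<Phi>: "\<forall>t\<in>set \<Phi>. (fst t = 1 \<or> fst t = 2) \<and> snd t \<in> W" "a = sval \<Phi>" and
      \<Psi>: "\<forall>t\<in>set \<Psi>. (fst t = 1 \<or> fst t = 2) \<and> snd t \<in> W" "b = sval \<Psi>" by blast
    have "sval (map (\<lambda>t. (3 - fst t, snd t)) \<Psi>) = - sval \<Psi>"
      using \<Psi>(1) by (induction \<Psi>) (auto simp: sg_def)
    then show ?case using \<Phi> \<Psi> by (intro exI[of _ "\<Phi> @ map (\<lambda>t. (3 - fst t, snd t)) \<Psi>"]) auto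
  qed
qed

lemma sval_norm_words: "sval (norm_words N m \<Phi>) = (\<Sum>g<N. act g (sval \<Phi>))"
proof (induction \<Phi>)
  case (Cons t \<Phi>)
  have "sval (map (\<lambda>g. (c, translate m g w)) [0..<N]) = (\<Sum>g<N. act g (sg c (frag_of w)))" for c w
  proof -
    have "sval (map (\<lambda>g. (c, translate m g w)) [0..<N]) = sg c (\<Sum>g<N. frag_of (translate m g w))"
      by (subst sval_map_distinct) (auto simp: lessThan_atLeast0)
    then show ?thesis by (simp add: sg_def sum_negf)
  qed
  then show ?case using Cons by (simp add: norm_words_def sum.distrib)
qed (simp add: norm_words_def)

text \<open>The hypothesis yields an element of norm one in \<open>Q\<close>. For a representative
  \<open>f\<close> in the free ring, the norm of \<open>f\<close> minus 1 lies in \<open>I\<close>,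
  and by the form of \<open>I\<close> this is a certificate.\<close>

theorem certifies_complete:
  assumes "detects TYPE(free set) H"
  shows "\<exists>\<Phi> J. certifies N m \<Phi> J"
proof -
  have "has_norm_one Q act_Q (carrier H)"
    using assms ring_action_Q has_norm_one_Q by (auto simp: detects_def)
  then obtain f where f: "f \<in> C" "Nrm Q act_Q (carrier H) (\<pi> f) = \<one>\<^bsub>Q\<^esub>"
    by (auto simp: has_norm_one_def carrier_Q)
  obtain \<Phi> where \<Phi>: "\<forall>t\<in>set \<Phi>. (fst t = 1 \<or> fst t = 2) \<and> snd t \<in> W" "f = sval \<Phi>"
    using sval_surj[OF f(1)] by blast
  have sumC: "(\<Sum>g<N. act g f) \<in> C" using f(1) act_closed by (intro sum_C) simp
  have "\<pi> (\<Sum>g<N. act g f) = \<pi> 1" using Nrm_Q[OF subset_refl f(1)] f(2) P.hom_one by (simp add: carrier)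
  then have "(\<Sum>g<N. act g f) - 1 \<in> I" using \<pi>_eq_iff[OF sumC C_closed(2)] by simp
  \<comment> \<open>The sign is reversed because \<open>certifies\<close> adds the relations to the
    norm minus 1, so they have to sum to its negative.\<close>
  from I_neg[OF this] obtain J where J: "\<forall>j\<in>set J. ok_rel j" "1 - (\<Sum>g<N. act g f) = rsum J"
    by (auto simp: I_def)
  let ?L = "norm_words N m \<Phi> @ (1, []) # concat (map (\<lambda>j. rel_words N m j) J)"
  have "sval ?L = (\<Sum>g<N. act g f) + (- 1 + rsum J)"
    by (simp add: sval_norm_words \<Phi>(2)[symmetric] sg_def frag_of_Nil rsum_def)
  also have "\<dots> = 0" unfolding J(2)[symmetric] by simp
  finally have "sval ?L = 0" .
  moreover have "\<forall>t\<in>set ?L. fst t = 1 \<or> fst t = 2"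
    using \<Phi>(1) J(1) by (auto simp: norm_words_def rel_words_def ok_rel_def)
  ultimately have "balanced ?L" by (intro balanced_of_sval)
  then have "certifies N m \<Phi> J"
    unfolding certifies_def using \<Phi>(1) J(1) by (auto simp: ok_rel_def)
  then show ?thesis by blast
qed

end

section \<open>Coding\<close>

text \<open>Signs become integers by \<open>int_decode\<close> and subgroups become sets by
  \<open>set_decode\<close>, so the number found by the search is already the code of this
  expression and the program has nothing left to compute.\<close>

definition lift_expr :: "'g list \<Rightarrow> sword list \<Rightarrow> 'g poly_expr" where
  "lift_expr zs \<Phi> = map (\<lambda>(c, w). (int_decode c, map (\<lambda>(g, s). (zs ! g, (!) zs ` set_decode s)) w)) \<Phi>"

lemma pos_nth: "distinct zs \<Longrightarrow> i < length zs \<Longrightarrow> pos zs (zs ! i) = i"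
proof -
  assume d: "distinct zs" and i: "i < length zs"
  have "takeWhile (\<lambda>y. y \<noteq> zs ! i) zs = take i zs"
    using d i by (intro takeWhile_eq_take_P_nth) (auto simp: nth_eq_iff_index_eq)
  then show ?thesis using i by (simp add: pos_def)
qed

locale nat_group_copy = nat_group H N for H :: "nat monoid" (structure) and N +
  fixes G :: "('g, 'm) monoid_scheme" and zs :: "'g list"
  assumes G: "group G" and zs: "distinct zs" "length zs = N" and iso: "(!) zs \<in> iso H G"
begin

lemma elab_image:
  assumes "E \<in> elem_ab_subgroups H"
  shows "(!) zs ` E \<in> elem_ab_subgroups G"
proof -
  have inj: "inj_on ((!) zs) (carrier H)" and im: "(!) zs ` carrier H = carrier G"
    using iso by (auto simp: iso_def bij_betw_def)
  have fin: "finite (carrier G)" using im carrier by (metis finite_imageI finite_lessThan)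
  have EH: "E \<subseteq> carrier H" using assms elem_ab_subgroups_iff subgroup.subset by blast
  \<comment> \<open>The image under an isomorphism is the preimage under its inverse, which reduces
    the claim to the known case of preimages.\<close>
  have "{g \<in> carrier G. inv_into (carrier H) ((!) zs) g \<in> E} = (!) zs ` E"
    using EH inj by (auto simp: im[symmetric] inv_into_f_f subset_iff)
  then show ?thesis
    using elem_ab_subgroups_preimage_iso[OF G fin is_group iso_set_sym[OF iso] assms] by simp
qed

lemma expr_over_lift:
  assumes "\<forall>t\<in>set \<Phi>. \<forall>l\<in>set (snd t). letter_ok N m l"
  shows "expr_over G (lift_expr zs \<Phi>)"
proof -
  have "zs ! g \<in> carrier G \<and> (!) zs ` set_decode s \<in> elem_ab_subgroups G" if "letter_ok N m (g, s)" for g s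
    using that elab_image[OF elab_codeD(1)] iso by (auto simp: letter_ok_def carrier iso_def bij_betw_def)
  then show ?thesis using assms by (fastforce simp: expr_over_def lift_expr_def)
qed

lemma code_lift:
  assumes "\<forall>t\<in>set \<Phi>. \<forall>l\<in>set (snd t). letter_ok N m l"
  shows "code_expr zs (lift_expr zs \<Phi>) = enc \<Phi>"
proof -
  have "pos zs (zs ! g) = g \<and> set_encode (pos zs ` (!) zs ` set_decode s) = s" if "letter_ok N m (g, s)" for g s
  proof -
    have g: "g < N" and s: "elab_code N m s" using that by (auto simp: letter_ok_def)
    have "pos zs (zs ! i) = i" if "i \<in> set_decode s" for i
      using that elab_codeD(2)[OF s] by (intro pos_nth) (auto simp: zs set_bits)
    then have "pos zs ` (!) zs ` set_decode s = set_decode s" by (simp add: image_image)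
    then show ?thesis using g by (simp add: pos_nth zs)
  qed
  then have w: "map (\<lambda>(g, E). prod_encode (pos zs g, set_encode (pos zs ` E)))
      (map (\<lambda>(g, s). (zs ! g, (!) zs ` set_decode s)) w) = map enc w"
    if "\<forall>l\<in>set w. letter_ok N m l" for w
    using that by (auto simp: enc_prod_def)
  have "enc t = prod_encode (fst t, list_encode (map enc (snd t)))" for t :: sword
    by (simp add: enc_prod_def enc_list_def)
  then have "map enc \<Phi> = map (\<lambda>t. prod_encode (fst t, list_encode (map enc (snd t)))) \<Phi>"
    by (intro map_cong refl)
  then have "enc \<Phi> = list_encode (map (\<lambda>t. prod_encode (fst t, list_encode (map enc (snd t)))) \<Phi>)"
    unfolding enc_list_def[of \<Phi>] by (rule arg_cong)
  moreover have "code_expr zs (lift_expr zs \<Phi>) =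
      list_encode (map (\<lambda>t. prod_encode (fst t, list_encode (map enc (snd t)))) \<Phi>)"
    unfolding code_expr_def lift_expr_def map_map
    using assms by (intro arg_cong[where f = list_encode] map_cong refl) (auto simp: w simp del: map_map)
  ultimately show ?thesis by simp
qed

theorem is_formula_lift:
  assumes cert: "certifies N m \<Phi> J"
  shows "is_formula G (lift_expr zs \<Phi>)"
proof -
  have \<Phi>: "\<forall>t\<in>set \<Phi>. \<forall>l\<in>set (snd t). letter_ok N m l" using cert by (auto simp: certifies_def)
  have inj: "inj_on ((!) zs) (carrier H)" and im: "(!) zs ` carrier H = carrier G"
    using iso by (auto simp: iso_def bij_betw_def)
  have "Nrm R \<phi> (carrier G) (eval_expr R \<phi> y (lift_expr zs \<Phi>)) = \<one>\<^bsub>R\<^esub>"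
    if act: "ring_action G R \<phi>"
      and y: "\<forall>E\<in>elem_ab_subgroups G. y E \<in> carrier R \<and> Nrm R \<phi> E (y E) = \<one>\<^bsub>R\<^esub>"
    for R :: "nat ring" and \<phi> y
  proof -
    note D = ring_actionD[OF act]
    interpret R: ring R by (rule D(2))
    \<comment> \<open>The action of \<open>G\<close> read on indices. \<open>\<rho>\<close> is its
      extensional version, and \<open>x\<close> assigns to a code the element given for the
      corresponding subgroup of \<open>G\<close>.\<close>
    define \<psi> where "\<psi> g = \<phi> (zs ! g)" for g
    define \<rho> where "\<rho> = (\<lambda>g. restrict (\<psi> g) (carrier R))"
    define x where "x s = y ((!) zs ` set_decode s)" for s
    have gG: "zs ! g \<in> carrier G" if "g \<in> carrier H" for g using that im by blast
    have Nrm: "Nrm R \<psi> U z = Nrm R \<phi> ((!) zs ` U) z" if "U \<subseteq> carrier H" "z \<in> carrier R" for U z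
      unfolding Nrm_def \<psi>_def using that D(4) gG inj_on_subset[OF inj that(1)]
      by (intro R.finsum_reindex[symmetric]) auto
    have Nrm\<rho>: "Nrm R \<rho> U z = Nrm R \<psi> U z" if "U \<subseteq> carrier H" "z \<in> carrier R" for U z
      unfolding \<rho>_def using that D(2,4) gG by (intro Nrm_restrict) (auto simp: \<psi>_def)
    have actH: "ring_action H R \<rho>"
    unfolding \<rho>_def
    proof (rule ring_actionI[OF is_group D(2)])
      have "zs ! \<one> = \<one>\<^bsub>G\<^esub>" using iso G is_group by (simp add: iso_def hom_one)
      then show "\<psi> \<one> z = z" if "z \<in> carrier R" for z using that D(5) by (simp add: \<psi>_def)
      show "\<psi> (g \<otimes> h) z = \<psi> g (\<psi> h z)" if "g \<in> carrier H" "h \<in> carrier H" "z \<in> carrier R" for g h z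
      proof -
        have "zs ! (g \<otimes> h) = zs ! g \<otimes>\<^bsub>G\<^esub> zs ! h"
          using iso that by (intro hom_mult[of "(!) zs" H G]) (auto simp: iso_def)
        then show ?thesis using that D(6) gG by (simp add: \<psi>_def)
      qed
    qed (use D(3) gG in \<open>auto simp: \<psi>_def\<close>)
    have x: "x s \<in> carrier R" "Nrm R \<rho> (set_decode s) (x s) = \<one>\<^bsub>R\<^esub>"
      if s: "elab_code N m s" for s
    proof -
      have y': "y ((!) zs ` set_decode s) \<in> carrier R" "Nrm R \<phi> ((!) zs ` set_decode s) (y ((!) zs ` set_decode s)) = \<one>\<^bsub>R\<^esub>"
        using y elab_image[OF elab_codeD(1)[OF s]] by auto
      show xR: "x s \<in> carrier R" using y'(1) by (simp add: x_def)
      have sub: "set_decode s \<subseteq> carrier H" using elab_codeD(2)[OF s] by (auto simp: carrier set_bits)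
      show "Nrm R \<rho> (set_decode s) (x s) = \<one>\<^bsub>R\<^esub>"
        using Nrm[OF sub xR] y'(2) Nrm\<rho>[OF sub xR] by (simp add: x_def)
    qed
    interpret S: nat_group_action H N R \<rho> x
      by unfold_locales (use actH x in auto)
    have w: "eval_word R \<phi> y (map (\<lambda>(g, s). (zs ! g, (!) zs ` set_decode s)) w) = S.ev w"
      if "\<forall>l\<in>set w. letter_ok N m l" for w
      using that
    proof (induction w)
      case Nil then show ?case by (simp add: eval_word_def S.ev_def)
    next
      case (Cons l w)
      obtain g s where l: "l = (g, s)" by fastforce
      then have "x s \<in> carrier R" using Cons.prems by (intro x(1)) (simp add: letter_ok_def)
      then have "\<rho> g (x s) = \<phi> (zs ! g) (y ((!) zs ` set_decode s))"
        by (simp add: \<rho>_def \<psi>_def x_def)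
      moreover have "eval_word R \<phi> y (map (\<lambda>(g, s). (zs ! g, (!) zs ` set_decode s)) w) = S.ev w"
        using Cons by simp
      ultimately show ?case by (simp add: eval_word_def S.ev_def l)
    qed
    have "eval_expr R \<phi> y (lift_expr zs \<Phi>) = S.evs \<Phi>"
      using \<Phi> by (induction \<Phi>) (auto simp: eval_expr_def S.evs_def lift_expr_def w)
    moreover have eR: "S.evs \<Phi> \<in> carrier R" using \<Phi> by (intro S.evs_closed)
    ultimately show ?thesis
      using S.certifies_sound[OF cert] Nrm[OF subset_refl eR] Nrm\<rho>[OF subset_refl eR] im by (simp add: carrier)
  qed
  then have "valid_in R G (lift_expr zs \<Phi>)" for R :: "nat ring" by (simp add: valid_in_def)
  then show ?thesis using expr_over_lift[OF \<Phi>] by (simp add: is_formula_def)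
qed

end

lemma code_group_enc: "code_group xs G = enc (map (\<lambda>x. map (\<lambda>y. pos xs (x \<otimes>\<^bsub>G\<^esub> y)) xs) xs)"
proof -
  have "enc ns = list_encode ns" for ns :: "nat list" by (simp add: enc_list_def map_idI)
  then show ?thesis by (simp add: code_group_def enc_list_def[where 'a = "nat list"] o_def)
qed

lemma pos_less: "x \<in> set xs \<Longrightarrow> pos xs x < length xs" "x \<in> set xs \<Longrightarrow> xs ! pos xs x = x"
  unfolding pos_def
  by (induction xs) auto

text \<open>The indexing of pairs is injective and turns the table into the product, so the group
  laws of \<open>H\<close> are pulled back along it.\<close>

lemma nat_group_copy_product:
  fixes G1 :: "'a monoid" and G2 :: "'b monoid"
  assumes G1: "group G1" and G2: "group G2" and xs: "enumerates xs G1" and ys: "enumerates ys G2"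
    and s: "s = map (\<lambda>x. map (\<lambda>y. pos xs (x \<otimes>\<^bsub>G1\<^esub> y)) xs) xs"
    and t: "t = map (\<lambda>x. map (\<lambda>y. pos ys (x \<otimes>\<^bsub>G2\<^esub> y)) ys) ys"
  obtains H :: "nat monoid" where
    "nat_group_copy H (length s * length t) (G1 \<times>\<times> G2) (List.product xs ys)"
    "\<And>i j. monoid.mult H i j = table_mult s t i j"
proof -
  let ?G = "G1 \<times>\<times> G2" and ?zs = "List.product xs ys" and ?N = "length s * length t" and ?m = "table_mult s t"
  interpret G1: group G1 by fact
  interpret G2: group G2 by fact
  interpret G: group ?G by (intro DirProd_group G1 G2)
  have set: "set xs = carrier G1" "set ys = carrier G2" and dist: "distinct xs" "distinct ys"
    using xs ys by (auto simp: enumerates_def)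
  have len: "length s = length xs" "length t = length ys" "length ?zs = ?N" by (simp_all add: s t)
  have setz: "set ?zs = carrier ?G" using set by auto
  have distz: "distinct ?zs" using dist by (rule distinct_product)
  \<comment> \<open>\<open>List.product\<close> runs fastest through the second factor, and
    \<open>table_mult\<close> splits an index into quotient and remainder accordingly.\<close>
  have nthz: "?zs ! k = (xs ! (k div length ys), ys ! (k mod length ys))" if "k < ?N" for k
    using that by (intro product_nth) (simp add: s t)
  have mult: "?m i j < ?N \<and> ?zs ! ?m i j = ?zs ! i \<otimes>\<^bsub>?G\<^esub> ?zs ! j" if i: "i < ?N" and j: "j < ?N" for i j
  proof -
    have l: "0 < length ys" using i by (cases ys) (auto simp: t)
    have d: "i div length ys < length xs" "j div length ys < length xs"
      using i j l by (simp_all add: s t less_mult_imp_div_less)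
    have r: "i mod length ys < length ys" "j mod length ys < length ys" using l by simp_all
    let ?a = "xs ! (i div length ys) \<otimes>\<^bsub>G1\<^esub> xs ! (j div length ys)"
    let ?b = "ys ! (i mod length ys) \<otimes>\<^bsub>G2\<^esub> ys ! (j mod length ys)"
    have "?a \<in> set xs" "?b \<in> set ys" using d r set by (metis G1.m_closed nth_mem, metis G2.m_closed nth_mem)
    then have p: "pos xs ?a < length xs" "xs ! pos xs ?a = ?a" "pos ys ?b < length ys" "ys ! pos ys ?b = ?b"
      using pos_less by metis+
    have m: "?m i j = pos xs ?a * length ys + pos ys ?b"
      using d r by (simp add: table_mult_def len(2)) (simp add: s t)
    have "pos xs ?a * length ys + pos ys ?b < length xs * length ys"
    proof -
      have "pos xs ?a * length ys + pos ys ?b < Suc (pos xs ?a) * length ys" using p(3) by simp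
      also have "\<dots> \<le> length xs * length ys" using p(1) by (intro mult_le_mono1) simp
      finally show ?thesis .
    qed
    then have lt: "?m i j < ?N" by (simp add: m len)
    have "?m i j div length ys = pos xs ?a" "?m i j mod length ys = pos ys ?b"
      unfolding m using p(3) l by simp_all
    then show ?thesis using lt nthz[OF lt] nthz[OF i] nthz[OF j] p by simp
  qed
  \<comment> \<open>The product is the table on all numbers and not only on the carrier, so it
    equals \<open>table_mult s t\<close> as a function and certificates for \<open>H\<close> are
    literally those that the program checks.\<close>
  define H :: "nat monoid" where "H = \<lparr>carrier = {..<?N}, monoid.mult = ?m, one = pos ?zs \<one>\<^bsub>?G\<^esub>\<rparr>"
  have carrier: "carrier H = {..<?N}" by (simp add: H_def)
  have bij: "bij_betw ((!) ?zs) (carrier H) (carrier ?G)"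
    unfolding carrier using bij_betw_nth[OF distz] setz len(3) by (metis lessThan_iff)
  have iso: "(!) ?zs \<in> iso H ?G"
    using bij mult by (auto simp: iso_def hom_def bij_betw_def H_def)
  have posz: "pos ?zs z < ?N \<and> ?zs ! pos ?zs z = z" if "z \<in> carrier ?G" for z
    using pos_less[of z ?zs] that len(3) unfolding setz by auto
  have "group H"
  proof (rule groupI)
    have inj: "i = j" if "i < ?N" "j < ?N" "?zs ! i = ?zs ! j" for i j
      using that distz len(3) by (simp add: nth_eq_iff_index_eq)
    have zG: "?zs ! i \<in> carrier ?G" if "i < ?N" for i using that nth_mem[of i ?zs] unfolding setz len(3) by simp
    show "\<one>\<^bsub>H\<^esub> \<in> carrier H" using posz[OF G.one_closed] by (simp add: H_def)
    fix i assume i: "i \<in> carrier H"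
    then have iN: "i < ?N" by (simp add: carrier)
    show "\<one>\<^bsub>H\<^esub> \<otimes>\<^bsub>H\<^esub> i = i"
      using posz[OF G.one_closed] mult[of "pos ?zs \<one>\<^bsub>?G\<^esub>" i] iN G.l_one[OF zG[OF iN]] inj by (simp add: H_def)
    show "\<exists>j\<in>carrier H. j \<otimes>\<^bsub>H\<^esub> i = \<one>\<^bsub>H\<^esub>"
    proof
      let ?j = "pos ?zs (inv\<^bsub>?G\<^esub> (?zs ! i))"
      have j: "?j < ?N" "?zs ! ?j = inv\<^bsub>?G\<^esub> (?zs ! i)" using posz G.inv_closed[OF zG[OF iN]] by auto
      then show "?j \<in> carrier H" by (simp add: carrier)
      show "?j \<otimes>\<^bsub>H\<^esub> i = \<one>\<^bsub>H\<^esub>"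
        using mult[OF j(1) iN] j(2) G.l_inv[OF zG[OF iN]] posz[OF G.one_closed] inj by (simp add: H_def)
    qed
    fix j assume "j \<in> carrier H"
    then have jN: "j < ?N" by (simp add: carrier)
    show "i \<otimes>\<^bsub>H\<^esub> j \<in> carrier H" using mult iN jN by (simp add: H_def)
    fix k assume "k \<in> carrier H"
    then have kN: "k < ?N" by (simp add: carrier)
    show "i \<otimes>\<^bsub>H\<^esub> j \<otimes>\<^bsub>H\<^esub> k = i \<otimes>\<^bsub>H\<^esub> (j \<otimes>\<^bsub>H\<^esub> k)"
    proof -
      have ij: "?m i j < ?N" "?zs ! ?m i j = ?zs ! i \<otimes>\<^bsub>?G\<^esub> ?zs ! j" using mult[OF iN jN] by auto
      have jk: "?m j k < ?N" "?zs ! ?m j k = ?zs ! j \<otimes>\<^bsub>?G\<^esub> ?zs ! k" using mult[OF jN kN] by auto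
      have "?zs ! ?m (?m i j) k = ?zs ! ?m i (?m j k)"
        using mult[OF ij(1) kN] mult[OF iN jk(1)] ij(2) jk(2) G.m_assoc[OF zG[OF iN] zG[OF jN] zG[OF kN]] by simp
      then have "?m (?m i j) k = ?m i (?m j k)"
        using mult[OF ij(1) kN] mult[OF iN jk(1)] inj by blast
      then show ?thesis by (simp add: H_def)
    qed
  qed
  then have "nat_group_copy H ?N ?G ?zs"
    using carrier G.is_group distz len(3) iso
    by (simp add: nat_group_copy_def nat_group_def nat_group_axioms_def nat_group_copy_axioms_def)
  then show ?thesis by (rule that) (simp add: H_def)
qed

theorem theorem2p5:
  shows "\<exists>A :: recf. \<forall>p (G\<^sub>1 :: 'a monoid) (G\<^sub>2 :: 'b monoid) xs ys fam.
    Factorial_Ring.prime p \<and> fin_p_group p G\<^sub>1 \<and> fin_p_group p G\<^sub>2 \<and>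
    enumerates xs G\<^sub>1 \<and> enumerates ys G\<^sub>2 \<and> formula_family p G\<^sub>1 G\<^sub>2 fam \<longrightarrow>
    (\<exists>\<Phi>. is_formula (G\<^sub>1 \<times>\<times> G\<^sub>2) \<Phi> \<and>
       computes A [code_group xs G\<^sub>1, code_group ys G\<^sub>2, code_family fam]
         (code_expr (List.product xs ys) \<Phi>))"
proof -
  obtain r where r: "\<And>s t c. \<exists>\<Phi> J. certifies (length s * length t) (table_mult s t) \<Phi> J \<Longrightarrow>
    \<exists>\<Phi> J. certifies (length s * length t) (table_mult s t) \<Phi> J \<and> computes r [enc s, enc t, c] (enc \<Phi>)"
    by (rule formula_search) blast
  show ?thesis
  proof (rule exI[of _ r], intro allI impI, elim conjE)
    fix p :: nat and G1 :: "'a monoid" and G2 :: "'b monoid" and xs ys fam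
    assume p: "Factorial_Ring.prime p" and G1: "fin_p_group p G1" and G2: "fin_p_group p G2"
      and xs: "enumerates xs G1" and ys: "enumerates ys G2" and fam: "formula_family p G1 G2 fam"
    define s where "s = map (\<lambda>x. map (\<lambda>y. pos xs (x \<otimes>\<^bsub>G1\<^esub> y)) xs) xs"
    define t where "t = map (\<lambda>x. map (\<lambda>y. pos ys (x \<otimes>\<^bsub>G2\<^esub> y)) ys) ys"
    obtain H :: "nat monoid" where copy: "nat_group_copy H (length s * length t) (G1 \<times>\<times> G2) (List.product xs ys)"
      and mult: "\<And>i j. monoid.mult H i j = table_mult s t i j"
      by (rule nat_group_copy_product[OF fin_p_groupD(1)[OF G1] fin_p_groupD(1)[OF G2] xs ys s_def t_def]) blast
    interpret nat_group_copy H "length s * length t" "G1 \<times>\<times> G2" "List.product xs ys" by (rule copy)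
    have m: "m = table_mult s t" by (simp add: mult fun_eq_iff)
    have "H \<cong> G1 \<times>\<times> G2" using iso by (auto simp: is_iso_def)
    \<comment> \<open>This guarantees that the search stops: \<open>free set\<close> is the type of
      the elements of the universal ring.\<close>
    then have "detects TYPE(free set) H"
      using detects_iso[OF is_group _ G] detects_formula_family[OF p G1 G2 fam] by (simp add: carrier)
    from certifies_complete[OF this]
    have "\<exists>\<Phi> J. certifies (length s * length t) (table_mult s t) \<Phi> J" unfolding m .
    from r[OF this, of "code_family fam"] obtain \<Phi> J
      where cert: "certifies (length s * length t) (table_mult s t) \<Phi> J"
        and comp: "computes r [enc s, enc t, code_family fam] (enc \<Phi>)" by blast
    note cert' = cert[folded m]
    have "\<forall>v\<in>set \<Phi>. \<forall>l\<in>set (snd v). letter_ok (length s * length t) m l" using cert' by (auto simp: certifies_def)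
    from code_lift[OF this] comp
    have "computes r [code_group xs G1, code_group ys G2, code_family fam]
        (code_expr (List.product xs ys) (lift_expr (List.product xs ys) \<Phi>))"
      by (simp add: code_group_enc s_def t_def)
    with is_formula_lift[OF cert'] show "\<exists>\<Phi>. is_formula (G1 \<times>\<times> G2) \<Phi> \<and>
        computes r [code_group xs G1, code_group ys G2, code_family fam] (code_expr (List.product xs ys) \<Phi>)"
      by blast
  qed
qed

end
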